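(* Let $L:\Omega\times\mathbb{R}\times\mathbb{R}^N\to\mathbb{R}$ be a Carathéodory function. Assume that there exist $\theta^+,\theta^-\in[0,1]$, two sequences $(m_i^+)_{i\geq1},(m_i^-)_{i\geq1}$ of real numbers converging to $+\infty$, a sequence $(\varepsilon_i)_{i\geq1}$ of positive numbers, a summable function $q\in L^1(\Omega)$ and a constant $C\geq0$ such that, for every $i\geq1$, for a.e. $x\in\Omega$, and for every $\xi\in\mathbb{R}^N$, $$\max_{s\in[m_i^+-\varepsilon_i,m_i^+]}\bigl(|L(x,s,\theta^+\xi)|+|L(x,s,-\theta^+\xi)|\bigr)\leq C\inf_{s\in[m_i^+,+\infty)}|L(x,s,\xi)|+q(x)$$ and $$\max_{s\in[-m_i^-,-m_i^-+\varepsilon_i]}\bigl(|L(x,s,\theta^-\xi)|+|L(x,s,-\theta^-\xi)|\bigr)\leq C\inf_{s\in(-\infty,-m_i^-]}|L(x,s,\xi)|+q(x).$$ Then $\mathcal L$ is $L^\infty(\Omega)$-regular at every $u\in\mathcal A$.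
   Context: Let $N\ge 1$, let $\Omega\subset\mathbb{R}^N$ be a bounded open set, $1\leq p\leq N$, and $\varphi\in W^{1,p}(\mathbb{R}^N)\cap L^\infty(\mathbb{R}^N)$. $W^{1,p}_0(\Omega)$ is the closure in $W^{1,p}(\Omega)$ of the $C^1$ functions with compact support in $\Omega$, and $W^{1,p}_\varphi(\Omega)=\varphi+W^{1,p}_0(\Omega)$. A function $L:\Omega\times\mathbb{R}\times\mathbb{R}^N\to\mathbb{R}$ is Carathéodory if $L(\cdot,t,\xi)$ is measurable for every $(t,\xi)$ and $L(x,\cdot,\cdot)$ is continuous for a.e. $x$. Set $\mathcal L(u)=\int_\Omega L(x,u(x),\nabla u(x))\,dx$, and let $\mathcal A=\{u\in W^{1,p}_\varphi(\Omega): L(x,u,\nabla u)\in L^1(\Omega)\}$. The functional $\mathcal L$ is said to be $L^\infty(\Omega)$-regular at $u\in\mathcal A$ if there exists a sequence $(u_k)_{k\ge1}\subset\mathcal A\cap L^\infty(\Omega)$ such that $u_k\to u$ in $W^{1,p}(\Omega)$ and $L(x,u_k,\nabla u_k)\to L(x,u,\nabla u)$ in $L^1(\Omega)$. *)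

theory Defs
  imports "HOL-Analysis.Analysis"
begin

definition partial_deriv :: "'n \<Rightarrow> (real ^ 'n \<Rightarrow> real) \<Rightarrow> real ^ 'n \<Rightarrow> real"
  where "partial_deriv i f x = frechet_derivative f (at x) (axis i 1)"

primrec C_class :: "nat \<Rightarrow> (real ^ 'n \<Rightarrow> real) \<Rightarrow> bool"
  where
    "C_class 0 f \<longleftrightarrow> continuous_on UNIV f"
  | "C_class (Suc k) f \<longleftrightarrow> (\<forall>x. f differentiable (at x)) \<and> (\<forall>i. C_class k (partial_deriv i f))"

text \<open>Functions with compact support in \<open>\<Omega>\<close> are total functions, extended by zero outside \<open>\<Omega>\<close>.\<close>

definition compactly_supported_in :: "(real ^ 'n) set \<Rightarrow> (real ^ 'n \<Rightarrow> real) \<Rightarrow> bool"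
  where "compactly_supported_in \<Omega> f \<longleftrightarrow>
    compact (closure {x. f x \<noteq> 0}) \<and> closure {x. f x \<noteq> 0} \<subseteq> \<Omega>"

definition C1_compact :: "(real ^ 'n) set \<Rightarrow> (real ^ 'n \<Rightarrow> real) set"
  where "C1_compact \<Omega> = {f. C_class 1 f \<and> compactly_supported_in \<Omega> f}"

definition test_functions :: "(real ^ 'n) set \<Rightarrow> (real ^ 'n \<Rightarrow> real) set"
  where "test_functions \<Omega> = {f. (\<forall>k. C_class k f) \<and> compactly_supported_in \<Omega> f}"

text \<open>
  Elements of the spaces below are total functions of which only the restriction to \<open>\<Omega>\<close>,
  up to Lebesgue null sets, is relevant; they represent the usual equivalence classes.
\<close>

definition Lp :: "(real ^ 'n) set \<Rightarrow> real \<Rightarrow> (real ^ 'n \<Rightarrow> 'b::real_normed_vector) set"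
  where "Lp \<Omega> p = {f \<in> borel_measurable (lebesgue_on \<Omega>).
    integrable (lebesgue_on \<Omega>) (\<lambda>x. norm (f x) powr p)}"

definition Linf :: "(real ^ 'n) set \<Rightarrow> (real ^ 'n \<Rightarrow> real) set"
  where "Linf \<Omega> = {f \<in> borel_measurable (lebesgue_on \<Omega>).
    \<exists>M. AE x in lebesgue_on \<Omega>. \<bar>f x\<bar> \<le> M}"

definition locally_integrable ::
    "(real ^ 'n) set \<Rightarrow> (real ^ 'n \<Rightarrow> 'b::{banach, second_countable_topology}) \<Rightarrow> bool"
  where "locally_integrable \<Omega> f \<longleftrightarrow>
    (\<forall>K. compact K \<and> K \<subseteq> \<Omega> \<longrightarrow> integrable (lebesgue_on K) f)"

definition has_weak_gradient ::
    "(real ^ 'n) set \<Rightarrow> (real ^ 'n \<Rightarrow> real) \<Rightarrow> (real ^ 'n \<Rightarrow> real ^ 'n) \<Rightarrow> bool"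
  where "has_weak_gradient \<Omega> u g \<longleftrightarrow>
    locally_integrable \<Omega> u \<and> locally_integrable \<Omega> g \<and>
    (\<forall>\<psi> \<in> test_functions \<Omega>. \<forall>i.
      (LINT x|lebesgue_on \<Omega>. u x * partial_deriv i \<psi> x) =
      - (LINT x|lebesgue_on \<Omega>. g x $ i * \<psi> x))"

text \<open>
  The weak gradient on an open set is unique up to Lebesgue null sets, so the choice of
  representative below is immaterial.
\<close>

definition weak_gradient :: "(real ^ 'n) set \<Rightarrow> (real ^ 'n \<Rightarrow> real) \<Rightarrow> real ^ 'n \<Rightarrow> real ^ 'n"
  where "weak_gradient \<Omega> u = (SOME g. has_weak_gradient \<Omega> u g)"

definition W1p :: "(real ^ 'n) set \<Rightarrow> real \<Rightarrow> (real ^ 'n \<Rightarrow> real) set"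
  where "W1p \<Omega> p = {u \<in> Lp \<Omega> p. \<exists>g \<in> Lp \<Omega> p. has_weak_gradient \<Omega> u g}"

definition W1p_norm :: "(real ^ 'n) set \<Rightarrow> real \<Rightarrow> (real ^ 'n \<Rightarrow> real) \<Rightarrow> real"
  where "W1p_norm \<Omega> p u =
    ((LINT x|lebesgue_on \<Omega>. \<bar>u x\<bar> powr p) +
     (LINT x|lebesgue_on \<Omega>. norm (weak_gradient \<Omega> u x) powr p)) powr (1 / p)"

definition W1p_zero :: "(real ^ 'n) set \<Rightarrow> real \<Rightarrow> (real ^ 'n \<Rightarrow> real) set"
  where "W1p_zero \<Omega> p =
    {u \<in> W1p \<Omega> p. \<forall>e>0. \<exists>w \<in> C1_compact \<Omega>. W1p_norm \<Omega> p (\<lambda>x. w x - u x) < e}"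

definition W1p_boundary ::
    "(real ^ 'n) set \<Rightarrow> real \<Rightarrow> (real ^ 'n \<Rightarrow> real) \<Rightarrow> (real ^ 'n \<Rightarrow> real) set"
  where "W1p_boundary \<Omega> p \<phi> = {u. \<exists>w \<in> W1p_zero \<Omega> p. u = (\<lambda>x. \<phi> x + w x)}"

definition caratheodory ::
    "(real ^ 'n) set \<Rightarrow> (real ^ 'n \<Rightarrow> real \<Rightarrow> real ^ 'n \<Rightarrow> real) \<Rightarrow> bool"
  where "caratheodory \<Omega> L \<longleftrightarrow>
    (\<forall>t \<xi>. (\<lambda>x. L x t \<xi>) \<in> borel_measurable (lebesgue_on \<Omega>)) \<and>
    (AE x in lebesgue_on \<Omega>. continuous_on UNIV (\<lambda>(t, \<xi>). L x t \<xi>))"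

definition lagrangian_along ::
    "(real ^ 'n) set \<Rightarrow> (real ^ 'n \<Rightarrow> real \<Rightarrow> real ^ 'n \<Rightarrow> real) \<Rightarrow> (real ^ 'n \<Rightarrow> real) \<Rightarrow>
      real ^ 'n \<Rightarrow> real"
  where "lagrangian_along \<Omega> L u x = L x (u x) (weak_gradient \<Omega> u x)"

definition admissible ::
    "(real ^ 'n) set \<Rightarrow> real \<Rightarrow> (real ^ 'n \<Rightarrow> real) \<Rightarrow>
      (real ^ 'n \<Rightarrow> real \<Rightarrow> real ^ 'n \<Rightarrow> real) \<Rightarrow> (real ^ 'n \<Rightarrow> real) set"
  where "admissible \<Omega> p \<phi> L =
    {u \<in> W1p_boundary \<Omega> p \<phi>. integrable (lebesgue_on \<Omega>) (lagrangian_along \<Omega> L u)}"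

definition Linf_regular_at ::
    "(real ^ 'n) set \<Rightarrow> real \<Rightarrow> (real ^ 'n \<Rightarrow> real) \<Rightarrow>
      (real ^ 'n \<Rightarrow> real \<Rightarrow> real ^ 'n \<Rightarrow> real) \<Rightarrow> (real ^ 'n \<Rightarrow> real) \<Rightarrow> bool"
  where "Linf_regular_at \<Omega> p \<phi> L u \<longleftrightarrow>
    (\<exists>v :: nat \<Rightarrow> real ^ 'n \<Rightarrow> real.
      (\<forall>k. v k \<in> admissible \<Omega> p \<phi> L \<inter> Linf \<Omega>) \<and>
      (\<lambda>k. W1p_norm \<Omega> p (\<lambda>x. v k x - u x)) \<longlonglongrightarrow> 0 \<and>
      (\<lambda>k. LINT x|lebesgue_on \<Omega>. \<bar>lagrangian_along \<Omega> L (v k) x - lagrangian_along \<Omega> L u x\<bar>)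
        \<longlonglongrightarrow> 0)"

end

theory Submission
  imports Defs
begin

text \<open>
  A truncation \<open>min u m\<close> has gradient \<open>0\<close> where \<open>u > m\<close>, and there the growth condition says in
  general nothing about the Lagrangian. Instead, the values of \<open>u\<close> beyond \<open>m\<^sub>i\<^sup>+\<close> are folded into
  \<open>[m\<^sub>i\<^sup>+ - \<epsilon>\<^sub>i, m\<^sub>i\<^sup>+]\<close> by a sawtooth of slopes \<open>\<plusminus>\<theta>\<^sup>+\<close>, and symmetrically below \<open>- m\<^sub>i\<^sup>-\<close>.
  The resulting piecewise affine map \<open>F\<^sub>i\<close> turns \<open>\<nabla>u\<close> into \<open>\<plusminus>\<theta>\<^sup>\<plusminus> \<nabla>u\<close> on the folded part, so the
  hypothesis bounds the Lagrangian along \<open>F\<^sub>i \<circ> u\<close> by \<open>C |L(x, u, \<nabla>u)| + q\<close>, and dominated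
  convergence gives both limits.

  It remains to see that \<open>F\<^sub>i \<circ> u\<close> keeps the boundary values. Once \<open>F\<^sub>i\<close> is the identity on the range
  of \<open>\<phi>\<close>, \<open>F\<^sub>i(u) - \<phi> = F\<^sub>i(\<phi> + w) - F\<^sub>i(\<phi>)\<close> with \<open>w \<in> W\<^sub>0\<^sup>1\<^sup>,\<^sup>p\<close>. Approximating \<open>w\<close> by functions with
  compact support reduces this to mollification together with the continuity in \<open>W\<^sup>1\<^sup>,\<^sup>p\<close> of composition
  with \<open>F\<^sub>i\<close>. The latter uses that \<open>\<nabla>u = 0\<close> almost everywhere on the preimage of the corners of \<open>F\<^sub>i\<close>,
  which follows by computing the weak gradient of \<open>F\<^sub>i \<circ> u\<close> once with right and once with left derivatives.
\<close>

subsection \<open>Smooth bump functions\<close>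

text \<open>Both signs of \<theta> occur in the growth condition because a continuation with slope
  \<theta> beyond the level would leave the window of width \<epsilon>_i; it has to turn back, and
  each turn changes the sign of the gradient. For every x the value u(x) lies strictly between the
  levels from some index on, so the pointwise limits are eventually constant and the work lies in
  the majorants. The folds fix 0 and are 1-Lipschitz, which gives 2|u| and 2|grad u|.

  The obstacle is the boundary condition. The space with zero boundary values is a closure of C^1
  functions, while F(\<phi> + y) - F(\<phi>) is merely Sobolev even for smooth y; having compact
  support, it can be mollified inside \<Omega>. In the passage from y to w the slopes of F, being
  discontinuous, need not converge where \<phi> + w sits at a corner, and the vanishing gradient
  there compensates. Elsewhere the slope of a piecewise affine F is locally constant, hence
  eventually constant along a convergent sequence.\<close>

definition flat_exp :: "nat \<Rightarrow> real \<Rightarrow> real"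
  where "flat_exp k t = (if t > 0 then exp (- 1 / t) / t ^ k else 0)"

lemma flat_exp_nonneg: "flat_exp k t \<ge> 0"
  by (simp add: flat_exp_def)

lemma tendsto_flat_exp_at_right: "(flat_exp k \<longlongrightarrow> 0) (at_right 0)"
proof -
  have "((\<lambda>t::real. (inverse t) ^ k / exp (inverse t)) \<longlongrightarrow> 0) (at_right 0)"
    by (rule filterlim_compose[OF tendsto_power_div_exp_0 filterlim_inverse_at_top_right])
  moreover have "eventually (\<lambda>t::real. (inverse t) ^ k / exp (inverse t) = flat_exp k t) (at_right 0)"
    by (auto simp: eventually_at_right_field flat_exp_def exp_minus field_simps intro!: exI[of _ 1])
  ultimately show ?thesis
    by (rule Lim_transform_eventually)
qed

text \<open>The powers of \<open>t\<close> in the denominator exist for this formula: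
  differentiation stays inside the family, so smoothness reduces to iterating one rule.\<close>

lemma has_real_derivative_flat_exp:
  "(flat_exp k has_real_derivative flat_exp (k + 2) t - real k * flat_exp (k + 1) t) (at t)"
proof -
  consider "t > 0" | "t < 0" | "t = 0" by linarith
  then show ?thesis
  proof cases
    case 1
    have "((\<lambda>t. exp (- 1 / t) / t ^ k) has_real_derivative
       flat_exp (k + 2) t - real k * flat_exp (k + 1) t) (at t)"
      using 1 by (auto intro!: derivative_eq_intros simp: flat_exp_def)
        (cases k, auto simp: field_simps power2_eq_square)
    then show ?thesis
      by (rule has_field_derivative_transform_within_open[of _ _ _ "{0<..}"])
        (use 1 in \<open>auto simp: flat_exp_def\<close>)
  next
    case 2
    have "((\<lambda>t. 0) has_real_derivative 0) (at t)" by simp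
    then have "(flat_exp k has_real_derivative 0) (at t)"
      by (rule has_field_derivative_transform_within_open[of _ _ _ "{..<0}"])
        (use 2 in \<open>auto simp: flat_exp_def\<close>)
    then show ?thesis using 2 by (simp add: flat_exp_def)
  next
    case 3
    \<comment> \<open>The right difference quotient of \<open>flat_exp k\<close> at 0 is
      \<open>flat_exp (Suc k)\<close>. From the left the function is identically 0, and 0 is also
      the value of the claimed derivative at 0.\<close>
    have R: "((\<lambda>h. (flat_exp k (0 + h) - flat_exp k 0) / h) \<longlongrightarrow> 0) (at_right 0)"
      by (rule Lim_transform_eventually[OF tendsto_flat_exp_at_right[of "Suc k"]])
        (auto simp: eventually_at_right_field flat_exp_def intro!: exI[of _ 1])
    have L: "((\<lambda>h. (flat_exp k (0 + h) - flat_exp k 0) / h) \<longlongrightarrow> 0) (at_left 0)"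
      by (rule Lim_transform_eventually[OF tendsto_const[of 0]])
        (auto simp: eventually_at_left_field flat_exp_def intro!: exI[of _ "-1"])
    show ?thesis
      unfolding 3 DERIV_def using filterlim_split_at[OF L R] by (simp add: flat_exp_def)
  qed
qed

lemma has_derivative_flat_exp_affine:
  fixes i :: "'n::finite" and x :: "real ^ 'n"
  shows "((\<lambda>x. flat_exp k (c * x $ i + d)) has_derivative
    (\<lambda>h. (flat_exp (k + 2) (c * x $ i + d) - real k * flat_exp (k + 1) (c * x $ i + d)) * (c * h $ i)))
    (at x)"
  by (rule has_derivative_compose[where g = "flat_exp k" and f = "\<lambda>x. c * x $ i + d",
        OF _ has_real_derivative_flat_exp[unfolded has_field_derivative_def]])
    (auto intro!: derivative_eq_intros bounded_linear_imp_has_derivative bounded_linear_vec_nth)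

text \<open>A set of functions closed under partial derivatives. Products of bump profiles in
  different coordinates lie in it, and the closedness gives every \<open>C_class k\<close> by a
  short induction on \<open>k\<close>.\<close>

inductive_set flat_exp_algebra :: "(real ^ 'n::finite \<Rightarrow> real) set" where
  gen: "(\<lambda>x. flat_exp k (c * x $ i + d)) \<in> flat_exp_algebra"
| const: "(\<lambda>x. c) \<in> flat_exp_algebra"
| add: "f \<in> flat_exp_algebra \<Longrightarrow> g \<in> flat_exp_algebra \<Longrightarrow> (\<lambda>x. f x + g x) \<in> flat_exp_algebra"
| mult: "f \<in> flat_exp_algebra \<Longrightarrow> g \<in> flat_exp_algebra \<Longrightarrow> (\<lambda>x. f x * g x) \<in> flat_exp_algebra"

lemma flat_exp_algebra_derivative:
  assumes "f \<in> flat_exp_algebra"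
  shows "\<exists>D. (\<forall>x. (f has_derivative D x) (at x)) \<and> (\<forall>j. (\<lambda>x. D x (axis j 1)) \<in> flat_exp_algebra)"
  using assms
proof induction
  case (gen k c i d)
  show ?case
  proof (intro exI conjI allI)
    \<comment> \<open>The subtraction is written as a sum with the constant factor
      \<open>- real k\<close>, since the algebra offers only constants, sums and products.\<close>
    show "((\<lambda>x. flat_exp k (c * x $ i + d)) has_derivative
      (\<lambda>h. (flat_exp (k + 2) (c * x $ i + d) + (- real k) * flat_exp (k + 1) (c * x $ i + d)) * (c * h $ i)))
      (at x)" for x
      using has_derivative_flat_exp_affine[of k c i d x] by simp
  next
    fix j :: 'a
    show "(\<lambda>x. (flat_exp (k + 2) (c * x $ i + d) + (- real k) * flat_exp (k + 1) (c * x $ i + d)) *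
        (c * axis j 1 $ i)) \<in> flat_exp_algebra"
      by (intro flat_exp_algebra.intros)
  qed
next
  case (const c)
  then show ?case
    by (intro exI[of _ "\<lambda>x h. 0"]) (auto intro: flat_exp_algebra.intros)
next
  case (add f g)
  then obtain D E where D: "\<And>x. (f has_derivative D x) (at x)" "\<And>j. (\<lambda>x. D x (axis j 1)) \<in> flat_exp_algebra"
    and E: "\<And>x. (g has_derivative E x) (at x)" "\<And>j. (\<lambda>x. E x (axis j 1)) \<in> flat_exp_algebra"
    by blast
  then show ?case
    by (intro exI[of _ "\<lambda>x h. D x h + E x h"])
      (auto intro!: flat_exp_algebra.intros has_derivative_add)
next
  case (mult f g)
  then obtain D E where D: "\<And>x. (f has_derivative D x) (at x)" "\<And>j. (\<lambda>x. D x (axis j 1)) \<in> flat_exp_algebra"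
    and E: "\<And>x. (g has_derivative E x) (at x)" "\<And>j. (\<lambda>x. E x (axis j 1)) \<in> flat_exp_algebra"
    by blast
  then show ?case using mult
    by (intro exI[of _ "\<lambda>x h. f x * E x h + D x h * g x"])
      (auto intro!: flat_exp_algebra.intros has_derivative_mult)
qed

lemma partial_deriv_eq:
  "(f has_derivative D) (at x) \<Longrightarrow> partial_deriv i f x = D (axis i 1)"
  unfolding partial_deriv_def by (simp flip: frechet_derivative_at)

lemma flat_exp_algebra_partial_deriv:
  assumes "f \<in> flat_exp_algebra"
  shows "f differentiable (at x)" "partial_deriv i f \<in> flat_exp_algebra"
proof -
  obtain D where D: "\<And>x. (f has_derivative D x) (at x)" "\<And>j. (\<lambda>x. D x (axis j 1)) \<in> flat_exp_algebra"
    using flat_exp_algebra_derivative[OF assms] by blast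
  show "f differentiable (at x)" using D(1) by (auto simp: differentiable_def)
  have "partial_deriv i f = (\<lambda>x. D x (axis i 1))"
    by (rule ext) (rule partial_deriv_eq[OF D(1)])
  then show "partial_deriv i f \<in> flat_exp_algebra" using D(2) by simp
qed

lemma C_class_flat_exp_algebra:
  "f \<in> flat_exp_algebra \<Longrightarrow> C_class k f"
proof (induction k arbitrary: f)
  case 0
  then show ?case
    using flat_exp_algebra_partial_deriv(1)
    by (auto intro!: differentiable_imp_continuous_on simp: differentiable_on_def intro: differentiable_at_withinI)
next
  case (Suc k)
  then show ?case by (simp add: flat_exp_algebra_partial_deriv)
qed

lemma flat_exp_algebra_prod:
  assumes "finite I" "\<And>i. i \<in> I \<Longrightarrow> f i \<in> flat_exp_algebra"
  shows "(\<lambda>x. \<Prod>i\<in>I. f i x) \<in> flat_exp_algebra"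
  using assms by (induction I) (auto intro: flat_exp_algebra.intros)

lemma exists_bump:
  fixes r :: real
  assumes "r > 0"
  obtains f :: "real ^ 'n \<Rightarrow> real" where "\<And>k. C_class k f" "\<And>x. f x \<ge> 0" "f 0 > 0"
    "\<And>x. f x \<noteq> 0 \<Longrightarrow> norm x < r"
proof -
  \<comment> \<open>The support will lie in the cube \<open>\<bar>x $ i\<bar> < s\<close>, where the
    l1 norm, which dominates the Euclidean norm, is below \<open>CARD('n) * s = r\<close>.\<close>
  define s where "s = r / real CARD('n)"
  have s: "s > 0" using assms by (simp add: s_def)
  \<comment> \<open>The coefficients \<open>1\<close> and \<open>- 1\<close> bring both profiles
    into the form of the generators; their product is nonzero exactly for
    \<open>- s < x $ i < s\<close>.\<close>
  define f :: "real ^ 'n \<Rightarrow> real"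
    where "f x = (\<Prod>i\<in>UNIV. flat_exp 0 (1 * x $ i + s) * flat_exp 0 ((- 1) * x $ i + s))" for x
  have "f \<in> flat_exp_algebra"
    unfolding f_def by (intro flat_exp_algebra_prod flat_exp_algebra.intros finite)
  then have "C_class k f" for k by (rule C_class_flat_exp_algebra)
  moreover have "f x \<ge> 0" for x
    unfolding f_def by (intro prod_nonneg mult_nonneg_nonneg flat_exp_nonneg ballI)
  moreover have "f 0 > 0"
    unfolding f_def using s by (auto simp: flat_exp_def intro!: prod_pos)
  moreover have "norm x < r" if "f x \<noteq> 0" for x
  proof -
    have "\<bar>x $ i\<bar> < s" for i
    proof -
      have "flat_exp 0 (1 * x $ i + s) * flat_exp 0 ((- 1) * x $ i + s) \<noteq> 0"
        using that by (auto simp: f_def)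
      then show ?thesis by (auto simp: flat_exp_def split: if_splits)
    qed
    then have "(\<Sum>i\<in>UNIV. \<bar>x $ i\<bar>) < (\<Sum>i\<in>(UNIV::'n set). s)"
      by (intro sum_strict_mono) auto
    also have "\<dots> = r" by (simp add: s_def)
    finally show ?thesis using norm_le_l1_cart[of x] by linarith
  qed
  ultimately show ?thesis using that by blast
qed

subsection \<open>Mollifiers\<close>

text \<open>Dominated convergence with a majorant that is fixed only up to an error
  \<open>a n\<close> vanishing in L1. The part of \<open>norm (f n x)\<close> below
  \<open>\<bar>b x\<bar>\<close> has a fixed majorant, and the excess is at most
  \<open>\<bar>a n x\<bar>\<close>.\<close>

lemma tendsto_integral_norm_0_dominated:
  fixes f :: "nat \<Rightarrow> 'a \<Rightarrow> 'b::{banach, second_countable_topology}" and a :: "nat \<Rightarrow> 'a \<Rightarrow> real"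
  assumes f: "\<And>n. f n \<in> borel_measurable M"
    and a: "\<And>n. integrable M (a n)" "(\<lambda>n. LINT x|M. \<bar>a n x\<bar>) \<longlonglongrightarrow> 0"
    and b: "integrable M b"
    and lim: "AE x in M. (\<lambda>n. f n x) \<longlonglongrightarrow> 0"
    and bound: "\<And>n. AE x in M. norm (f n x) \<le> \<bar>a n x\<bar> + b x"
  shows "(\<lambda>n. LINT x|M. norm (f n x)) \<longlonglongrightarrow> 0"
proof -
  note [measurable] = f borel_measurable_integrable[OF a(1)] borel_measurable_integrable[OF b]
  define m where "m n x = min (norm (f n x)) \<bar>b x\<bar>" for n x
  have m_meas[measurable]: "m n \<in> borel_measurable M" for n
    unfolding m_def by measurable
  have m_int: "integrable M (m n)" for n
    by (rule Bochner_Integration.integrable_bound[OF b]) (auto simp: m_def)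
  have "(\<lambda>n. LINT x|M. m n x) \<longlonglongrightarrow> (LINT x|M. 0)"
  proof (rule integral_dominated_convergence[where w = "\<lambda>x. \<bar>b x\<bar>"])
    show "AE x in M. (\<lambda>n. m n x) \<longlonglongrightarrow> 0"
      using lim
    proof eventually_elim
      case (elim x)
      then have "(\<lambda>n. norm (f n x)) \<longlonglongrightarrow> 0" by (simp add: tendsto_norm_zero)
      show ?case
        by (rule tendsto_sandwich[OF _ _ tendsto_const[of 0] \<open>(\<lambda>n. norm (f n x)) \<longlonglongrightarrow> 0\<close>])
          (auto simp: m_def)
    qed
  qed (use b in \<open>auto simp: m_def\<close>)
  then have lim_bound: "(\<lambda>n. (LINT x|M. m n x) + (LINT x|M. \<bar>a n x\<bar>)) \<longlonglongrightarrow> 0"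
    using tendsto_add[OF _ a(2)] by fastforce
  have "(LINT x|M. norm (f n x)) \<le> (LINT x|M. m n x) + (LINT x|M. \<bar>a n x\<bar>)" for n
  proof -
    have "(LINT x|M. norm (f n x)) \<le> (LINT x|M. m n x + \<bar>a n x\<bar>)"
    proof (rule integral_mono_AE')
      show "AE x in M. 0 \<le> m n x + \<bar>a n x\<bar>" by (simp add: m_def)
      show "AE x in M. norm (f n x) \<le> m n x + \<bar>a n x\<bar>"
        using bound[of n] by eventually_elim (auto simp: m_def)
    qed (use m_int a in auto)
    also have "\<dots> = (LINT x|M. m n x) + (LINT x|M. \<bar>a n x\<bar>)"
      using m_int a by (simp add: Bochner_Integration.integral_add)
    finally show ?thesis .
  qed
  then show ?thesis
    by (intro tendsto_sandwich[OF _ _ tendsto_const[of 0] lim_bound]) auto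
qed

text \<open>Convergence in L1 yields pointwise convergence only along subsequences; this principle
  leads back to the whole sequence.\<close>

lemma LIMSEQ_subsequence_principle:
  fixes a :: "nat \<Rightarrow> 'a::metric_space"
  assumes "\<And>r. strict_mono (r :: nat \<Rightarrow> nat) \<Longrightarrow> \<exists>s :: nat \<Rightarrow> nat. strict_mono s \<and> (\<lambda>n. a (r (s n))) \<longlonglongrightarrow> l"
  shows "a \<longlonglongrightarrow> l"
proof (rule ccontr)
  assume "\<not> a \<longlonglongrightarrow> l"
  then obtain e where e: "e > 0" "\<And>N. \<exists>n\<ge>N. dist (a n) l \<ge> e"
    unfolding lim_sequentially by (meson linorder_not_le)
  have "infinite {n. dist (a n) l \<ge> e}"
    unfolding infinite_nat_iff_unbounded_le using e(2) by auto
  from infinite_enumerate[OF this] obtain r :: "nat \<Rightarrow> nat"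
    where r: "strict_mono r" "\<And>n. dist (a (r n)) l \<ge> e" by auto
  from assms[OF r(1)] obtain s where "(\<lambda>n. a (r (s n))) \<longlonglongrightarrow> l" by blast
  then obtain N where "\<And>n. n \<ge> N \<Longrightarrow> dist (a (r (s n))) l < e"
    using e(1) unfolding lim_sequentially by blast
  then show False using r(2)[of "s N"] by (meson linorder_not_le order_refl)
qed

section \<open>Continuous functions, compact support and partial derivatives\<close>

lemma borel_measurable_lebesgue_continuous:
  fixes f :: "'a::euclidean_space \<Rightarrow> 'b::topological_space"
  assumes "continuous_on UNIV f"
  shows "f \<in> borel_measurable lebesgue"
  using borel_measurable_continuous_onI[OF assms] by (simp add: measurable_completion)

lemma C_class_imp_continuous:
  assumes "C_class k f"
  shows "continuous_on UNIV f"
  using assms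
  by (cases k) (auto intro!: differentiable_imp_continuous_on simp: differentiable_on_def
      intro: differentiable_at_withinI)

lemma C_class_partial_deriv_continuous:
  assumes "C_class (Suc k) f"
  shows "continuous_on UNIV (partial_deriv i f)"
  using assms by (auto intro: C_class_imp_continuous)

lemma bounded_of_compact_support:
  fixes f :: "'a::t2_space \<Rightarrow> 'b::real_normed_vector"
  assumes "continuous_on UNIV f" "compact K" "\<And>x. x \<notin> K \<Longrightarrow> f x = 0"
  obtains B where "B > 0" "\<And>x. norm (f x) \<le> B"
proof -
  have "bounded (f ` K)"
    using assms(1,2) by (meson compact_continuous_image compact_imp_bounded continuous_on_subset subset_UNIV)
  then obtain B where B: "B > 0" "\<And>x. x \<in> K \<Longrightarrow> norm (f x) \<le> B"
    unfolding bounded_pos by auto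
  have "norm (f x) \<le> B" for x
    using B assms(3)[of x] by (cases "x \<in> K") auto
  with B(1) show ?thesis by (rule that)
qed

lemma has_derivative_partial_deriv:
  fixes f :: "real ^ 'n \<Rightarrow> real"
  assumes "f differentiable (at x)"
  shows "(f has_derivative (\<lambda>h. \<Sum>i\<in>UNIV. partial_deriv i f x * h $ i)) (at x)"
proof -
  let ?D = "frechet_derivative f (at x)"
  have D: "(f has_derivative ?D) (at x)"
    using assms by (simp add: frechet_derivative_works)
  then have lin: "linear ?D" by (rule has_derivative_linear)
  have "?D h = (\<Sum>i\<in>UNIV. partial_deriv i f x * h $ i)" for h
  proof -
    have "?D h = ?D (\<Sum>i\<in>UNIV. h $ i *\<^sub>R axis i 1)"
      using basis_expansion[of h] by (simp add: scalar_mult_eq_scaleR)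
    also have "\<dots> = (\<Sum>i\<in>UNIV. h $ i *\<^sub>R ?D (axis i 1))"
      by (simp add: linear_sum[OF lin] linear_scale[OF lin] o_def)
    also have "\<dots> = (\<Sum>i\<in>UNIV. partial_deriv i f x * h $ i)"
      by (simp add: partial_deriv_def mult.commute)
    finally show ?thesis .
  qed
  then have "?D = (\<lambda>h. \<Sum>i\<in>UNIV. partial_deriv i f x * h $ i)" ..
  with D show ?thesis by simp
qed

lemma partial_deriv_eq_0_outside:
  fixes f :: "real ^ 'n \<Rightarrow> real"
  assumes "closed K" "\<And>y. y \<notin> K \<Longrightarrow> f y = 0" "x \<notin> K"
  shows "partial_deriv i f x = 0"
proof -
  have "(f has_derivative (\<lambda>_. 0)) (at x)"
    by (rule has_derivative_transform_within_open[of "\<lambda>_. 0" _ _ _ "- K"]) (use assms in auto)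
  then show ?thesis by (rule partial_deriv_eq)
qed

definition mollifier :: "real \<Rightarrow> (real ^ 'n \<Rightarrow> real) \<Rightarrow> bool"
  where "mollifier r \<rho> \<longleftrightarrow> (\<forall>k. C_class k \<rho>) \<and> (\<forall>x. \<rho> x \<ge> 0) \<and> (\<forall>x. \<rho> x \<noteq> 0 \<longrightarrow> norm x < r) \<and>
    integral\<^sup>L lebesgue \<rho> = 1"

text \<open>Integrability follows from the mass 1, because the integral of a nonintegrable function
  is 0 by convention.\<close>

lemma mollifierD:
  assumes "mollifier r \<rho>"
  shows "C_class k \<rho>" "\<rho> x \<ge> 0" "\<rho> x \<noteq> 0 \<Longrightarrow> norm x < r" "integral\<^sup>L lebesgue \<rho> = 1"
    "integrable lebesgue \<rho>"
  using assms not_integrable_integral_eq[of lebesgue \<rho>] by (auto simp: mollifier_def)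

lemma mollifier_mono: "mollifier r \<rho> \<Longrightarrow> r \<le> s \<Longrightarrow> mollifier s \<rho>"
  by (force simp: mollifier_def)

lemma integrable_continuous_compact_support:
  fixes f :: "'a::euclidean_space \<Rightarrow> 'b::euclidean_space"
  assumes "continuous_on UNIV f" "compact K" "\<And>x. x \<notin> K \<Longrightarrow> f x = 0"
  shows "integrable lebesgue f"
proof -
  obtain B where B: "\<And>x. norm (f x) \<le> B" using bounded_of_compact_support[OF assms] by blast
  have fin: "emeasure lebesgue K < \<infinity>" using assms(2) emeasure_compact_finite[of K] lmeasurable_compact fmeasurableD2 less_top by (metis infinity_ennreal_def)
  have "integrable lebesgue (\<lambda>x. B * indicator K x :: real)"
    using fin assms(2) by (intro integrable_mult_right integrable_real_indicator) (auto simp: borel_compact)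
  then show ?thesis
    by (rule Bochner_Integration.integrable_bound)
      (use B assms(3) borel_measurable_lebesgue_continuous[OF assms(1)] in
        \<open>auto simp: indicator_def intro!: AE_I2 order_trans[OF B] \<close>)
qed

text \<open>The factor \<open>c\<close> serves the induction: a partial derivative of a reflected
  function is again a reflected function, with the opposite sign.\<close>

lemma C_class_scale_reflect:
  "C_class k f \<Longrightarrow> C_class k (\<lambda>y. c * f (a - y))"
proof (induction k arbitrary: f c)
  case 0
  then show ?case by (auto intro!: continuous_intros continuous_on_compose2[of UNIV f])
next
  case (Suc k)
  have der: "((\<lambda>y. c * f (a - y)) has_derivative
      (\<lambda>h. c * (\<Sum>i\<in>UNIV. partial_deriv i f (a - x) * (- h) $ i))) (at x)" for x
    using Suc.prems
    by (intro has_derivative_mult_right has_derivative_compose[where g = f and f = "\<lambda>y. a - y",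
        OF _ has_derivative_partial_deriv]) (auto intro!: derivative_eq_intros)
  have "partial_deriv i (\<lambda>y. c * f (a - y)) = (\<lambda>y. (- c) * partial_deriv i f (a - y))" for i
    by (rule ext, subst partial_deriv_eq[OF der]) (simp add: axis_def if_distrib sum.delta cong: if_cong)
  moreover have "C_class k (\<lambda>y. (- c) * partial_deriv i f (a - y))" for i
    using Suc.IH[of "partial_deriv i f" "- c"] Suc.prems by simp
  ultimately show ?case using der by (auto simp: differentiable_def)
qed

lemma partial_deriv_reflect:
  assumes "f differentiable (at (a - x))"
  shows "partial_deriv i (\<lambda>y. f (a - y)) x = - partial_deriv i f (a - x)"
proof -
  have der: "((\<lambda>y. f (a - y)) has_derivative
      (\<lambda>h. (\<Sum>i\<in>UNIV. partial_deriv i f (a - x) * (- h) $ i))) (at x)"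
    using assms
    by (intro has_derivative_compose[where g = f and f = "\<lambda>y. a - y",
        OF _ has_derivative_partial_deriv]) (auto intro!: derivative_eq_intros)
  show ?thesis
    by (subst partial_deriv_eq[OF der]) (simp add: axis_def if_distrib sum.delta sum_negf cong: if_cong)
qed

lemma exists_mollifier:
  assumes "r > 0"
  obtains \<rho> :: "real ^ 'n \<Rightarrow> real" where "mollifier r \<rho>"
proof -
  obtain f :: "real ^ 'n \<Rightarrow> real" where f: "\<And>k. C_class k f" "\<And>x. f x \<ge> 0" "f 0 > 0"
    "\<And>x. f x \<noteq> 0 \<Longrightarrow> norm x < r"
    using exists_bump[OF assms] by blast
  have cont: "continuous_on UNIV f" using f(1) C_class_imp_continuous by blast
  have "integrable lebesgue f"
    by (rule integrable_continuous_compact_support[OF cont, of "cball 0 r"]) (use f(4) in force)+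
  moreover have "integral\<^sup>L lebesgue f \<noteq> 0"
  proof
    assume "integral\<^sup>L lebesgue f = 0"
    then have "AE x in lebesgue. f x = 0"
      using \<open>integrable lebesgue f\<close> f(2) by (simp add: integral_nonneg_eq_0_iff_AE)
    then have "{x. f x \<noteq> 0} \<in> null_sets lebesgue"
      by (simp add: completion.AE_iff_null_sets)
    then have "negligible {x. f x \<noteq> 0}" by (simp add: negligible_iff_null_sets)
    moreover have "open {x. f x \<noteq> 0}"
      using open_Collect_neq[OF cont continuous_on_const[of UNIV 0]] by simp
    ultimately show False using open_not_negligible f(3) by fastforce
  qed
  moreover have "integral\<^sup>L lebesgue f \<ge> 0" using f(2) by simp
  ultimately have pos: "integral\<^sup>L lebesgue f > 0" by linarith
  define c where "c = inverse (integral\<^sup>L lebesgue f)"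
  \<comment> \<open>Two reflections at 0 cancel and leave the multiplication by
    \<open>c\<close>.\<close>
  have f': "C_class k (\<lambda>x. f (0 - x))" for k
    using C_class_scale_reflect[OF f(1), of k 1 0] by simp
  have "C_class k (\<lambda>x. c * f x)" for k
    using C_class_scale_reflect[OF f', of k c 0] by simp
  then have "mollifier r (\<lambda>x. c * f x)"
    using pos f by (auto simp: mollifier_def c_def)
  then show ?thesis by (rule that)
qed

subsection \<open>Convolution with a mollifier\<close>

text \<open>The shift sits in the kernel, so that regularity in \<open>x\<close> comes from
  \<open>\<rho>\<close> alone. Values in any Euclidean space let a function and its gradient be
  smoothed alike.\<close>

definition convol :: "(real ^ 'n \<Rightarrow> real) \<Rightarrow> (real ^ 'n \<Rightarrow> 'b::euclidean_space) \<Rightarrow> real ^ 'n \<Rightarrow> 'b"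
  where "convol \<rho> f x = (LINT y|lebesgue. \<rho> (x - y) *\<^sub>R f y)"

lemma borel_measurable_lebesgue_reflect:
  fixes \<rho> :: "real ^ 'n \<Rightarrow> real"
  assumes "continuous_on UNIV \<rho>"
  shows "(\<lambda>y. \<rho> (x - y)) \<in> borel_measurable lebesgue"
  by (rule borel_measurable_lebesgue_continuous, rule continuous_on_compose2[OF assms])
    (auto intro!: continuous_intros)

lemma integrable_convol:
  fixes f :: "real ^ 'n \<Rightarrow> 'b::euclidean_space"
  assumes "continuous_on UNIV \<rho>" "\<And>x. \<bar>\<rho> x\<bar> \<le> B" "integrable lebesgue f"
  shows "integrable lebesgue (\<lambda>y. \<rho> (x - y) *\<^sub>R f y)"
proof (rule Bochner_Integration.integrable_bound)
  show "integrable lebesgue (\<lambda>y. B *\<^sub>R f y)" using assms by simp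
  show "(\<lambda>y. \<rho> (x - y) *\<^sub>R f y) \<in> borel_measurable lebesgue"
    using borel_measurable_lebesgue_reflect[OF assms(1)] assms(3) by measurable
  show "AE y in lebesgue. norm (\<rho> (x - y) *\<^sub>R f y) \<le> norm (B *\<^sub>R f y)"
    using assms(2) by (auto intro!: AE_I2 mult_right_mono intro: order_trans[OF _ abs_ge_self])
qed

lemma continuous_convol:
  fixes f :: "real ^ 'n \<Rightarrow> 'b::euclidean_space"
  assumes \<rho>: "continuous_on UNIV \<rho>" "\<And>x. \<bar>\<rho> x\<bar> \<le> B" and f: "integrable lebesgue f"
  shows "continuous_on UNIV (convol \<rho> f)"
proof (rule continuous_on_sequentiallyI)
  fix u :: "nat \<Rightarrow> real ^ 'n" and a
  assume u: "u \<longlonglongrightarrow> a"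
  show "(\<lambda>n. convol \<rho> f (u n)) \<longlonglongrightarrow> convol \<rho> f a"
    unfolding convol_def
  proof (rule integral_dominated_convergence[where w = "\<lambda>y. B * norm (f y)"])
    show "AE y in lebesgue. (\<lambda>n. \<rho> (u n - y) *\<^sub>R f y) \<longlonglongrightarrow> \<rho> (a - y) *\<^sub>R f y"
      using u by (intro AE_I2 tendsto_intros continuous_on_tendsto_compose[OF \<rho>(1)]) auto
  qed (use integrable_convol[OF \<rho> f] assms in \<open>auto intro!: mult_right_mono\<close>)
qed

text \<open>Differentiation under the integral sign: the first-order remainder of the kernel,
  divided by \<open>norm h\<close>, tends to 0 pointwise and is bounded, so a multiple of
  \<open>\<bar>u\<bar>\<close> is a majorant.\<close>

lemma convol_has_derivative:
  fixes u :: "real ^ 'n \<Rightarrow> real"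
  assumes \<rho>: "C_class 1 \<rho>" "compact K" "\<And>x. x \<notin> K \<Longrightarrow> \<rho> x = 0" and u: "integrable lebesgue u"
  shows "(convol \<rho> u has_derivative (\<lambda>h. \<Sum>i\<in>UNIV. convol (partial_deriv i \<rho>) u x * h $ i)) (at x)"
proof -
  have cont: "continuous_on UNIV \<rho>" "continuous_on UNIV (partial_deriv i \<rho>)" for i
    using \<rho>(1) C_class_imp_continuous[of 1 \<rho>] C_class_partial_deriv_continuous[of 0 \<rho>] by auto
  obtain B0 where B0: "\<And>x. \<bar>\<rho> x\<bar> \<le> B0"
    using bounded_of_compact_support[OF cont(1) \<rho>(2,3)] by auto
  have "\<exists>B. \<forall>x. \<bar>partial_deriv i \<rho> x\<bar> \<le> B" for i
    by (rule bounded_of_compact_support[OF cont(2)[of i] \<rho>(2)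
        partial_deriv_eq_0_outside[OF compact_imp_closed[OF \<rho>(2)] \<rho>(3)]]) auto
  then obtain B where B: "\<And>i x. \<bar>partial_deriv i \<rho> x\<bar> \<le> B i" by metis
  \<comment> \<open>\<open>S\<close> bounds the derivative of \<open>\<rho>\<close> as a linear form
    at every point, hence is also a Lipschitz constant of \<open>\<rho>\<close>; the remainder
    quotient is therefore at most \<open>2 * S\<close>.\<close>
  define S where "S = (\<Sum>i\<in>UNIV. B i)"
  define D where "D z h = (\<Sum>i\<in>UNIV. partial_deriv i \<rho> z * h $ i)" for z h
  have D: "(\<rho> has_derivative D z) (at z)" for z
    unfolding D_def using \<rho>(1) by (intro has_derivative_partial_deriv) simp
  have D_bound: "\<bar>D z h\<bar> \<le> S * norm h" for z h
    unfolding D_def S_def sum_distrib_right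
    by (intro order_trans[OF sum_abs] sum_mono)
      (auto simp: abs_mult intro!: mult_mono B component_le_norm_cart order_trans[OF _ B])
  have lip: "\<bar>\<rho> (z + h) - \<rho> z\<bar> \<le> S * norm h" for z h
  proof -
    have "norm (\<rho> (z + h) - \<rho> z) \<le> S * norm (z + h - z)"
      by (rule differentiable_bound[of UNIV _ "\<lambda>z. D z"])
        (use D D_bound in \<open>auto intro!: onorm_le\<close>)
    then show ?thesis by simp
  qed
  note int = integrable_convol[OF cont(1) B0 u] integrable_convol[OF cont(2) B u]
  have D_int: "(\<Sum>i\<in>UNIV. convol (partial_deriv i \<rho>) u x * h $ i) = (LINT y|lebesgue. D (x - y) h * u y)"
    and D_integrable: "integrable lebesgue (\<lambda>y. D (x - y) h * u y)" for h
  proof -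
    have *: "(\<lambda>y. D (x - y) h * u y) = (\<lambda>y. \<Sum>i\<in>UNIV. (partial_deriv i \<rho> (x - y) *\<^sub>R u y) * h $ i)"
      by (auto simp: D_def sum_distrib_left sum_distrib_right mult_ac intro!: sum.cong)
    show "integrable lebesgue (\<lambda>y. D (x - y) h * u y)"
      unfolding * using int(2) by (intro Bochner_Integration.integrable_sum integrable_mult_left)
    show "(\<Sum>i\<in>UNIV. convol (partial_deriv i \<rho>) u x * h $ i) = (LINT y|lebesgue. D (x - y) h * u y)"
      unfolding * convol_def using int(2)
      by (subst Bochner_Integration.integral_sum) auto
  qed
  define R where "R h y = inverse (norm h) *
    (\<rho> (x + h - y) *\<^sub>R u y - \<rho> (x - y) *\<^sub>R u y - D (x - y) h * u y)" for h y
  have R_eq: "R h y = (\<rho> (x + h - y) - \<rho> (x - y) - D (x - y) h) / norm h * u y" for h y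
    unfolding R_def divide_inverse by (simp add: algebra_simps)
  have R_int: "integrable lebesgue (R h)" for h
    unfolding R_def using int(1) D_integrable
    by (intro integrable_mult_right Bochner_Integration.integrable_diff)
  have quot: "(convol \<rho> u (x + h) - convol \<rho> u x - (\<Sum>i\<in>UNIV. convol (partial_deriv i \<rho>) u x * h $ i)) / norm h
      = (LINT y|lebesgue. R h y)" for h
  proof -
    have "(LINT y|lebesgue. R h y) =
        inverse (norm h) * (LINT y|lebesgue. \<rho> (x + h - y) *\<^sub>R u y - \<rho> (x - y) *\<^sub>R u y - D (x - y) h * u y)"
      unfolding R_def by (rule integral_mult_right_zero)
    also have "(LINT y|lebesgue. \<rho> (x + h - y) *\<^sub>R u y - \<rho> (x - y) *\<^sub>R u y - D (x - y) h * u y) =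
        (LINT y|lebesgue. \<rho> (x + h - y) *\<^sub>R u y - \<rho> (x - y) *\<^sub>R u y) - (LINT y|lebesgue. D (x - y) h * u y)"
      by (intro Bochner_Integration.integral_diff Bochner_Integration.integrable_diff int D_integrable)
    also have "(LINT y|lebesgue. \<rho> (x + h - y) *\<^sub>R u y - \<rho> (x - y) *\<^sub>R u y) =
        convol \<rho> u (x + h) - convol \<rho> u x"
      unfolding convol_def by (intro Bochner_Integration.integral_diff int)
    finally show ?thesis unfolding D_int by (simp add: divide_inverse mult.commute)
  qed
  \<comment> \<open>Dominated convergence speaks of sequences, so the limit at 0 is tested along
    sequences of nonzero increments.\<close>
  have "((\<lambda>h. LINT y|lebesgue. R h y) \<longlongrightarrow> 0) (at 0)"
    unfolding tendsto_at_iff_sequentially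
  proof (intro allI impI)
    fix X :: "nat \<Rightarrow> real ^ 'n"
    assume X: "\<forall>i. X i \<in> UNIV - {0}" "X \<longlonglongrightarrow> 0"
    have "(\<lambda>n. LINT y|lebesgue. R (X n) y) \<longlonglongrightarrow> (LINT y|(lebesgue :: (real ^ 'n) measure). (0 :: real))"
    proof (rule integral_dominated_convergence[where w = "\<lambda>y. (2 * S) * \<bar>u y\<bar>"])
      have "(\<lambda>n. R (X n) y) \<longlonglongrightarrow> 0" for y
      proof -
        have "((\<lambda>h. (\<rho> (x - y + h) - \<rho> (x - y) - D (x - y) h) / norm h) \<longlongrightarrow> 0) (at 0)"
          using D[of "x - y"] unfolding has_derivative_at
          by (elim conjE, subst tendsto_norm_zero_iff[symmetric]) simp
        then have "(\<lambda>n. (\<rho> (x - y + X n) - \<rho> (x - y) - D (x - y) (X n)) / norm (X n)) \<longlonglongrightarrow> 0"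
          unfolding tendsto_at_iff_sequentially using X by (auto simp: o_def)
        from tendsto_mult_left_zero[OF this, of "u y"] show ?thesis
          unfolding R_eq by (simp add: add_diff_eq diff_add_eq)
      qed
      then show "AE y in lebesgue. (\<lambda>n. R (X n) y) \<longlonglongrightarrow> 0" by simp
      have "\<bar>R (X n) y\<bar> \<le> 2 * S * \<bar>u y\<bar>" for n y
      proof -
        have "\<bar>\<rho> (x + X n - y) - \<rho> (x - y) - D (x - y) (X n)\<bar> \<le> 2 * S * norm (X n)"
          using lip[of "x - y" "X n"] D_bound[of "x - y" "X n"] by (simp add: algebra_simps)
        moreover have "norm (X n) > 0" using X(1) by simp
        ultimately have "\<bar>(\<rho> (x + X n - y) - \<rho> (x - y) - D (x - y) (X n)) / norm (X n)\<bar> \<le> 2 * S"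
          by (simp add: field_simps)
        then show ?thesis unfolding R_eq abs_mult by (intro mult_right_mono) auto
      qed
      then show "AE y in lebesgue. norm (R (X n) y) \<le> (2 * S) * \<bar>u y\<bar>" for n by simp
    qed (use R_int u in auto)
    then show "((\<lambda>h. LINT y|lebesgue. R h y) \<circ> X) \<longlonglongrightarrow> 0" by (simp add: o_def)
  qed
  then have "((\<lambda>h. norm (convol \<rho> u (x + h) - convol \<rho> u x -
      (\<Sum>i\<in>UNIV. convol (partial_deriv i \<rho>) u x * h $ i)) / norm h) \<longlongrightarrow> 0) (at 0)"
    unfolding quot[symmetric] by (drule_tac tendsto_norm_zero) simp
  moreover have "bounded_linear (\<lambda>h. \<Sum>i\<in>UNIV. convol (partial_deriv i \<rho>) u x * h $ i)"
    by (intro bounded_linear_sum bounded_linear_mult_right[THEN bounded_linear_compose] bounded_linear_vec_nth)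
  ultimately show ?thesis unfolding has_derivative_at by blast
qed

lemma partial_deriv_convol:
  fixes u :: "real ^ 'n \<Rightarrow> real"
  assumes \<rho>: "C_class 1 \<rho>" "compact K" "\<And>x. x \<notin> K \<Longrightarrow> \<rho> x = 0" and u: "integrable lebesgue u"
  shows "partial_deriv i (convol \<rho> u) = convol (partial_deriv i \<rho>) u"
  by (rule ext, subst partial_deriv_eq[OF convol_has_derivative[OF assms]])
    (simp_all add: axis_def if_distrib[of "\<lambda>t. _ * t"] sum.delta cong: if_cong)

lemma C_class_convol:
  fixes u :: "real ^ 'n \<Rightarrow> real"
  assumes \<rho>: "C_class 1 \<rho>" "compact K" "\<And>x. x \<notin> K \<Longrightarrow> \<rho> x = 0" and u: "integrable lebesgue u"
  shows "C_class 1 (convol \<rho> u)"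
proof -
  have "continuous_on UNIV (convol (partial_deriv i \<rho>) u)" for i
  proof -
    have cont: "continuous_on UNIV (partial_deriv i \<rho>)"
      using \<rho>(1) C_class_partial_deriv_continuous[of 0 \<rho>] by auto
    obtain B where "\<And>x. \<bar>partial_deriv i \<rho> x\<bar> \<le> B"
      by (rule bounded_of_compact_support[OF cont \<rho>(2)
        partial_deriv_eq_0_outside[OF compact_imp_closed[OF \<rho>(2)] \<rho>(3)]]) auto
    then show ?thesis by (rule continuous_convol[OF cont _ u])
  qed
  then show ?thesis
    using convol_has_derivative[OF assms] by (auto simp: differentiable_def partial_deriv_convol[OF assms])
qed

lemma mollifier_compact_support:
  fixes \<rho> :: "real ^ 'n \<Rightarrow> real"
  assumes "mollifier r \<rho>"
  shows "C_class 1 \<rho>" "compact (cball (0 :: real ^ 'n) r)" "x \<notin> cball 0 r \<Longrightarrow> \<rho> x = 0" "continuous_on UNIV \<rho>"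
  using mollifierD(1)[OF assms, of 1] mollifierD(3)[OF assms, of x] C_class_imp_continuous[of 1 \<rho>]
  by (auto simp del: C_class.simps One_nat_def)

lemma mollifier_bounded:
  assumes "mollifier r \<rho>"
  obtains B where "\<And>x. \<bar>\<rho> x\<bar> \<le> B"
  using bounded_of_compact_support[OF mollifier_compact_support(4,2,3)[OF assms]] by (auto simp del: mem_cball)

lemma continuous_convol_mollifier:
  fixes f :: "real ^ 'n \<Rightarrow> 'b::euclidean_space"
  assumes "mollifier r \<rho>" "integrable lebesgue f"
  shows "continuous_on UNIV (convol \<rho> f)"
  using mollifier_bounded[OF assms(1)] continuous_convol[OF mollifier_compact_support(4)[OF assms(1)] _ assms(2)] by metis

lemma integrable_convol_mollifier:
  fixes f :: "real ^ 'n \<Rightarrow> 'b::euclidean_space"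
  assumes "mollifier r \<rho>" "integrable lebesgue f"
  shows "integrable lebesgue (\<lambda>y. \<rho> (x - y) *\<^sub>R f y)"
  using mollifier_bounded[OF assms(1)] integrable_convol[OF mollifier_compact_support(4)[OF assms(1)] _ assms(2)] by metis

lemma nn_integral_lborel_translate:
  fixes f :: "'a::euclidean_space \<Rightarrow> ennreal"
  assumes [measurable]: "f \<in> borel_measurable borel"
  shows "(\<integral>\<^sup>+x. f (x - y) \<partial>lborel) = (\<integral>\<^sup>+x. f x \<partial>lborel)"
proof -
  have "(\<integral>\<^sup>+x. f x \<partial>lborel) = (\<integral>\<^sup>+x. f x \<partial>distr lborel borel ((+) (- y)))"
    by (subst lborel_distr_plus) simp
  also have "\<dots> = (\<integral>\<^sup>+x. f (x - y) \<partial>lborel)"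
    by (subst nn_integral_distr) auto
  finally show ?thesis by simp
qed

lemma nn_integral_lborel_reflect:
  fixes f :: "real ^ 'n \<Rightarrow> ennreal"
  assumes [measurable]: "f \<in> borel_measurable borel"
  shows "(\<integral>\<^sup>+y. f (x - y) \<partial>lborel) = (\<integral>\<^sup>+y. f y \<partial>lborel)"
proof -
  have "(\<integral>\<^sup>+y. f y \<partial>lborel) = (\<integral>\<^sup>+y. f y \<partial>density (distr lborel borel (\<lambda>y. x + (- 1) *\<^sub>R y)) (\<lambda>_. ennreal (\<bar>- 1\<bar> ^ DIM(real ^ 'n))))"
    by (subst lborel_affine[of "- 1" x]) auto
  also have "\<dots> = (\<integral>\<^sup>+y. f (x - y) \<partial>lborel)"
    by (subst nn_integral_density) (auto simp: nn_integral_distr)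
  finally show ?thesis by simp
qed

text \<open>The two variables serve different ends: the mass in \<open>x\<close> enters the L1 bound
  through Tonelli, the mass in \<open>y\<close> makes a convolution an average.\<close>

lemma mollifier_integrals:
  fixes \<rho> :: "real ^ 'n \<Rightarrow> real"
  assumes "mollifier r \<rho>"
  shows "(\<integral>\<^sup>+x. ennreal (\<rho> (x - y)) \<partial>lborel) = 1" "integrable lebesgue (\<lambda>y. \<rho> (x - y))"
    "(LINT y|lebesgue. \<rho> (x - y)) = 1"
proof -
  note [measurable] = borel_measurable_continuous_onI[OF mollifier_compact_support(4)[OF assms]]
  have one: "(\<integral>\<^sup>+x. ennreal (\<rho> x) \<partial>lborel) = 1"
    using nn_integral_eq_integral[OF mollifierD(5)[OF assms]] mollifierD(2,4)[OF assms]
    by (simp add: nn_integral_completion)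
  show "(\<integral>\<^sup>+x. ennreal (\<rho> (x - y)) \<partial>lborel) = 1"
    using nn_integral_lborel_translate[of "\<lambda>x. ennreal (\<rho> x)" y] one by simp
  have "(\<integral>\<^sup>+y. ennreal (\<rho> (x - y)) \<partial>lborel) = 1"
    using nn_integral_lborel_reflect[of "\<lambda>x. ennreal (\<rho> x)" x] one by simp
  then have "has_bochner_integral lebesgue (\<lambda>y. \<rho> (x - y)) 1"
    using borel_measurable_lebesgue_reflect[OF mollifier_compact_support(4)[OF assms]] mollifierD(2)[OF assms]
    by (intro has_bochner_integral_nn_integral) (auto simp: nn_integral_completion)
  then show "integrable lebesgue (\<lambda>y. \<rho> (x - y))" "(LINT y|lebesgue. \<rho> (x - y)) = 1"
    by (auto simp: has_bochner_integral_iff)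
qed

lemma norm_convol_le:
  fixes f :: "real ^ 'n \<Rightarrow> 'b::euclidean_space"
  assumes "mollifier r \<rho>"
  shows "norm (convol \<rho> f x) \<le> convol \<rho> (\<lambda>y. norm (f y)) x"
proof -
  have "norm (convol \<rho> f x) \<le> (LINT y|lebesgue. norm (\<rho> (x - y) *\<^sub>R f y))"
    unfolding convol_def by (rule integral_norm_bound)
  then show ?thesis using mollifierD(2)[OF assms] by (simp add: convol_def)
qed

text \<open>Young's inequality with constant 1: by Tonelli the integration in \<open>x\<close> is
  done first, and every shifted kernel has mass 1.\<close>

lemma integrable_convol_L1:
  fixes f :: "real ^ 'n \<Rightarrow> 'b::euclidean_space"
  assumes \<rho>: "mollifier r \<rho>" and f: "integrable lebesgue f"
  shows "integrable lebesgue (convol \<rho> f)"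
    and "(LINT x|lebesgue. norm (convol \<rho> f x)) \<le> (LINT x|lebesgue. norm (f x))"
proof -
  note [measurable] = borel_measurable_continuous_onI[OF mollifier_compact_support(4)[OF \<rho>]]
  note [simp] = mollifierD(2)[OF \<rho>]
  \<comment> \<open>Tonelli is applied over \<open>lborel\<close>, so the Lebesgue measurable
    \<open>norm (f x)\<close> is exchanged for a Borel function that equals it almost
    everywhere.\<close>
  have "(\<lambda>x. norm (f x)) \<in> borel_measurable lebesgue" using f by auto
  from completion_ex_borel_measurable_real[OF this]
  obtain g where g[measurable]: "g \<in> borel_measurable borel" and fg: "AE x in lborel. norm (f x) = g x"
    by auto
  have "(\<integral>\<^sup>+x. norm (convol \<rho> f x) \<partial>lebesgue) \<le> (\<integral>\<^sup>+x. (\<integral>\<^sup>+y. ennreal (\<rho> (x - y)) * ennreal (g y) \<partial>lborel) \<partial>lborel)"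
    unfolding nn_integral_completion
  proof (rule nn_integral_mono)
    fix x
    have "ennreal (norm (convol \<rho> f x)) \<le> (\<integral>\<^sup>+y. norm (\<rho> (x - y) *\<^sub>R f y) \<partial>lebesgue)"
      unfolding convol_def using integrable_convol_mollifier[OF \<rho> f] by (rule integral_norm_bound_ennreal)
    also have "\<dots> = (\<integral>\<^sup>+y. ennreal (\<rho> (x - y)) * ennreal (norm (f y)) \<partial>lborel)"
      by (simp add: ennreal_mult nn_integral_completion)
    also have "\<dots> = (\<integral>\<^sup>+y. ennreal (\<rho> (x - y)) * ennreal (g y) \<partial>lborel)"
      using fg by (intro nn_integral_cong_AE) auto
    finally show "ennreal (norm (convol \<rho> f x)) \<le> (\<integral>\<^sup>+y. ennreal (\<rho> (x - y)) * ennreal (g y) \<partial>lborel)" .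
  qed
  also have "\<dots> = (\<integral>\<^sup>+y. (\<integral>\<^sup>+x. ennreal (\<rho> (x - y)) * ennreal (g y) \<partial>lborel) \<partial>lborel)"
    by (rule lborel_pair.Fubini'[symmetric]) measurable
  also have "\<dots> = (\<integral>\<^sup>+y. ennreal (g y) \<partial>lborel)"
    by (subst nn_integral_multc) (auto simp: mollifier_integrals(1)[OF \<rho>])
  also have "\<dots> = (\<integral>\<^sup>+y. norm (f y) \<partial>lborel)"
    using fg by (intro nn_integral_cong_AE) auto
  also have "\<dots> = ennreal (LINT y|lebesgue. norm (f y))"
    using f nn_integral_eq_integral[of lebesgue "\<lambda>y. norm (f y)"] by (simp add: nn_integral_completion)
  finally have le: "(\<integral>\<^sup>+x. norm (convol \<rho> f x) \<partial>lebesgue) \<le> ennreal (LINT y|lebesgue. norm (f y))" .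
  have meas: "convol \<rho> f \<in> borel_measurable lebesgue"
    by (rule borel_measurable_lebesgue_continuous[OF continuous_convol_mollifier[OF \<rho> f]])
  show int: "integrable lebesgue (convol \<rho> f)"
    by (rule integrableI_bounded[OF meas]) (use le in \<open>auto intro: order.strict_trans1\<close>)
  have "ennreal (LINT x|lebesgue. norm (convol \<rho> f x)) \<le> ennreal (LINT x|lebesgue. norm (f x))"
    using le nn_integral_eq_integral[of lebesgue "\<lambda>y. norm (convol \<rho> f y)"] int by simp
  then show "(LINT x|lebesgue. norm (convol \<rho> f x)) \<le> (LINT x|lebesgue. norm (f x))"
    by (simp add: ennreal_le_iff)
qed

subsection \<open>Approximation in L1 and Lp\<close>

text \<open>Only bounds on the radii are prescribed and the members may have different profiles, so
  the class is stable under passing to subsequences.\<close>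

definition mollifier_sequence :: "(nat \<Rightarrow> real ^ 'n \<Rightarrow> real) \<Rightarrow> bool"
  where "mollifier_sequence \<rho> \<longleftrightarrow> (\<forall>n. mollifier (1 / real (Suc n)) (\<rho> n))"

lemma exists_mollifier_sequence:
  obtains \<rho> :: "nat \<Rightarrow> real ^ 'n \<Rightarrow> real" where "mollifier_sequence \<rho>"
proof -
  have "\<exists>\<rho> :: real ^ 'n \<Rightarrow> real. mollifier (1 / real (Suc n)) \<rho>" for n
    by (rule exists_mollifier[of "1 / real (Suc n)"]) auto
  then show ?thesis using that unfolding mollifier_sequence_def by metis
qed

lemma mollifier_sequence_subseq:
  assumes "mollifier_sequence \<rho>" "strict_mono (s :: nat \<Rightarrow> nat)"
  shows "mollifier_sequence (\<lambda>n. \<rho> (s n))"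
  unfolding mollifier_sequence_def
proof
  fix n
  have "n \<le> s n" using assms(2) by (rule strict_mono_imp_increasing)
  then have "1 / real (Suc (s n)) \<le> 1 / real (Suc n)" by (simp add: frac_le)
  then show "mollifier (1 / real (Suc n)) (\<rho> (s n))"
    using assms(1) mollifier_mono unfolding mollifier_sequence_def by blast
qed

lemma convol_diff:
  fixes f g :: "real ^ 'n \<Rightarrow> 'b::euclidean_space"
  assumes "mollifier r \<rho>" "integrable lebesgue f" "integrable lebesgue g"
  shows "convol \<rho> (\<lambda>x. f x - g x) x = convol \<rho> f x - convol \<rho> g x"
  using integrable_convol_mollifier[OF assms(1,2)] integrable_convol_mollifier[OF assms(1,3)]
  by (simp add: convol_def scaleR_diff_right)

lemma convol_cong_local:
  assumes "mollifier r \<rho>" "\<And>y. dist x y < r \<Longrightarrow> f y = g y"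
  shows "convol \<rho> f x = convol \<rho> g x"
  unfolding convol_def
proof (rule Bochner_Integration.integral_cong[OF refl])
  fix y
  show "\<rho> (x - y) *\<^sub>R f y = \<rho> (x - y) *\<^sub>R g y"
    using assms mollifierD(3)[OF assms(1), of "x - y"] by (cases "\<rho> (x - y) = 0") (auto simp: dist_norm)
qed

lemma convol_eq_0:
  assumes "mollifier r \<rho>" "\<And>y. dist x y < r \<Longrightarrow> f y = 0"
  shows "convol \<rho> f x = 0"
  by (subst convol_cong_local[OF assms(1), of _ f "\<lambda>_. 0"]) (use assms in \<open>auto simp: convol_def\<close>)

lemma norm_convol_bound:
  fixes f :: "real ^ 'n \<Rightarrow> 'b::euclidean_space"
  assumes \<rho>: "mollifier r \<rho>" and f: "integrable lebesgue f" and "\<And>y. dist x y < r \<Longrightarrow> norm (f y) \<le> B"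
  shows "norm (convol \<rho> f x) \<le> B"
proof -
  have "norm (convol \<rho> f x) \<le> (LINT y|lebesgue. norm (\<rho> (x - y) *\<^sub>R f y))"
    unfolding convol_def by (rule integral_norm_bound)
  also have "\<dots> \<le> (LINT y|lebesgue. \<rho> (x - y) * B)"
  proof (rule integral_mono)
    show "norm (\<rho> (x - y) *\<^sub>R f y) \<le> \<rho> (x - y) * B" for y
      using assms(3)[of y] mollifierD(2,3)[OF \<rho>, of "x - y"]
      by (cases "\<rho> (x - y) = 0") (auto simp: dist_norm intro!: mult_left_mono)
  qed (intro integrable_norm integrable_mult_left integrable_convol_mollifier[OF \<rho> f] mollifier_integrals(2)[OF \<rho>])+
  also have "\<dots> = B" using mollifier_integrals(3)[OF \<rho>] by simp
  finally show ?thesis .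
qed

lemma convol_tendsto_continuous:
  fixes g :: "real ^ 'n \<Rightarrow> 'b::euclidean_space"
  assumes \<rho>: "mollifier_sequence \<rho>" and g: "integrable lebesgue g" "continuous_on UNIV g"
  shows "(\<lambda>n. convol (\<rho> n) g x) \<longlonglongrightarrow> g x"
  unfolding lim_sequentially
proof (intro allI impI)
  fix e :: real assume e: "e > 0"
  obtain d where d: "d > 0" "\<And>y. dist y x < d \<Longrightarrow> dist (g y) (g x) < e / 2"
    using g(2) e unfolding continuous_on_iff by (meson UNIV_I half_gt_zero)
  obtain N where N: "1 / real (Suc N) < d" using d(1) nat_approx_posE by blast
  show "\<exists>N. \<forall>n\<ge>N. dist (convol (\<rho> n) g x) (g x) < e"
  proof (intro exI allI impI)
    fix n assume "n \<ge> N"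
    have m: "mollifier (1 / real (Suc n)) (\<rho> n)" using \<rho> by (simp add: mollifier_sequence_def)
    have "1 / real (Suc n) \<le> 1 / real (Suc N)" using \<open>n \<ge> N\<close> by (simp add: frac_le)
    then have small: "1 / real (Suc n) < d" using N by simp
    have "convol (\<rho> n) g x - g x = (LINT y|lebesgue. \<rho> n (x - y) *\<^sub>R g y) - (LINT y|lebesgue. \<rho> n (x - y) *\<^sub>R g x)"
      using mollifier_integrals(2,3)[OF m] by (simp add: convol_def)
    also have "\<dots> = (LINT y|lebesgue. \<rho> n (x - y) *\<^sub>R (g y - g x))"
      unfolding scaleR_diff_right
      by (rule Bochner_Integration.integral_diff[symmetric])
        (use integrable_convol_mollifier[OF m g(1)] mollifier_integrals(2)[OF m] in auto)
    finally have eq: "convol (\<rho> n) g x - g x = (LINT y|lebesgue. \<rho> n (x - y) *\<^sub>R (g y - g x))" .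
    have "norm (convol (\<rho> n) g x - g x) \<le> (LINT y|lebesgue. norm (\<rho> n (x - y) *\<^sub>R (g y - g x)))"
      unfolding eq by (rule integral_norm_bound)
    also have "\<dots> \<le> (LINT y|lebesgue. \<rho> n (x - y) * (e / 2))"
    proof (rule integral_mono)
      show "norm (\<rho> n (x - y) *\<^sub>R (g y - g x)) \<le> \<rho> n (x - y) * (e / 2)" for y
        using d(2)[of y] mollifierD(2,3)[OF m, of "x - y"] small
        by (cases "\<rho> n (x - y) = 0") (auto simp: dist_norm norm_minus_commute intro!: mult_left_mono)
      show "integrable lebesgue (\<lambda>y. norm (\<rho> n (x - y) *\<^sub>R (g y - g x)))"
        unfolding scaleR_diff_right
        by (intro integrable_norm Bochner_Integration.integrable_diff)
          (use integrable_convol_mollifier[OF m g(1)] mollifier_integrals(2)[OF m] in auto)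
    qed (use mollifier_integrals(2)[OF m] in auto)
    also have "\<dots> = e / 2" using mollifier_integrals(3)[OF m] by simp
    finally show "dist (convol (\<rho> n) g x) (g x) < e" using e by (simp add: dist_norm)
  qed
qed

lemma convol_L1_continuous:
  fixes g :: "real ^ 'n \<Rightarrow> 'b::euclidean_space"
  assumes \<rho>: "mollifier_sequence \<rho>" and g: "continuous_on UNIV g" "\<And>x. x \<notin> cball 0 R \<Longrightarrow> g x = 0"
  shows "(\<lambda>n. LINT x|lebesgue. norm (convol (\<rho> n) g x - g x)) \<longlonglongrightarrow> 0"
proof -
  obtain B where B: "B > 0" "\<And>x. norm (g x) \<le> B"
    using bounded_of_compact_support[OF g(1) compact_cball g(2)] by blast
  have int: "integrable lebesgue g" by (rule integrable_continuous_compact_support[OF g(1) compact_cball g(2)])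
  have m: "mollifier (1 / real (Suc n)) (\<rho> n)" for n using \<rho> by (simp add: mollifier_sequence_def)
  have "(\<lambda>n. LINT x|lebesgue. norm (convol (\<rho> n) g x - g x)) \<longlonglongrightarrow> (LINT x|(lebesgue :: (real ^ 'n) measure). (0 :: real))"
  \<comment> \<open>All radii are at most 1, so each convolution vanishes outside the ball of radius
    \<open>R + 1\<close>; inside, it obeys the same bound \<open>B\<close> as
    \<open>g\<close>.\<close>
  proof (rule integral_dominated_convergence[where w = "\<lambda>x. (2 * B) * indicator (cball 0 (R + 1)) x"])
    show "integrable lebesgue (\<lambda>x. (2 * B) * indicator (cball (0 :: real ^ 'n) (R + 1)) x :: real)"
      by (intro integrable_mult_right integrable_real_indicator)
        (auto intro: emeasure_lborel_cball_finite[unfolded infinity_ennreal_def])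
    show "AE x in lebesgue. (\<lambda>n. norm (convol (\<rho> n) g x - g x)) \<longlonglongrightarrow> 0"
      using convol_tendsto_continuous[OF \<rho> int g(1)]
      by (auto intro!: AE_I2 tendsto_norm_zero LIM_zero)
    show "AE x in lebesgue. norm (norm (convol (\<rho> n) g x - g x)) \<le> (2 * B) * indicator (cball 0 (R + 1)) x" for n
    proof (rule AE_I2)
      fix x :: "real ^ 'n"
      show "norm (norm (convol (\<rho> n) g x - g x)) \<le> (2 * B) * indicator (cball 0 (R + 1)) x"
      proof (cases "x \<in> cball 0 (R + 1)")
        case True
        have "norm (convol (\<rho> n) g x) \<le> B" by (rule norm_convol_bound[OF m int B(2)])
        then show ?thesis
          using True B(2)[of x] norm_triangle_ineq4[of "convol (\<rho> n) g x" "g x"] by simp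
      next
        case False
        have "1 / real (Suc n) \<le> 1" by simp
        have "g y = 0" if "dist x y < 1 / real (Suc n)" for y
        proof (rule g(2))
          have "dist x y < 1" using that \<open>1 / real (Suc n) \<le> 1\<close> by linarith
          then show "y \<notin> cball 0 R" using False dist_triangle[of 0 x y] by (auto simp: dist_commute)
        qed
        then have "convol (\<rho> n) g x = 0" by (rule convol_eq_0[OF m])
        moreover have "g x = 0" using False by (intro g(2)) auto
        ultimately show ?thesis using False by simp
      qed
    qed
    show "(\<lambda>x. norm (convol (\<rho> n) g x - g x)) \<in> borel_measurable lebesgue" for n
      using integrable_convol_L1(1)[OF m int] int by measurable
  qed simp
  then show ?thesis by simp
qed

text \<open>Truncation in value and in space makes \<open>f\<close> bounded with bounded support. A
  bounded measurable function is almost everywhere a limit of continuous functions, and after a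
  projection and a cut-off these are uniformly bounded on a common ball, so dominated convergence
  applies a second time.\<close>

lemma L1_approx_continuous:
  fixes f :: "real ^ 'n \<Rightarrow> 'b::euclidean_space"
  assumes f: "integrable lebesgue f" and e: "e > 0"
  obtains g R where "continuous_on UNIV g" "\<And>x. x \<notin> cball 0 R \<Longrightarrow> g x = 0"
    "(LINT x|lebesgue. norm (f x - g x)) < e"
proof -
  note [measurable] = borel_measurable_integrable[OF f]
  define T where "T k x = (if norm (f x) \<le> real k \<and> norm x \<le> real k then f x else 0)" for k x
  have normmeas: "(\<lambda>x::real^'n. norm x) \<in> borel_measurable lebesgue"
    by (intro borel_measurable_lebesgue_continuous continuous_intros)
  note [measurable] = normmeas
  have T_meas[measurable]: "T k \<in> borel_measurable lebesgue" for k
    unfolding T_def by measurable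
  have "(\<lambda>k. LINT x|lebesgue. norm (f x - T k x)) \<longlonglongrightarrow> (LINT x|(lebesgue :: (real ^ 'n) measure). (0 :: real))"
  proof (rule integral_dominated_convergence[where w = "\<lambda>x. norm (f x)"])
    show "AE x in lebesgue. (\<lambda>k. norm (f x - T k x)) \<longlonglongrightarrow> 0"
    proof (rule AE_I2)
      fix x
      obtain N where N: "norm (f x) + norm x \<le> real N" using real_arch_simple by blast
      have "T k x = f x" if "k \<ge> N" for k
      proof -
        have "real N \<le> real k" using that by simp
        then show ?thesis using N norm_ge_zero[of x] norm_ge_zero[of "f x"] unfolding T_def
          by (smt (verit))
      qed
      then show "(\<lambda>k. norm (f x - T k x)) \<longlonglongrightarrow> 0"
        by (intro tendsto_eventually) (force simp: eventually_sequentially)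
    qed
  qed (use f in \<open>auto simp: T_def\<close>)
  then have "(\<lambda>k. LINT x|lebesgue. norm (f x - T k x)) \<longlonglongrightarrow> 0" by simp
  then have "eventually (\<lambda>k. (LINT x|lebesgue. norm (f x - T k x)) < e / 2) sequentially"
    using e by (intro order_tendstoD) auto
  then obtain k where k: "(LINT x|lebesgue. norm (f x - T k x)) < e / 2"
    by (auto simp: eventually_sequentially)
  have T_int: "integrable lebesgue (T k)"
    by (rule Bochner_Integration.integrable_bound[OF f]) (auto simp: T_def)
  \<comment> \<open>\<open>measurable_on\<close> unfolds to continuous functions that converge to
    \<open>T k\<close> outside a negligible set.\<close>
  have "T k measurable_on UNIV"
    using T_meas by (simp add: measurable_on_iff_borel_measurable lebesgue_on_UNIV_eq)
  then obtain N h where N: "negligible N" and h: "\<And>n. continuous_on UNIV (h n)"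
    and h_lim: "\<And>x. x \<notin> N \<Longrightarrow> (\<lambda>n. h n x) \<longlonglongrightarrow> T k x"
    unfolding measurable_on_def by auto
  \<comment> \<open>The projection onto the ball of radius \<open>k\<close> is continuous and fixes
    the values of \<open>T k\<close>, so it bounds the approximants without changing their
    limit.\<close>
  define c where "c = closest_point (cball (0 :: 'b) (real k))"
  have c_cont: "continuous_on UNIV c"
    unfolding c_def by (rule continuous_on_closest_point) auto
  have c_norm: "norm (c y) \<le> real k" for y
    using closest_point_in_set[of "cball 0 (real k)" y] by (auto simp: c_def)
  have c_id: "c y = y" if "norm y \<le> real k" for y
    unfolding c_def using that by (intro closest_point_self) auto
  \<comment> \<open>The cut-off is 1 on the ball of radius \<open>k\<close>, outside which
    \<open>T k\<close> vanishes, and 0 beyond radius \<open>k + 1\<close>.\<close>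
  define g where "g n x = max 0 (min 1 (real k + 1 - norm x)) *\<^sub>R c (h n x)" for n x
  have g_cont: "continuous_on UNIV (g n)" for n
    unfolding g_def by (intro continuous_intros continuous_on_compose2[OF c_cont h]) auto
  have g_supp: "g n x = 0" if "x \<notin> cball 0 (real k + 1)" for n x
    using that by (auto simp: g_def)
  have g_bound: "norm (g n x) \<le> real k" for n x
  proof -
    have "norm (g n x) \<le> 1 * norm (c (h n x))"
      unfolding g_def norm_scaleR by (rule mult_right_mono) auto
    then show ?thesis using c_norm[of "h n x"] by linarith
  qed
  have T_bound: "norm (T k x) \<le> real k" for x by (auto simp: T_def)
  have "(\<lambda>n. LINT x|lebesgue. norm (T k x - g n x)) \<longlonglongrightarrow> (LINT x|(lebesgue :: (real ^ 'n) measure). (0 :: real))"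
  proof (rule integral_dominated_convergence[where w = "\<lambda>x. (2 * real k) * indicator (cball 0 (real k + 1)) x"])
    show "integrable lebesgue (\<lambda>x. (2 * real k) * indicator (cball (0 :: real ^ 'n) (real k + 1)) x :: real)"
      by (intro integrable_mult_right integrable_real_indicator)
        (auto intro: emeasure_lborel_cball_finite[unfolded infinity_ennreal_def])
    have "AE x in lebesgue. x \<notin> N"
      using N by (simp add: negligible_iff_null_sets AE_not_in)
    then show "AE x in lebesgue. (\<lambda>n. norm (T k x - g n x)) \<longlonglongrightarrow> 0"
    proof eventually_elim
      case (elim x)
      have "(\<lambda>n. c (h n x)) \<longlonglongrightarrow> c (T k x)"
        by (rule continuous_on_tendsto_compose[OF c_cont h_lim[OF elim]]) auto
      then have "(\<lambda>n. g n x) \<longlonglongrightarrow> max 0 (min 1 (real k + 1 - norm x)) *\<^sub>R c (T k x)"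
        unfolding g_def by (intro tendsto_intros)
      moreover have "max 0 (min 1 (real k + 1 - norm x)) *\<^sub>R c (T k x) = T k x"
        unfolding c_id[OF T_bound] by (auto simp: T_def)
      ultimately have "(\<lambda>n. g n x) \<longlonglongrightarrow> T k x" by simp
      then have "(\<lambda>n. T k x - g n x) \<longlonglongrightarrow> T k x - T k x" by (intro tendsto_intros)
      then show ?case by (simp add: tendsto_norm_zero)
    qed
    show "AE x in lebesgue. norm (norm (T k x - g n x)) \<le> (2 * real k) * indicator (cball 0 (real k + 1)) x" for n
    proof (rule AE_I2)
      fix x
      show "norm (norm (T k x - g n x)) \<le> (2 * real k) * indicator (cball 0 (real k + 1)) x"
      proof (cases "x \<in> cball 0 (real k + 1)")
        case True
        then show ?thesis using T_bound[of x] g_bound[of n x] norm_triangle_ineq4[of "T k x" "g n x"] by simp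
      next
        case False
        then show ?thesis using g_supp[OF False, of n] by (auto simp: T_def)
      qed
    qed
    show "(\<lambda>x. norm (T k x - g n x)) \<in> borel_measurable lebesgue" for n
      using borel_measurable_lebesgue_continuous[OF g_cont[of n]] by measurable
  qed simp
  then have "(\<lambda>n. LINT x|lebesgue. norm (T k x - g n x)) \<longlonglongrightarrow> 0" by simp
  then have "eventually (\<lambda>n. (LINT x|lebesgue. norm (T k x - g n x)) < e / 2) sequentially"
    using e by (intro order_tendstoD) auto
  then obtain n where n: "(LINT x|lebesgue. norm (T k x - g n x)) < e / 2"
    by (auto simp: eventually_sequentially)
  have g_int: "integrable lebesgue (g n)"
    by (rule integrable_continuous_compact_support[OF g_cont compact_cball g_supp])
  have "(LINT x|lebesgue. norm (f x - g n x)) \<le> (LINT x|lebesgue. norm (f x - T k x) + norm (T k x - g n x))"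
  proof (rule integral_mono)
    show "norm (f x - g n x) \<le> norm (f x - T k x) + norm (T k x - g n x)" for x
      using norm_triangle_ineq[of "f x - T k x" "T k x - g n x"] by simp
  qed (use f T_int g_int in auto)
  also have "\<dots> = (LINT x|lebesgue. norm (f x - T k x)) + (LINT x|lebesgue. norm (T k x - g n x))"
    using f T_int g_int by (intro Bochner_Integration.integral_add) auto
  finally have "(LINT x|lebesgue. norm (f x - g n x)) < e" using k n by linarith
  then show ?thesis using that g_cont g_supp by blast
qed

text \<open>The L1 bound for convolutions, with its constant independent of the kernel, carries the
  convergence from continuous functions of compact support to their L1 limits.\<close>

theorem convol_L1:
  fixes f :: "real ^ 'n \<Rightarrow> 'b::euclidean_space"
  assumes \<rho>: "mollifier_sequence \<rho>" and f: "integrable lebesgue f"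
  shows "(\<lambda>n. LINT x|lebesgue. norm (convol (\<rho> n) f x - f x)) \<longlonglongrightarrow> 0"
  unfolding lim_sequentially
proof (intro allI impI)
  fix e :: real assume e: "e > 0"
  obtain g R where g: "continuous_on UNIV g" "\<And>x. x \<notin> cball 0 R \<Longrightarrow> g x = 0"
    "(LINT x|lebesgue. norm (f x - g x)) < e / 3"
    using L1_approx_continuous[OF f, of "e / 3"] e by auto
  have m: "mollifier (1 / real (Suc n)) (\<rho> n)" for n using \<rho> by (simp add: mollifier_sequence_def)
  have g_int: "integrable lebesgue g" by (rule integrable_continuous_compact_support[OF g(1) compact_cball g(2)])
  obtain N where N: "\<And>n. n \<ge> N \<Longrightarrow> norm (LINT x|lebesgue. norm (convol (\<rho> n) g x - g x)) < e / 3"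
    using LIMSEQ_D[OF convol_L1_continuous[OF \<rho> g(1,2)], where r = "e / 3"] e
    by (auto simp del: real_norm_def)
  have "dist (LINT x|lebesgue. norm (convol (\<rho> n) f x - f x)) 0 < e" if "n \<ge> N" for n
  proof -
    note C = integrable_convol_L1[OF m[of n]]
    have fg: "integrable lebesgue (\<lambda>x. f x - g x)" using f g_int by auto
    have "(LINT x|lebesgue. norm (convol (\<rho> n) f x - f x)) \<le>
        (LINT x|lebesgue. norm (convol (\<rho> n) (\<lambda>x. f x - g x) x) + norm (convol (\<rho> n) g x - g x) + norm (f x - g x))"
    proof (rule integral_mono)
      show "norm (convol (\<rho> n) f x - f x) \<le> norm (convol (\<rho> n) (\<lambda>x. f x - g x) x)
          + norm (convol (\<rho> n) g x - g x) + norm (f x - g x)" for x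
      proof -
        have "convol (\<rho> n) f x - f x = convol (\<rho> n) (\<lambda>x. f x - g x) x + (convol (\<rho> n) g x - g x) - (f x - g x)"
          unfolding convol_diff[OF m f g_int] by simp
        then show ?thesis
          using norm_triangle_ineq4[of "convol (\<rho> n) (\<lambda>x. f x - g x) x + (convol (\<rho> n) g x - g x)" "f x - g x"]
            norm_triangle_ineq[of "convol (\<rho> n) (\<lambda>x. f x - g x) x" "convol (\<rho> n) g x - g x"]
          by (smt (verit))
      qed
    qed (use f g_int C(1)[OF f] C(1)[OF g_int] C(1)[OF fg] in auto)
    also have "\<dots> = (LINT x|lebesgue. norm (convol (\<rho> n) (\<lambda>x. f x - g x) x))
        + (LINT x|lebesgue. norm (convol (\<rho> n) g x - g x)) + (LINT x|lebesgue. norm (f x - g x))"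
      using f g_int C(1)[OF g_int] C(1)[OF fg]
      by (subst Bochner_Integration.integral_add, simp, simp, subst Bochner_Integration.integral_add) auto
    also have "\<dots> < e"
      using C(2)[OF fg] N[OF that] g(3) by simp
    finally show ?thesis by simp
  qed
  then show "\<exists>N. \<forall>n\<ge>N. dist (LINT x|lebesgue. norm (convol (\<rho> n) f x - f x)) 0 < e" by blast
qed

section \<open>Jensen's inequality for convolutions and approximation in Lp\<close>

lemma powr_tangent_le:
  fixes p t A :: real
  assumes "p \<ge> 1" "t \<ge> 0" "A > 0"
  shows "A powr p + p * A powr (p - 1) * (t - A) \<le> t powr p"
\<comment> \<open>Convexity is used on the open half-line only. At 0 the tangent takes the value
  \<open>(1 - p) * A powr p\<close>, which is not positive.\<close>
proof (cases "t = 0")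
  case True
  have "A powr p = A powr (p - 1) * A" using assms by (simp add: powr_diff)
  then have "A powr p + p * A powr (p - 1) * (t - A) = (1 - p) * A powr p"
    using True by (simp add: algebra_simps)
  also have "\<dots> \<le> 0" using assms by (intro mult_nonpos_nonneg) auto
  finally show ?thesis using True by simp
next
  case False
  then have t: "t > 0" using assms by simp
  have "t powr p - A powr p \<ge> p * A powr (p - 1) * (t - A)"
  proof (rule convex_on_imp_above_tangent[where A = "{0<..}"])
    show "convex_on {0<..} (\<lambda>x::real. x powr p)"
      by (rule f''_ge0_imp_convex[where f' = "\<lambda>x. p * x powr (p - 1)" and f'' = "\<lambda>x. p * ((p - 1) * x powr (p - 1 - 1))"])
        (use assms in \<open>auto intro!: derivative_eq_intros mult_nonneg_nonneg\<close>)
    show "((\<lambda>x. x powr p) has_real_derivative p * A powr (p - 1)) (at A within {0<..})"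
      using assms by (auto intro!: derivative_eq_intros)
  qed (use t assms in \<open>auto simp: connected_Ioi interior_open\<close>)
  then show ?thesis by simp
qed

text \<open>Jensen's inequality for the probability density \<open>\<rho> (x - y)\<close> in
  \<open>y\<close>. The tangent of the p-th power at the average \<open>A\<close> of
  \<open>norm (f y)\<close> is integrated; its linear term contributes 0.\<close>

lemma convol_powr_le:
  fixes f :: "real ^ 'n \<Rightarrow> 'b::euclidean_space"
  assumes \<rho>: "mollifier r \<rho>" and p: "p \<ge> 1" and f: "integrable lebesgue f"
    and fp: "integrable lebesgue (\<lambda>x. norm (f x) powr p)"
  shows "norm (convol \<rho> f x) powr p \<le> convol \<rho> (\<lambda>x. norm (f x) powr p) x"
proof -
  define A where "A = convol \<rho> (\<lambda>y. norm (f y)) x"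
  have nonneg: "0 \<le> convol \<rho> (\<lambda>x. norm (f x) powr p) x" "0 \<le> A"
    using mollifierD(2)[OF \<rho>] by (auto simp: convol_def A_def)
  have "norm (convol \<rho> f x) powr p \<le> A powr p"
    using norm_convol_le[OF \<rho>, of f x] p by (intro powr_mono2) (auto simp: A_def)
  also have "A powr p \<le> convol \<rho> (\<lambda>x. norm (f x) powr p) x"
  proof (cases "A = 0")
    case False
    then have A: "A > 0" using nonneg by simp
    have fn: "integrable lebesgue (\<lambda>y. norm (f y))" using f by simp
    note int = integrable_convol_mollifier[OF \<rho> fn, of x] integrable_convol_mollifier[OF \<rho> fp, of x]
      mollifier_integrals(2)[OF \<rho>, of x]
    define c where "c = p * A powr (p - 1)"
    have "A powr p = (LINT y|lebesgue. (A powr p - c * A) * \<rho> (x - y) + c * (\<rho> (x - y) *\<^sub>R norm (f y)))"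
      using int mollifier_integrals(3)[OF \<rho>, of x]
      by (subst Bochner_Integration.integral_add) (auto simp: A_def convol_def)
    also have "\<dots> \<le> (LINT y|lebesgue. \<rho> (x - y) *\<^sub>R (norm (f y) powr p))"
    proof (rule integral_mono)
      show "(A powr p - c * A) * \<rho> (x - y) + c * (\<rho> (x - y) *\<^sub>R norm (f y)) \<le> \<rho> (x - y) *\<^sub>R (norm (f y) powr p)" for y
        using mult_left_mono[OF powr_tangent_le[OF p _ A, of "norm (f y)"] mollifierD(2)[OF \<rho>, of "x - y"]]
        by (simp add: c_def algebra_simps)
    qed (use int in auto)
    finally show ?thesis by (simp add: convol_def)
  qed (use nonneg in simp)
  finally show ?thesis .
qed

lemma powr_add_le:
  fixes a b p :: real
  assumes "p \<ge> 0" "a \<ge> 0" "b \<ge> 0"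
  shows "(a + b) powr p \<le> 2 powr p * (a powr p + b powr p)"
proof -
  have "(a + b) powr p \<le> (2 * max a b) powr p" using assms by (intro powr_mono2) auto
  also have "\<dots> = 2 powr p * max a b powr p" using assms by (simp add: powr_mult)
  also have "\<dots> \<le> 2 powr p * (a powr p + b powr p)"
    by (intro mult_left_mono) (auto simp: max_def)
  finally show ?thesis .
qed

lemma norm_add_powr_le:
  fixes a b :: "'a::real_normed_vector"
  assumes "p \<ge> 0"
  shows "norm (a + b) powr p \<le> 2 powr p * (norm a powr p + norm b powr p)"
  using assms norm_triangle_ineq[of a b] powr_add_le[of p "norm a" "norm b"] powr_mono2[of p "norm (a + b)" "norm a + norm b"]
  by simp

lemma norm_convol_diff_powr_le:
  fixes f :: "real ^ 'n \<Rightarrow> 'b::euclidean_space"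
  assumes \<rho>: "mollifier r \<rho>" and p: "p \<ge> 1" and f: "integrable lebesgue f"
    "integrable lebesgue (\<lambda>x. norm (f x) powr p)"
  shows "norm (convol \<rho> f x - f x) powr p \<le> 2 powr p * (convol \<rho> (\<lambda>x. norm (f x) powr p) x + norm (f x) powr p)"
proof -
  have "norm (convol \<rho> f x - f x) powr p \<le> 2 powr p * (norm (convol \<rho> f x) powr p + norm (f x) powr p)"
    using norm_add_powr_le[of p "convol \<rho> f x" "- f x"] p by simp
  also have "\<dots> \<le> 2 powr p * (convol \<rho> (\<lambda>x. norm (f x) powr p) x + norm (f x) powr p)"
    by (intro mult_left_mono add_right_mono convol_powr_le[OF \<rho> p f]) auto
  finally show ?thesis .
qed

text \<open>Convergence in L1 gives pointwise convergence along a subsequence. By Jensen the p-th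
  power of the error is at most \<open>2 powr p\<close> times the sum of
  \<open>norm (f x) powr p\<close> and its convolution. This majorant is twice the fixed function
  plus the difference of the two, which vanishes in L1.\<close>

theorem convol_Lp:
  fixes f :: "real ^ 'n \<Rightarrow> 'b::euclidean_space"
  assumes \<rho>: "mollifier_sequence \<rho>" and p: "p \<ge> 1" and f: "integrable lebesgue f"
    and fp: "integrable lebesgue (\<lambda>x. norm (f x) powr p)"
  shows "(\<lambda>n. LINT x|lebesgue. norm (convol (\<rho> n) f x - f x) powr p) \<longlonglongrightarrow> 0"
proof (rule LIMSEQ_subsequence_principle)
  fix s :: "nat \<Rightarrow> nat" assume s: "strict_mono s"
  have ms: "mollifier_sequence (\<lambda>n. \<rho> (s n))" by (rule mollifier_sequence_subseq[OF \<rho> s])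
  have m: "mollifier (1 / real (Suc n)) (\<rho> n)" for n using \<rho> by (simp add: mollifier_sequence_def)
  have "\<exists>t. strict_mono t \<and> (AE x in lebesgue. (\<lambda>n. convol (\<rho> (s (t n))) f x - f x) \<longlonglongrightarrow> 0)"
    by (rule tendsto_L1_AE_subseq[OF _ convol_L1[OF ms f]]) (use integrable_convol_L1(1)[OF m f] f in auto)
  then obtain t where t: "strict_mono t" "AE x in lebesgue. (\<lambda>n. convol (\<rho> (s (t n))) f x - f x) \<longlonglongrightarrow> 0"
    by blast
  have mst: "mollifier_sequence (\<lambda>n. \<rho> (s (t n)))" by (rule mollifier_sequence_subseq[OF ms t(1)])
  define \<sigma> where "\<sigma> n = \<rho> (s (t n))" for n
  have m\<sigma>: "mollifier (1 / real (Suc n)) (\<sigma> n)" for n using mst by (simp add: mollifier_sequence_def \<sigma>_def)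
  let ?F = "\<lambda>x. norm (f x) powr p"
  have "(\<lambda>n. LINT x|lebesgue. norm (norm (convol (\<sigma> n) f x - f x) powr p)) \<longlonglongrightarrow> 0"
  proof (rule tendsto_integral_norm_0_dominated[where a = "\<lambda>n x. 2 powr p * (convol (\<sigma> n) ?F x - ?F x)"
        and b = "\<lambda>x. 2 * 2 powr p * ?F x"])
    show "(\<lambda>x. norm (convol (\<sigma> n) f x - f x) powr p) \<in> borel_measurable lebesgue" for n
      using integrable_convol_L1(1)[OF m\<sigma> f] f by measurable
    show "integrable lebesgue (\<lambda>x. 2 powr p * (convol (\<sigma> n) ?F x - ?F x))" for n
      using integrable_convol_L1(1)[OF m\<sigma> fp] fp by auto
    have "(\<lambda>n. 2 powr p * (LINT x|lebesgue. norm (convol (\<sigma> n) ?F x - ?F x))) \<longlonglongrightarrow> 2 powr p * 0"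
      unfolding \<sigma>_def by (intro tendsto_mult_left convol_L1[OF mst fp])
    then show "(\<lambda>n. LINT x|lebesgue. \<bar>2 powr p * (convol (\<sigma> n) ?F x - ?F x)\<bar>) \<longlonglongrightarrow> 0"
      by (simp add: abs_mult)
    show "integrable lebesgue (\<lambda>x. 2 * 2 powr p * ?F x)" using fp by simp
    show "AE x in lebesgue. (\<lambda>n. norm (convol (\<sigma> n) f x - f x) powr p) \<longlonglongrightarrow> 0"
      using t(2)
    proof eventually_elim
      case (elim x)
      have "(\<lambda>n. norm (convol (\<sigma> n) f x - f x) powr p) \<longlonglongrightarrow> 0 powr p"
        using elim p by (intro tendsto_powr') (auto simp: \<sigma>_def intro: tendsto_norm_zero)
      then show ?case by simp
    qed
    show "AE x in lebesgue. norm (norm (convol (\<sigma> n) f x - f x) powr p) \<le>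
        \<bar>2 powr p * (convol (\<sigma> n) ?F x - ?F x)\<bar> + 2 * 2 powr p * ?F x" for n
    proof (rule AE_I2)
      fix x
      have "norm (convol (\<sigma> n) f x - f x) powr p \<le> 2 powr p * (convol (\<sigma> n) ?F x + ?F x)"
        by (rule norm_convol_diff_powr_le[OF m\<sigma> p f fp])
      also have "\<dots> = 2 powr p * (convol (\<sigma> n) ?F x - ?F x) + 2 * 2 powr p * ?F x"
        by (simp add: algebra_simps)
      finally show "norm (norm (convol (\<sigma> n) f x - f x) powr p) \<le>
        \<bar>2 powr p * (convol (\<sigma> n) ?F x - ?F x)\<bar> + 2 * 2 powr p * ?F x"
        by (simp add: abs_le_iff)
    qed
  qed
  then have "(\<lambda>n. LINT x|lebesgue. norm (convol (\<rho> (s (t n))) f x - f x) powr p) \<longlonglongrightarrow> 0"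
    by (simp add: \<sigma>_def)
  then show "\<exists>t :: nat \<Rightarrow> nat. strict_mono t \<and>
      (\<lambda>n. LINT x|lebesgue. norm (convol (\<rho> (s (t n))) f x - f x) powr p) \<longlonglongrightarrow> 0"
    using t(1) by blast
qed

subsection \<open>Uniqueness of weak gradients\<close>

lemma integrable_lebesgue_on_iff:
  fixes f :: "real ^ 'n \<Rightarrow> 'b::euclidean_space"
  assumes "S \<in> sets lebesgue"
  shows "integrable (lebesgue_on S) f \<longleftrightarrow> integrable lebesgue (\<lambda>x. indicator S x *\<^sub>R f x)"
  using assms by (intro integrable_restrict_space) auto

lemma integral_lebesgue_on:
  fixes f :: "real ^ 'n \<Rightarrow> 'b::euclidean_space"
  assumes "S \<in> sets lebesgue"
  shows "integral\<^sup>L (lebesgue_on S) f = (LINT x|lebesgue. indicator S x *\<^sub>R f x)"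
  using assms by (intro integral_restrict_space) auto

lemma AE_lebesgue_on_iff:
  fixes S :: "(real ^ 'n) set"
  assumes "S \<in> sets lebesgue"
  shows "(AE x in lebesgue_on S. P x) \<longleftrightarrow> (AE x in lebesgue. x \<in> S \<longrightarrow> P x)"
  using assms by (intro AE_restrict_space_iff) auto

lemma open_in_sets_lebesgue: "open S \<Longrightarrow> S \<in> sets (lebesgue :: (real ^ 'n) measure)"
  by auto

lemma compact_in_sets_lebesgue: "compact S \<Longrightarrow> S \<in> sets (lebesgue :: (real ^ 'n) measure)"
  by (simp add: fmeasurableD lmeasurable_compact)

text \<open>Completeness of Lebesgue measure carries measurability across an almost everywhere
  equality.\<close>

lemma borel_measurable_lebesgue_on_AE:
  fixes f g :: "real ^ 'n \<Rightarrow> 'b::euclidean_space"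
  assumes S: "S \<in> sets lebesgue" and f: "f \<in> borel_measurable (lebesgue_on S)"
    and ae: "AE x in lebesgue_on S. f x = g x"
  shows "g \<in> borel_measurable (lebesgue_on S)"
proof -
  have "(\<lambda>x. indicator S x *\<^sub>R f x) \<in> borel_measurable lebesgue"
    using f S by (subst (asm) borel_measurable_restrict_space_iff) auto
  moreover have "AE x in lebesgue. indicator S x *\<^sub>R f x = indicator S x *\<^sub>R g x"
    using ae unfolding AE_lebesgue_on_iff[OF S] by eventually_elim (auto simp: indicator_def)
  ultimately have "(\<lambda>x. indicator S x *\<^sub>R g x) \<in> borel_measurable lebesgue"
    by (rule borel_measurable_AE)
  then show ?thesis
    using S by (subst borel_measurable_restrict_space_iff) auto
qed

lemma integrable_lebesgue_on_cong_AE: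
  fixes f g :: "real ^ 'n \<Rightarrow> 'b::euclidean_space"
  assumes S: "S \<in> sets lebesgue" and f: "integrable (lebesgue_on S) f"
    and ae: "AE x in lebesgue_on S. f x = g x"
  shows "integrable (lebesgue_on S) g"
  using f by (rule integrable_cong_AE_imp)
    (use borel_measurable_lebesgue_on_AE[OF S borel_measurable_integrable[OF f] ae] ae in auto)

lemma integrable_lebesgue_on_subset:
  fixes f :: "real ^ 'n \<Rightarrow> 'b::euclidean_space"
  assumes "integrable (lebesgue_on S) f" "S \<in> sets lebesgue" "T \<in> sets lebesgue" "T \<subseteq> S"
  shows "integrable (lebesgue_on T) f"
proof -
  have "integrable lebesgue (\<lambda>x. indicator T x *\<^sub>R (indicator S x *\<^sub>R f x))"
    using assms(1) unfolding integrable_lebesgue_on_iff[OF assms(2)] by (rule integrable_mult_indicator[OF assms(3)])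
  moreover have "indicator T x *\<^sub>R (indicator S x *\<^sub>R f x) = indicator T x *\<^sub>R f x" for x
    using assms(4) by (auto simp: indicator_def)
  ultimately have "integrable lebesgue (\<lambda>x. indicator T x *\<^sub>R f x)" by (simp only:)
  then show ?thesis using integrable_lebesgue_on_iff[OF assms(3)] by blast
qed

lemma locally_integrableI:
  fixes f :: "real ^ 'n \<Rightarrow> 'b::euclidean_space"
  assumes "integrable (lebesgue_on \<Omega>) f" "open \<Omega>"
  shows "locally_integrable \<Omega> f"
  using assms by (auto simp: locally_integrable_def intro!: integrable_lebesgue_on_subset[of \<Omega>] intro: compact_in_sets_lebesgue)

lemma compactly_supported_inI:
  assumes "compact K" "K \<subseteq> \<Omega>" "\<And>x. x \<notin> K \<Longrightarrow> f x = 0"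
  shows "compactly_supported_in \<Omega> f"
proof -
  have sub: "closure {x. f x \<noteq> 0} \<subseteq> K"
    by (rule closure_minimal[OF _ compact_imp_closed[OF assms(1)]]) (use assms(3) in blast)
  have "compact (closure {x. f x \<noteq> 0})"
    using closed_Int_compact[OF closed_closure[of "{x. f x \<noteq> 0}"] assms(1)] sub by (simp only: Int_absorb2)
  then show ?thesis
    using sub assms(2) unfolding compactly_supported_in_def by (meson order_trans)
qed

lemma compactly_supported_inE:
  assumes "compactly_supported_in \<Omega> f"
  obtains K where "compact K" "K \<subseteq> \<Omega>" "\<And>x. x \<notin> K \<Longrightarrow> f x = 0"
proof (rule that)
  show "compact (closure {x. f x \<noteq> 0})" "closure {x. f x \<noteq> 0} \<subseteq> \<Omega>"
    using assms unfolding compactly_supported_in_def by blast+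
  show "f x = 0" if "x \<notin> closure {x. f x \<noteq> 0}" for x
    using that closure_subset[of "{x. f x \<noteq> 0}"] by blast
qed

text \<open>\<open>f\<close> itself may fail to be integrable on \<open>\<Omega>\<close>. The factor
  \<open>\<psi>\<close> confines the integrand to \<open>K\<close>, where \<open>f\<close> is
  integrable and \<open>\<psi>\<close> bounded.\<close>

lemma integrable_locally_mult_compact:
  fixes f :: "real ^ 'n \<Rightarrow> real"
  assumes f: "locally_integrable \<Omega> f" and K: "compact K" "K \<subseteq> \<Omega>"
    and \<psi>: "continuous_on UNIV \<psi>" "\<And>x. x \<notin> K \<Longrightarrow> \<psi> x = 0" and \<Omega>: "open \<Omega>"
  shows "integrable (lebesgue_on \<Omega>) (\<lambda>x. f x * \<psi> x)"
    and "(LINT x|lebesgue_on \<Omega>. f x * \<psi> x) = (LINT x|lebesgue. (indicator K x *\<^sub>R f x) * \<psi> x)"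
proof -
  have Kl: "K \<in> sets lebesgue" using K(1) by (rule compact_in_sets_lebesgue)
  have \<Omega>l: "\<Omega> \<in> sets lebesgue" using \<Omega> by (rule open_in_sets_lebesgue)
  obtain B where B: "\<And>x. norm (\<psi> x) \<le> B" using bounded_of_compact_support[OF \<psi>(1) K(1) \<psi>(2)] by blast
  have fK: "integrable lebesgue (\<lambda>x. indicator K x *\<^sub>R f x)"
    using f K unfolding locally_integrable_def integrable_lebesgue_on_iff[OF Kl, symmetric] by blast
  have eq: "indicator \<Omega> x *\<^sub>R (f x * \<psi> x) = (indicator K x *\<^sub>R f x) * \<psi> x" for x
    using \<psi>(2)[of x] K(2) by (auto simp: indicator_def)
  have "integrable lebesgue (\<lambda>x. (indicator K x *\<^sub>R f x) * \<psi> x)"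
  proof (rule Bochner_Integration.integrable_bound)
    show "integrable lebesgue (\<lambda>x. B * (indicator K x *\<^sub>R f x))" using fK by simp
    show "(\<lambda>x. (indicator K x *\<^sub>R f x) * \<psi> x) \<in> borel_measurable lebesgue"
      using fK borel_measurable_lebesgue_continuous[OF \<psi>(1)] by measurable
    show "AE x in lebesgue. norm (indicator K x *\<^sub>R f x * \<psi> x) \<le> norm (B * (indicator K x *\<^sub>R f x))"
    proof (rule AE_I2)
      fix x
      have "\<bar>\<psi> x\<bar> * \<bar>indicator K x *\<^sub>R f x\<bar> \<le> \<bar>B\<bar> * \<bar>indicator K x *\<^sub>R f x\<bar>"
        using B[of x] by (intro mult_right_mono) auto
      then show "norm (indicator K x *\<^sub>R f x * \<psi> x) \<le> norm (B * (indicator K x *\<^sub>R f x))"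
        unfolding real_norm_def abs_mult[of B] abs_mult[of _ "\<psi> x"] by (simp only: mult.commute)
    qed
  qed
  then show "integrable (lebesgue_on \<Omega>) (\<lambda>x. f x * \<psi> x)"
    unfolding integrable_lebesgue_on_iff[OF \<Omega>l] eq .
  show "(LINT x|lebesgue_on \<Omega>. f x * \<psi> x) = (LINT x|lebesgue. (indicator K x *\<^sub>R f x) * \<psi> x)"
    unfolding integral_lebesgue_on[OF \<Omega>l] eq ..
qed

lemma test_functionsE:
  assumes "\<psi> \<in> test_functions \<Omega>"
  obtains K where "compact K" "K \<subseteq> \<Omega>" "\<And>x. x \<notin> K \<Longrightarrow> \<psi> x = 0" "\<And>x i. x \<notin> K \<Longrightarrow> partial_deriv i \<psi> x = 0"
    "continuous_on UNIV \<psi>" "\<And>i. continuous_on UNIV (partial_deriv i \<psi>)" "\<And>x. \<psi> differentiable (at x)"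
proof -
  have C: "C_class 1 \<psi>" and s: "compactly_supported_in \<Omega> \<psi>" using assms by (auto simp: test_functions_def)
  obtain K where K: "compact K" "K \<subseteq> \<Omega>" "\<And>x. x \<notin> K \<Longrightarrow> \<psi> x = 0"
    using compactly_supported_inE[OF s] by blast
  show ?thesis
    by (rule that[of K])
      (use K C C_class_imp_continuous[OF C] partial_deriv_eq_0_outside[OF compact_imp_closed[OF K(1)] K(3)] in auto)
qed

text \<open>A convolution evaluated at \<open>x\<close> thereby becomes an integral against a test
  function, which is how the weak formulation is exploited pointwise.\<close>

lemma test_function_mollifier:
  assumes "mollifier r \<rho>" "cball x r \<subseteq> \<Omega>"
  shows "(\<lambda>y. \<rho> (x - y)) \<in> test_functions \<Omega>"
proof -
  have "\<forall>k. C_class k (\<lambda>y. \<rho> (x - y))"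
    using C_class_scale_reflect[OF mollifierD(1)[OF assms(1)], of _ 1 x] by simp
  moreover have "compactly_supported_in \<Omega> (\<lambda>y. \<rho> (x - y))"
    by (rule compactly_supported_inI[OF compact_cball assms(2)])
      (use mollifierD(3)[OF assms(1)] in \<open>force simp: dist_norm\<close>)
  ultimately show ?thesis by (simp add: test_functions_def)
qed

text \<open>The last property leaves room for mollification: kernels of one common radius centred in
  \<open>K m\<close> are supported in a single compact set.\<close>

lemma compact_exhaustion:
  fixes \<Omega> :: "(real ^ 'n) set"
  assumes "open \<Omega>"
  obtains K :: "nat \<Rightarrow> (real ^ 'n) set" where "\<And>j. compact (K j)" "\<And>j. K j \<subseteq> \<Omega>" "(\<Union>j. K j) = \<Omega>"
    "\<And>m. \<exists>j. \<exists>r>0. \<forall>x\<in>K m. cball x r \<subseteq> K j"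
proof -
  define K where "K j = cball 0 (real j) \<inter> (\<Inter>y\<in>- \<Omega>. {x. dist x y \<ge> 1 / real (Suc j)})" for j
  have "compact (K j)" for j
    unfolding K_def by (intro compact_Int_closed compact_cball closed_INT ballI closed_Collect_le continuous_intros)
  moreover have sub: "K j \<subseteq> \<Omega>" for j
  proof
    fix x assume "x \<in> K j"
    show "x \<in> \<Omega>"
    proof (rule ccontr)
      assume "x \<notin> \<Omega>"
      then have "dist x x \<ge> 1 / real (Suc j)" using \<open>x \<in> K j\<close> unfolding K_def by blast
      then show False by simp
    qed
  qed
  moreover have "(\<Union>j. K j) = \<Omega>"
  proof
    show "\<Omega> \<subseteq> (\<Union>j. K j)"
    proof
      fix x assume "x \<in> \<Omega>"
      then obtain e where e: "e > 0" "ball x e \<subseteq> \<Omega>" using assms open_contains_ball by blast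
      obtain N1 where N1: "1 / real (Suc N1) < e" using e(1) nat_approx_posE by blast
      obtain N2 where N2: "norm x \<le> real N2" using real_arch_simple by blast
      define N where "N = max N1 N2"
      have "1 / real (Suc N) \<le> 1 / real (Suc N1)" by (auto simp: N_def intro!: frac_le)
      then have "1 / real (Suc N) \<le> e" using N1 by simp
      moreover have "dist x y \<ge> e" if "y \<notin> \<Omega>" for y using that e(2) by (meson mem_ball not_le subsetD)
      moreover have "norm x \<le> real N" using N2 by (auto simp: N_def)
      ultimately have "x \<in> K N" by (force simp: K_def)
      then show "x \<in> (\<Union>j. K j)" by blast
    qed
  qed (use sub in blast)
  moreover have "\<exists>j. \<exists>r>0. \<forall>x\<in>K m. cball x r \<subseteq> K j" for m
  proof -
    \<comment> \<open>With this index \<open>1 / (m + 1)\<close> is twice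
      \<open>1 / (j + 1)\<close>, so a move by \<open>r\<close> spends half of the distance to the
      complement. The norm grows by at most 1, and \<open>m + 1 \<le> j\<close>.\<close>
    define j where "j = 2 * m + 1"
    define r where "r = 1 / real (Suc j)"
    have r: "1 / real (Suc m) = 2 * r" "r > 0" "r \<le> 1" by (auto simp: r_def j_def field_simps)
    have "y \<in> K j" if x: "x \<in> K m" and y: "y \<in> cball x r" for x y
    proof -
      have "norm y \<le> norm x + dist x y" using norm_triangle_ineq2[of y x] by (simp add: dist_norm norm_minus_commute)
      then have "norm y \<le> real j" using x y r by (auto simp: K_def j_def)
      moreover have "dist y z \<ge> r" if "z \<notin> \<Omega>" for z
      proof -
        have "dist x z \<ge> 2 * r" using x that unfolding K_def r(1) by auto
        then show ?thesis using y dist_triangle[of x z y] by (auto simp: dist_commute)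
      qed
      ultimately show ?thesis by (auto simp: K_def r_def)
    qed
    then show ?thesis using r(2) by blast
  qed
  ultimately show ?thesis by (rule that)
qed

lemma mollifier_sequence_small:
  assumes "r > 0"
  obtains N where "\<And>n. n \<ge> N \<Longrightarrow> 1 / real (Suc n) \<le> r"
proof -
  obtain N where N: "1 / real (Suc N) < r" using assms nat_approx_posE by blast
  have "1 / real (Suc n) \<le> r" if "n \<ge> N" for n
    using N frac_le[of 1 1 "real (Suc N)" "real (Suc n)"] that by linarith
  then show ?thesis by (rule that)
qed

text \<open>On a compact set the mollified values of \<open>f\<close> are integrals against test
  functions, hence 0 for small radii, while along a subsequence they converge to \<open>f\<close>
  almost everywhere.\<close>

theorem fundamental_lemma:
  fixes f :: "real ^ 'n \<Rightarrow> real"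
  assumes \<Omega>: "open \<Omega>" and f: "locally_integrable \<Omega> f"
    and test: "\<And>\<psi>. \<psi> \<in> test_functions \<Omega> \<Longrightarrow> (LINT x|lebesgue_on \<Omega>. f x * \<psi> x) = 0"
  shows "AE x in lebesgue_on \<Omega>. f x = 0"
proof -
  obtain K :: "nat \<Rightarrow> (real ^ 'n) set" where K: "\<And>j. compact (K j)" "\<And>j. K j \<subseteq> \<Omega>" "(\<Union>j. K j) = \<Omega>"
    "\<And>m. \<exists>j. \<exists>r>0. \<forall>x\<in>K m. cball x r \<subseteq> K j"
    using compact_exhaustion[OF \<Omega>] by metis
  obtain \<rho> :: "nat \<Rightarrow> real ^ 'n \<Rightarrow> real" where \<rho>: "mollifier_sequence \<rho>"
    using exists_mollifier_sequence by blast
  have m: "mollifier (1 / real (Suc n)) (\<rho> n)" for n using \<rho> by (simp add: mollifier_sequence_def)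
  have "AE x in lebesgue. x \<in> K k \<longrightarrow> f x = 0" for k
  proof -
    obtain j r where r: "r > 0" "\<And>x. x \<in> K k \<Longrightarrow> cball x r \<subseteq> K j" using K(4)[of k] by blast
    \<comment> \<open>Mollification asks for an integrable function, so \<open>f\<close> is cut off.
      \<open>K j\<close> contains the supports of the small kernels centred in \<open>K k\<close>,
      which therefore do not see the cut-off.\<close>
    define F where "F x = indicator (K j) x *\<^sub>R f x" for x
    have F: "integrable lebesgue F"
      using f K(1,2)[of j] compact_in_sets_lebesgue[OF K(1)[of j]]
      unfolding F_def locally_integrable_def by (subst integrable_lebesgue_on_iff[symmetric]) auto
    obtain s :: "nat \<Rightarrow> nat" where s: "strict_mono s" "AE x in lebesgue. (\<lambda>n. convol (\<rho> (s n)) F x - F x) \<longlonglongrightarrow> 0"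
      using tendsto_L1_AE_subseq[OF _ convol_L1[OF \<rho> F]] integrable_convol_L1(1)[OF m F] F by auto
    obtain N where N: "\<And>n. n \<ge> N \<Longrightarrow> 1 / real (Suc n) \<le> r" using mollifier_sequence_small[OF r(1)] by blast
    have zero: "convol (\<rho> n) F x = 0" if x: "x \<in> K k" and n: "n \<ge> N" for n x
    proof -
      have sub: "cball x (1 / real (Suc n)) \<subseteq> K j" using r(2)[OF x] N[OF n] by (auto simp: subset_iff)
      have "convol (\<rho> n) F x = (LINT y|lebesgue. indicator (K j) y *\<^sub>R f y * \<rho> n (x - y))"
        by (simp add: convol_def F_def mult.commute mult.left_commute)
      also have "\<dots> = (LINT y|lebesgue_on \<Omega>. f y * \<rho> n (x - y))"
      proof (rule integrable_locally_mult_compact(2)[symmetric, OF f K(1,2) _ _ \<Omega>])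
        show "continuous_on UNIV (\<lambda>y. \<rho> n (x - y))"
          by (rule continuous_on_compose2[OF mollifier_compact_support(4)[OF m]]) (auto intro!: continuous_intros)
        show "\<rho> n (x - y) = 0" if "y \<notin> K j" for y
          using that sub mollifierD(3)[OF m, of n "x - y"] by (force simp: dist_norm)
      qed
      also have "\<dots> = 0"
        using sub K(2)[of j] by (intro test test_function_mollifier[OF m]) auto
      finally show ?thesis .
    qed
    show ?thesis
      using s(2)
    proof eventually_elim
      case (elim x)
      show ?case
      proof
        assume x: "x \<in> K k"
        have "eventually (\<lambda>n. convol (\<rho> (s n)) F x - F x = - F x) sequentially"
          unfolding eventually_sequentially
        proof (intro exI allI impI)
          fix n assume "n \<ge> N"
          then have "s n \<ge> N" using strict_mono_imp_increasing[OF s(1), of n] by linarith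
          then show "convol (\<rho> (s n)) F x - F x = - F x" using zero[OF x] by simp
        qed
        then have "(\<lambda>n. convol (\<rho> (s n)) F x - F x) \<longlonglongrightarrow> - F x" by (rule tendsto_eventually)
        then have "- F x = 0" using elim LIMSEQ_unique by blast
        moreover have "x \<in> K j" using r(1) r(2)[OF x] by auto
        ultimately show "f x = 0" by (simp add: F_def)
      qed
    qed
  qed
  then have "AE x in lebesgue. \<forall>k. x \<in> K k \<longrightarrow> f x = 0" unfolding AE_all_countable by blast
  then show ?thesis
    unfolding AE_lebesgue_on_iff[OF open_in_sets_lebesgue[OF \<Omega>]]
    by eventually_elim (use K(3) in blast)
qed

lemma locally_integrable_component:
  fixes g :: "real ^ 'n \<Rightarrow> real ^ 'n"
  shows "locally_integrable \<Omega> g \<Longrightarrow> locally_integrable \<Omega> (\<lambda>x. g x $ i)"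
  unfolding locally_integrable_def
  using integrable_bounded_linear[OF bounded_linear_vec_nth] by blast

theorem weak_gradient_unique:
  fixes u :: "real ^ 'n \<Rightarrow> real"
  assumes \<Omega>: "open \<Omega>" and g: "has_weak_gradient \<Omega> u g" and h: "has_weak_gradient \<Omega> u h"
  shows "AE x in lebesgue_on \<Omega>. g x = h x"
proof -
  have "AE x in lebesgue_on \<Omega>. g x $ i - h x $ i = 0" for i
  proof (rule fundamental_lemma[OF \<Omega>])
    have lg: "locally_integrable \<Omega> (\<lambda>x. g x $ i)" and lh: "locally_integrable \<Omega> (\<lambda>x. h x $ i)"
      using g h by (auto simp: has_weak_gradient_def intro: locally_integrable_component)
    then show "locally_integrable \<Omega> (\<lambda>x. g x $ i - h x $ i)"
      by (auto simp: locally_integrable_def)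
    fix \<psi> :: "real ^ 'n \<Rightarrow> real" assume \<psi>: "\<psi> \<in> test_functions \<Omega>"
    obtain K where K: "compact K" "K \<subseteq> \<Omega>" "\<And>x. x \<notin> K \<Longrightarrow> \<psi> x = 0" "continuous_on UNIV \<psi>"
      using test_functionsE[OF \<psi>] by metis
    have "(LINT x|lebesgue_on \<Omega>. (g x $ i - h x $ i) * \<psi> x) =
        (LINT x|lebesgue_on \<Omega>. g x $ i * \<psi> x) - (LINT x|lebesgue_on \<Omega>. h x $ i * \<psi> x)"
      unfolding left_diff_distrib
      by (intro Bochner_Integration.integral_diff integrable_locally_mult_compact(1)[OF _ K(1,2,4,3) \<Omega>] lg lh)
    also have "\<dots> = 0"
      using g h \<psi> unfolding has_weak_gradient_def by fastforce
    finally show "(LINT x|lebesgue_on \<Omega>. (g x $ i - h x $ i) * \<psi> x) = 0" .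
  qed
  then have "AE x in lebesgue_on \<Omega>. \<forall>i. g x $ i - h x $ i = 0" by (simp add: AE_all_countable)
  then show ?thesis by eventually_elim (simp add: vec_eq_iff)
qed

subsection \<open>The chain rule for smooth functions\<close>

lemma integral_lebesgue_translate:
  fixes h :: "real ^ 'n \<Rightarrow> real"
  assumes "continuous_on UNIV h"
  shows "(LINT x|lebesgue. h (x + c)) = (LINT x|lebesgue. h x)"
proof -
  note [measurable] = borel_measurable_continuous_onI[OF assms]
  have "(LINT x|lborel. h x) = (LINT x|distr lborel borel ((+) c). h x)"
    by (subst lborel_distr_plus) simp
  also have "\<dots> = (LINT x|lborel. h (x + c))"
    by (subst integral_distr) (auto simp: add.commute)
  finally show ?thesis
    by (subst (1 2) integral_completion) auto
qed

text \<open>Translation invariance gives every difference quotient of \<open>h\<close> the integral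
  0, and dominated convergence passes to the derivative. Applied to a product, this is integration
  by parts.\<close>

theorem integral_directional_derivative_eq_0:
  fixes h d :: "real ^ 'n \<Rightarrow> real" and e :: "real ^ 'n"
  assumes h: "continuous_on UNIV h" and d: "continuous_on UNIV d"
    and K: "compact K" "\<And>x. x \<notin> K \<Longrightarrow> h x = 0" "\<And>x. x \<notin> K \<Longrightarrow> d x = 0"
    and deriv: "\<And>x. ((\<lambda>t. h (x + t *\<^sub>R e)) has_real_derivative d x) (at 0)"
  shows "(LINT x|lebesgue. d x) = 0"
proof -
  obtain B where B: "\<And>x. norm (d x) \<le> B" using bounded_of_compact_support[OF d K(1,3)] by blast
  obtain R where R: "\<And>x. x \<in> K \<Longrightarrow> norm x \<le> R" using compact_imp_bounded[OF K(1)] bounded_iff by blast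
  have h_int: "integrable lebesgue h" by (rule integrable_continuous_compact_support[OF h K(1,2)])
  have ht_cont: "continuous_on UNIV (\<lambda>x. h (x + c))" for c
    by (rule continuous_on_compose2[OF h]) (auto intro!: continuous_intros)
  have deriv': "((\<lambda>t. h (x + t *\<^sub>R e)) has_real_derivative d (x + t *\<^sub>R e)) (at t)" for x t
  proof -
    have "((\<lambda>s. h ((x + t *\<^sub>R e) + (s + - t) *\<^sub>R e)) has_real_derivative d (x + t *\<^sub>R e)) (at t)"
      using deriv[of "x + t *\<^sub>R e"] DERIV_shift[of "\<lambda>s. h ((x + t *\<^sub>R e) + s *\<^sub>R e)" "d (x + t *\<^sub>R e)" t "- t"] by simp
    then show ?thesis by (simp add: algebra_simps)
  qed
  have lip: "\<bar>h (x + t *\<^sub>R e) - h x\<bar> \<le> B * t" if t: "t > 0" for x t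
  proof -
    obtain z where "0 < z" "z < t" "h (x + t *\<^sub>R e) - h (x + 0 *\<^sub>R e) = (t - 0) * d (x + z *\<^sub>R e)"
      using MVT2[OF t deriv'[of x]] by blast
    then show ?thesis using B[of "x + z *\<^sub>R e"] t by (simp add: abs_mult mult.commute mult_left_mono)
  qed
  define \<tau> where "\<tau> n = 1 / real (Suc n)" for n
  have \<tau>: "\<tau> n > 0" "\<tau> n \<le> 1" for n by (auto simp: \<tau>_def)
  have \<tau>0: "\<tau> \<longlonglongrightarrow> 0" unfolding \<tau>_def using LIMSEQ_inverse_real_of_nat by (simp add: divide_inverse)
  define q where "q n x = (h (x + \<tau> n *\<^sub>R e) - h x) / \<tau> n" for n x
  have int_t: "integrable lebesgue (\<lambda>x. h (x + c))" for c
  proof (rule integrable_continuous_compact_support[OF ht_cont, of "(\<lambda>x. x - c) ` K"])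
    show "compact ((\<lambda>x. x - c) ` K)" using K(1) by (intro compact_continuous_image continuous_intros)
    show "h (x + c) = 0" if "x \<notin> (\<lambda>x. x - c) ` K" for x
      using that K(2)[of "x + c"] by (metis add_diff_cancel imageI)
  qed
  have q_int: "integrable lebesgue (q n)" for n
    unfolding q_def using int_t h_int by (intro integrable_divide_zero Bochner_Integration.integrable_diff) auto
  have q_zero: "(LINT x|lebesgue. q n x) = 0" for n
    unfolding q_def using int_t h_int integral_lebesgue_translate[OF h] by simp
  have "(\<lambda>n. LINT x|lebesgue. q n x) \<longlonglongrightarrow> (LINT x|lebesgue. d x)"
  \<comment> \<open>Since \<open>\<tau> n \<le> 1\<close>, the shift is at most
    \<open>norm e\<close>, and the quotients vanish outside this ball; by the mean value theorem
    they are bounded by \<open>B\<close>.\<close>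
  proof (rule integral_dominated_convergence[where w = "\<lambda>x. B * indicator (cball 0 (R + norm e)) x"])
    show "integrable lebesgue (\<lambda>x. B * indicator (cball (0 :: real ^ 'n) (R + norm e)) x :: real)"
      by (intro integrable_mult_right integrable_real_indicator)
        (auto intro: emeasure_lborel_cball_finite[unfolded infinity_ennreal_def])
    show "AE x in lebesgue. (\<lambda>n. q n x) \<longlonglongrightarrow> d x"
    proof (rule AE_I2)
      fix x
      have "((\<lambda>t. (h (x + t *\<^sub>R e) - h x) / t) \<longlongrightarrow> d x) (at 0)"
        using deriv[of x] by (simp add: DERIV_def)
      then show "(\<lambda>n. q n x) \<longlonglongrightarrow> d x"
        unfolding tendsto_at_iff_sequentially q_def using \<tau>(1) \<tau>0 by (auto simp: o_def less_imp_neq[symmetric])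
    qed
    show "AE x in lebesgue. norm (q n x) \<le> B * indicator (cball 0 (R + norm e)) x" for n
    proof (rule AE_I2)
      fix x
      show "norm (q n x) \<le> B * indicator (cball 0 (R + norm e)) x"
      proof (cases "x \<in> cball 0 (R + norm e)")
        case True
        then show ?thesis
          using lip[OF \<tau>(1), of x n] \<tau>(1)[of n] by (simp add: q_def field_simps)
      next
        case False
        have "norm (\<tau> n *\<^sub>R e) \<le> norm e" using \<tau>[of n] by (simp add: mult_left_le_one_le)
        then have "norm (x + \<tau> n *\<^sub>R e) > R"
          using False norm_triangle_ineq2[of x "- (\<tau> n *\<^sub>R e)"] by simp
        moreover have "norm x > R" using False norm_ge_zero[of e] unfolding mem_cball dist_0_norm by linarith
        ultimately have "h (x + \<tau> n *\<^sub>R e) = 0" "h x = 0" using R K(2) by (meson not_le)+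
        then show ?thesis using False by (simp add: q_def)
      qed
    qed
  qed (use q_int borel_measurable_lebesgue_continuous[OF d] in auto)
  then have "(\<lambda>n. 0) \<longlonglongrightarrow> (LINT x|lebesgue. d x)" unfolding q_zero .
  then show ?thesis using LIMSEQ_unique[OF tendsto_const] by metis
qed

lemma has_real_derivative_partial_deriv:
  fixes f :: "real ^ 'n \<Rightarrow> real"
  assumes "f differentiable (at x)"
  shows "((\<lambda>t. f (x + t *\<^sub>R axis i 1)) has_real_derivative partial_deriv i f x) (at 0)"
proof -
  have "(f has_derivative frechet_derivative f (at x)) (at (x + 0 *\<^sub>R axis i 1))"
    using assms by (simp add: frechet_derivative_works)
  then have "((\<lambda>t. f (x + t *\<^sub>R axis i 1)) has_derivative
      (\<lambda>t. frechet_derivative f (at x) (t *\<^sub>R axis i 1))) (at 0)"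
    by (rule has_derivative_compose[rotated]) (auto intro!: derivative_eq_intros)
  moreover have "frechet_derivative f (at x) (t *\<^sub>R axis i 1) = partial_deriv i f x * t" for t
    using linear_scale[OF linear_frechet_derivative[OF assms]] by (simp add: partial_deriv_def mult.commute)
  ultimately show ?thesis by (simp add: has_field_derivative_def)
qed

lemma has_weak_gradientI:
  fixes u :: "real ^ 'n \<Rightarrow> real"
  assumes "open \<Omega>" "integrable (lebesgue_on \<Omega>) u" "integrable (lebesgue_on \<Omega>) g"
    and "\<And>\<psi> i. \<psi> \<in> test_functions \<Omega> \<Longrightarrow>
      (LINT x|lebesgue_on \<Omega>. u x * partial_deriv i \<psi> x) = - (LINT x|lebesgue_on \<Omega>. g x $ i * \<psi> x)"
  shows "has_weak_gradient \<Omega> u g"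
  using assms by (auto simp: has_weak_gradient_def intro: locally_integrableI)

lemma has_weak_gradientD:
  assumes "has_weak_gradient \<Omega> u g" "\<psi> \<in> test_functions \<Omega>"
  shows "(LINT x|lebesgue_on \<Omega>. u x * partial_deriv i \<psi> x) = - (LINT x|lebesgue_on \<Omega>. g x $ i * \<psi> x)"
  using assms by (auto simp: has_weak_gradient_def)

lemma integral_lebesgue_on_eq:
  fixes f h :: "real ^ 'n \<Rightarrow> real"
  assumes "\<Omega> \<in> sets lebesgue" "\<And>x. x \<in> \<Omega> \<Longrightarrow> f x = h x" "\<And>x. x \<notin> \<Omega> \<Longrightarrow> h x = 0"
  shows "(LINT x|lebesgue_on \<Omega>. f x) = (LINT x|lebesgue. h x)"
  unfolding integral_lebesgue_on[OF assms(1)]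
  by (rule Bochner_Integration.integral_cong[OF refl]) (use assms in \<open>auto simp: indicator_def\<close>)

text \<open>At points whose \<open>r\<close>-ball stays in \<open>\<Omega>\<close>, mollification
  commutes with weak differentiation. The derivative moves to the kernel, a test function in
  \<open>y\<close>, and the sign from the reflection cancels the sign in the weak
  formulation.\<close>

lemma partial_deriv_convol_weak:
  fixes u :: "real ^ 'n \<Rightarrow> real" and g :: "real ^ 'n \<Rightarrow> real ^ 'n"
  assumes \<Omega>: "open \<Omega>" and w: "has_weak_gradient \<Omega> u g"
    and u: "integrable (lebesgue_on \<Omega>) u" and g: "integrable (lebesgue_on \<Omega>) g"
    and m: "mollifier r \<rho>" and sub: "cball x r \<subseteq> \<Omega>"
  shows "partial_deriv i (convol \<rho> (\<lambda>y. indicator \<Omega> y *\<^sub>R u y)) x = convol \<rho> (\<lambda>y. indicator \<Omega> y *\<^sub>R g y) x $ i"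
proof -
  note \<Omega>l = open_in_sets_lebesgue[OF \<Omega>]
  have u': "integrable lebesgue (\<lambda>y. indicator \<Omega> y *\<^sub>R u y)" and g': "integrable lebesgue (\<lambda>y. indicator \<Omega> y *\<^sub>R g y)"
    using u g by (auto simp only: integrable_lebesgue_on_iff[OF \<Omega>l])
  have pd: "partial_deriv i (\<lambda>y. \<rho> (x - y)) y = - partial_deriv i \<rho> (x - y)" for y
    using mollifier_compact_support(1)[OF m] by (intro partial_deriv_reflect) simp
  have "partial_deriv i (convol \<rho> (\<lambda>y. indicator \<Omega> y *\<^sub>R u y)) x
      = convol (partial_deriv i \<rho>) (\<lambda>y. indicator \<Omega> y *\<^sub>R u y) x"
    using partial_deriv_convol[OF mollifier_compact_support(1,2,3)[OF m] u'] by simp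
  also have "\<dots> = (LINT y|lebesgue_on \<Omega>. - (u y * partial_deriv i (\<lambda>y. \<rho> (x - y)) y))"
    unfolding convol_def pd integral_lebesgue_on[OF \<Omega>l]
    by (rule Bochner_Integration.integral_cong) (auto simp: mult_ac)
  also have "\<dots> = (LINT y|lebesgue_on \<Omega>. g y $ i * \<rho> (x - y))"
    using has_weak_gradientD[OF w test_function_mollifier[OF m sub], of i] by simp
  also have "\<dots> = (LINT y|lebesgue. (\<rho> (x - y) *\<^sub>R (indicator \<Omega> y *\<^sub>R g y)) $ i)"
    unfolding integral_lebesgue_on[OF \<Omega>l]
    by (rule Bochner_Integration.integral_cong) (auto simp: mult_ac)
  also have "\<dots> = convol \<rho> (\<lambda>y. indicator \<Omega> y *\<^sub>R g y) x $ i"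
    unfolding convol_def
    by (rule integral_bounded_linear[OF bounded_linear_vec_nth integrable_convol_mollifier[OF m g']])
  finally show ?thesis .
qed

lemma finite_measure_lebesgue_on_bounded_open:
  fixes \<Omega> :: "(real ^ 'n) set"
  assumes "open \<Omega>" "bounded \<Omega>"
  shows "finite_measure (lebesgue_on \<Omega>)"
  using assms by (intro finite_measure_lebesgue_on lmeasurable_open)

lemma lipschitz_imp_continuous:
  fixes F :: "real \<Rightarrow> real"
  assumes "\<And>s t. \<bar>F s - F t\<bar> \<le> B * \<bar>s - t\<bar>"
  shows "continuous_on UNIV F"
proof (rule continuous_onI)
  fix x e :: real assume e: "e > 0"
  have "dist (F y) (F x) \<le> e" if "dist y x < e / (\<bar>B\<bar> + 1)" for y
  proof -
    have "dist (F y) (F x) \<le> B * \<bar>y - x\<bar>" using assms by (simp add: dist_real_def)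
    also have "\<dots> \<le> (\<bar>B\<bar> + 1) * \<bar>y - x\<bar>" by (intro mult_right_mono) auto
    also have "\<dots> \<le> e" using that by (simp add: dist_real_def field_simps)
    finally show ?thesis .
  qed
  then show "\<exists>d>0. \<forall>x'\<in>UNIV. dist x' x < d \<longrightarrow> dist (F x') (F x) \<le> e"
    using e by (intro exI[of _ "e / (\<bar>B\<bar> + 1)"]) auto
qed

lemma integrable_lipschitz_compose:
  fixes F :: "real \<Rightarrow> real" and u :: "'a \<Rightarrow> real"
  assumes "finite_measure M" and F: "\<And>s t. \<bar>F s - F t\<bar> \<le> B * \<bar>s - t\<bar>" and u: "integrable M u"
  shows "integrable M (\<lambda>x. F (u x))"
proof (rule Bochner_Integration.integrable_bound)
  interpret finite_measure M by fact
  show "integrable M (\<lambda>x. \<bar>F 0\<bar> + \<bar>B * u x\<bar>)" using u by auto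
  show "(\<lambda>x. F (u x)) \<in> borel_measurable M"
    using borel_measurable_continuous_onI[OF lipschitz_imp_continuous[OF F]] u
    by (auto intro: measurable_compose)
  show "AE x in M. norm (F (u x)) \<le> norm (\<bar>F 0\<bar> + \<bar>B * u x\<bar>)"
  proof (rule AE_I2)
    fix x
    have "B * \<bar>u x\<bar> \<le> \<bar>B * u x\<bar>" by (simp add: abs_mult mult_right_mono)
    then show "norm (F (u x)) \<le> norm (\<bar>F 0\<bar> + \<bar>B * u x\<bar>)"
      using F[of "u x" 0] by simp
  qed
qed

lemma integrable_mult_bounded:
  fixes f :: "'a \<Rightarrow> 'b::euclidean_space" and c :: "'a \<Rightarrow> real"
  assumes "integrable M f" "c \<in> borel_measurable M" "\<And>x. \<bar>c x\<bar> \<le> B"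
  shows "integrable M (\<lambda>x. c x *\<^sub>R f x)"
proof (rule Bochner_Integration.integrable_bound)
  show "integrable M (\<lambda>x. B *\<^sub>R f x)" using assms by simp
  show "(\<lambda>x. c x *\<^sub>R f x) \<in> borel_measurable M" using assms by measurable
  show "AE x in M. norm (c x *\<^sub>R f x) \<le> norm (B *\<^sub>R f x)"
    using assms(3) by (auto intro!: AE_I2 mult_right_mono intro: order_trans[OF _ abs_ge_self])
qed

text \<open>The classical chain rule is applied to mollifications of \<open>u\<close>, tested
  against \<open>\<psi>\<close>, and the radius sent to 0. Near the support of \<open>\<psi>\<close>
  the gradient of the mollification is eventually the mollified weak gradient.\<close>

lemma chain_rule_C1:
  fixes u :: "real ^ 'n \<Rightarrow> real"
  assumes \<Omega>: "open \<Omega>" "bounded \<Omega>" and w: "has_weak_gradient \<Omega> u g"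
    and u: "integrable (lebesgue_on \<Omega>) u" and g: "integrable (lebesgue_on \<Omega>) g"
    and F: "\<And>t. (F has_real_derivative F' t) (at t)" and F': "continuous_on UNIV F'" "\<And>t. \<bar>F' t\<bar> \<le> B"
  shows "has_weak_gradient \<Omega> (\<lambda>x. F (u x)) (\<lambda>x. F' (u x) *\<^sub>R g x)"
proof (rule has_weak_gradientI[OF \<Omega>(1)])
  note \<Omega>l = open_in_sets_lebesgue[OF \<Omega>(1)]
  note fin = finite_measure_lebesgue_on_bounded_open[OF \<Omega>]
  have lip: "\<bar>F s - F t\<bar> \<le> B * \<bar>s - t\<bar>" for s t
    using field_differentiable_bound[of UNIV F F' B s t] F F'(2) by auto
  have B: "B \<ge> 0" using F'(2)[of 0] by linarith
  have F_cont: "continuous_on UNIV F" by (rule lipschitz_imp_continuous[OF lip])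
  note [measurable] = borel_measurable_continuous_onI[OF F'(1)] borel_measurable_continuous_onI[OF F_cont]
  show "integrable (lebesgue_on \<Omega>) (\<lambda>x. F (u x))" by (rule integrable_lipschitz_compose[OF fin lip u])
  show "integrable (lebesgue_on \<Omega>) (\<lambda>x. F' (u x) *\<^sub>R g x)"
    by (rule integrable_mult_bounded[OF g _ F'(2)]) (use u in measurable)
  fix \<psi> :: "real ^ 'n \<Rightarrow> real" and i assume \<psi>: "\<psi> \<in> test_functions \<Omega>"
  obtain K where K: "compact K" "K \<subseteq> \<Omega>" "\<And>x. x \<notin> K \<Longrightarrow> \<psi> x = 0" "\<And>x i. x \<notin> K \<Longrightarrow> partial_deriv i \<psi> x = 0"
    "continuous_on UNIV \<psi>" "\<And>i. continuous_on UNIV (partial_deriv i \<psi>)" "\<And>x. \<psi> differentiable (at x)"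
    using test_functionsE[OF \<psi>] by metis
  obtain r where r: "r > 0" "(\<Union>x\<in>K. cball x r) \<subseteq> \<Omega>"
    using compact_subset_open_imp_cball_epsilon_subset[OF K(1) \<Omega>(1) K(2)] by blast
  obtain N where N: "\<And>n. n \<ge> N \<Longrightarrow> 1 / real (Suc n) \<le> r" using mollifier_sequence_small[OF r(1)] by blast
  obtain P where P: "\<And>x. norm (\<psi> x) \<le> P" using bounded_of_compact_support[OF K(5,1,3)] by blast
  obtain Q where Q: "\<And>x. norm (partial_deriv i \<psi> x) \<le> Q" using bounded_of_compact_support[OF K(6,1,4)] by blast
  have P0: "P \<ge> 0" "Q \<ge> 0" using P[of 0] Q[of 0] norm_ge_zero order_trans by blast+
  define U where "U x = indicator \<Omega> x *\<^sub>R u x" for x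
  define G where "G x = indicator \<Omega> x *\<^sub>R g x" for x
  have U: "integrable lebesgue U" and G: "integrable lebesgue G"
    using u g unfolding U_def G_def by (auto simp only: integrable_lebesgue_on_iff[OF \<Omega>l])
  obtain \<rho> :: "nat \<Rightarrow> real ^ 'n \<Rightarrow> real" where \<rho>: "mollifier_sequence \<rho>"
    using exists_mollifier_sequence by blast
  have m0: "mollifier (1 / real (Suc n)) (\<rho> n)" for n using \<rho> by (simp add: mollifier_sequence_def)
  \<comment> \<open>Two successive extractions: along \<open>s\<close> the mollifications of
    \<open>U\<close> converge almost everywhere, and along the further subsequence
    \<open>s (t n)\<close> those of \<open>G\<close> as well.\<close>
  obtain s :: "nat \<Rightarrow> nat" where s: "strict_mono s" "AE x in lebesgue. (\<lambda>n. convol (\<rho> (s n)) U x - U x) \<longlonglongrightarrow> 0"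
    using tendsto_L1_AE_subseq[OF _ convol_L1[OF \<rho> U]] integrable_convol_L1(1)[OF m0 U] U by auto
  have \<rho>s: "mollifier_sequence (\<lambda>n. \<rho> (s n))" by (rule mollifier_sequence_subseq[OF \<rho> s(1)])
  obtain t :: "nat \<Rightarrow> nat" where t: "strict_mono t" "AE x in lebesgue. (\<lambda>n. convol (\<rho> (s (t n))) G x - G x) \<longlonglongrightarrow> 0"
    using tendsto_L1_AE_subseq[OF _ convol_L1[OF \<rho>s G]] integrable_convol_L1(1)[OF m0 G] G by auto
  have \<sigma>: "mollifier_sequence (\<lambda>n. \<rho> (s (t n)))" by (rule mollifier_sequence_subseq[OF \<rho>s t(1)])
  define \<sigma> where "\<sigma> n = \<rho> (s (t n))" for n
  have m: "mollifier (1 / real (Suc n)) (\<sigma> n)" for n using \<sigma> by (simp add: mollifier_sequence_def \<sigma>_def)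
  define V where "V n = convol (\<sigma> n) U" for n
  define H where "H n = convol (\<sigma> n) G" for n
  have V: "integrable lebesgue (V n)" and H: "integrable lebesgue (H n)" for n
    unfolding V_def H_def by (rule integrable_convol_L1(1)[OF m U], rule integrable_convol_L1(1)[OF m G])
  have V_lim: "(\<lambda>n. LINT x|lebesgue. norm (V n x - U x)) \<longlonglongrightarrow> 0"
    and H_lim: "(\<lambda>n. LINT x|lebesgue. norm (H n x - G x)) \<longlonglongrightarrow> 0"
    unfolding V_def H_def \<sigma>_def by (rule convol_L1[OF \<sigma> U], rule convol_L1[OF \<sigma> G])
  have V_ae: "AE x in lebesgue. (\<lambda>n. V n x) \<longlonglongrightarrow> U x"
    using s(2)
  proof eventually_elim
    case (elim x)
    from LIMSEQ_subseq_LIMSEQ[OF elim t(1)] have "(\<lambda>n. V n x - U x) \<longlonglongrightarrow> 0"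
      by (simp add: V_def \<sigma>_def o_def)
    then show ?case by (rule LIM_zero_cancel)
  qed
  have H_ae: "AE x in lebesgue. (\<lambda>n. H n x) \<longlonglongrightarrow> G x"
    using t(2) by eventually_elim (rule LIM_zero_cancel, simp add: H_def \<sigma>_def)
  note [measurable] = borel_measurable_integrable[OF U] borel_measurable_integrable[OF G]
    borel_measurable_integrable[OF V] borel_measurable_integrable[OF H]
    borel_measurable_lebesgue_continuous[OF K(5)] borel_measurable_lebesgue_continuous[OF K(6)]
  note [measurable] = borel_measurable_integrable[OF integrable_bounded_linear[OF bounded_linear_vec_nth G]]
    borel_measurable_integrable[OF integrable_bounded_linear[OF bounded_linear_vec_nth H]]
  have V_C1: "C_class 1 (V n)" for n
    unfolding V_def by (rule C_class_convol[OF mollifier_compact_support(1,2,3)[OF m] U])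
  have V_diff: "V n differentiable (at x)" and V_cont: "continuous_on UNIV (V n)"
    and V_pcont: "continuous_on UNIV (partial_deriv i (V n))" for n x
    using V_C1[of n] C_class_imp_continuous[OF V_C1[of n]] by auto
  \<comment> \<open>The integrands of the two sides of the weak formulation for
    \<open>F (V n x)\<close>. In \<open>C\<close> the gradient of \<open>V n\<close> is already
    replaced by the mollified gradient \<open>H n\<close>, whose limit is known.\<close>
  define A where "A n x = F (V n x) * partial_deriv i \<psi> x" for n x
  define C where "C n x = F' (V n x) * (H n x $ i) * \<psi> x" for n x
  have int_A: "integrable lebesgue (A n)" for n
  proof -
    have "continuous_on UNIV (A n)"
      unfolding A_def by (intro continuous_intros K(6) continuous_on_compose2[OF F_cont V_cont]) auto
    then show ?thesis
      by (rule integrable_continuous_compact_support[OF _ K(1)]) (simp add: A_def K(4))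
  qed
  have int_C: "integrable lebesgue (C n)" for n
  proof -
    have "continuous_on UNIV (H n)"
      unfolding H_def by (rule continuous_convol_mollifier[OF m G])
    then have "continuous_on UNIV (C n)"
      unfolding C_def by (intro continuous_intros K(5) continuous_on_compose2[OF F'(1) V_cont]) auto
    then show ?thesis
      by (rule integrable_continuous_compact_support[OF _ K(1)]) (simp add: C_def K(3))
  qed
  have ibp: "(LINT x|lebesgue. A n x) = - (LINT x|lebesgue. C n x)" if n: "n \<ge> N" for n
  proof -
    \<comment> \<open>\<open>H n\<close> need not be the gradient of \<open>V n\<close> close to the
      boundary of \<open>\<Omega>\<close>, but there the factor \<open>\<psi> x\<close> is
      0.\<close>
    have VH: "partial_deriv i (V n) x * \<psi> x = H n x $ i * \<psi> x" for x
    proof (cases "x \<in> K")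
      case True
      then have "cball x r \<subseteq> \<Omega>" using r(2) by blast
      then have "cball x (1 / real (Suc n)) \<subseteq> \<Omega>"
        using subset_cball[OF N[OF n], of x] by (rule order_trans[rotated])
      then show ?thesis
        unfolding V_def H_def U_def G_def using partial_deriv_convol_weak[OF \<Omega>(1) w u g m] by simp
    qed (simp add: K(3))
    define d where "d x = F (V n x) * partial_deriv i \<psi> x + F' (V n x) * partial_deriv i (V n) x * \<psi> x" for x
    have "(LINT x|lebesgue. d x) = 0"
    proof (rule integral_directional_derivative_eq_0[where h = "\<lambda>x. F (V n x) * \<psi> x" and e = "axis i 1"])
      show "continuous_on UNIV (\<lambda>x. F (V n x) * \<psi> x)"
        by (intro continuous_intros K(5) continuous_on_compose2[OF F_cont V_cont]) auto
      show "continuous_on UNIV d"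
        unfolding d_def
        by (intro continuous_intros K(5,6) V_pcont continuous_on_compose2[OF F_cont V_cont]
            continuous_on_compose2[OF F'(1) V_cont]) auto
      show "compact K" by fact
      show "F (V n x) * \<psi> x = 0" "d x = 0" if "x \<notin> K" for x
        using K(3,4)[OF that] by (auto simp: d_def)
      show "((\<lambda>t. F (V n (x + t *\<^sub>R axis i 1)) * \<psi> (x + t *\<^sub>R axis i 1)) has_real_derivative d x) (at 0)" for x
      proof -
        have "((\<lambda>t. F (V n (x + t *\<^sub>R axis i 1))) has_real_derivative F' (V n x) * partial_deriv i (V n) x) (at 0)"
          by (rule DERIV_chain2[where f = F and g = "\<lambda>t. V n (x + t *\<^sub>R axis i 1)"])
            (use F[of "V n x"] has_real_derivative_partial_deriv[OF V_diff] in auto)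
        from DERIV_mult[OF this has_real_derivative_partial_deriv[OF K(7)]] show ?thesis
          by (simp add: d_def add.commute mult.commute)
      qed
    qed
    moreover have "d x = A n x + C n x" for x
      unfolding d_def A_def C_def mult.assoc VH by (rule refl)
    ultimately show ?thesis using int_A int_C by simp
  qed
  have A_lim: "(\<lambda>n. LINT x|lebesgue. norm (A n x - F (U x) * partial_deriv i \<psi> x)) \<longlonglongrightarrow> 0"
  proof (rule tendsto_integral_norm_0_dominated[where a = "\<lambda>n x. B * Q * norm (V n x - U x)" and b = "\<lambda>x. 0"])
    show "(\<lambda>x. A n x - F (U x) * partial_deriv i \<psi> x) \<in> borel_measurable lebesgue" for n
      unfolding A_def by measurable
    show "integrable lebesgue (\<lambda>x. B * Q * norm (V n x - U x))" for n using U V by auto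
    have "(\<lambda>n. B * Q * (LINT x|lebesgue. norm (V n x - U x))) \<longlonglongrightarrow> B * Q * 0"
      by (intro tendsto_mult_left V_lim)
    then show "(\<lambda>n. LINT x|lebesgue. \<bar>B * Q * norm (V n x - U x)\<bar>) \<longlonglongrightarrow> 0"
      using B P0 by (simp add: abs_mult)
    show "AE x in lebesgue. (\<lambda>n. A n x - F (U x) * partial_deriv i \<psi> x) \<longlonglongrightarrow> 0"
      using V_ae
    proof eventually_elim
      case (elim x)
      have "(\<lambda>n. A n x) \<longlonglongrightarrow> F (U x) * partial_deriv i \<psi> x"
        unfolding A_def by (intro tendsto_intros continuous_on_tendsto_compose[OF F_cont elim]) auto
      then show ?case by (rule LIM_zero)
    qed
    show "AE x in lebesgue. norm (A n x - F (U x) * partial_deriv i \<psi> x) \<le> \<bar>B * Q * norm (V n x - U x)\<bar> + 0" for n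
    proof (rule AE_I2)
      fix x
      have "\<bar>F (V n x) - F (U x)\<bar> * \<bar>partial_deriv i \<psi> x\<bar> \<le> (B * \<bar>V n x - U x\<bar>) * Q"
        using Q[of x] lip B by (intro mult_mono) auto
      moreover have "A n x - F (U x) * partial_deriv i \<psi> x = (F (V n x) - F (U x)) * partial_deriv i \<psi> x"
        by (simp add: A_def algebra_simps)
      ultimately show "norm (A n x - F (U x) * partial_deriv i \<psi> x) \<le> \<bar>B * Q * norm (V n x - U x)\<bar> + 0"
        using B P0 by (simp add: abs_mult mult_ac)
    qed
  qed simp
  \<comment> \<open>\<open>F' (V n x)\<close> converges only pointwise, so besides the L1 error of
    \<open>H n\<close> a fixed majorant in terms of \<open>G\<close> enters; for \<open>A\<close>
    the Lipschitz bound gives an estimate by the L1 error of \<open>V n\<close> alone.\<close>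
  have C_lim: "(\<lambda>n. LINT x|lebesgue. norm (C n x - F' (U x) * (G x $ i) * \<psi> x)) \<longlonglongrightarrow> 0"
  proof (rule tendsto_integral_norm_0_dominated[where a = "\<lambda>n x. B * P * norm (H n x - G x)"
        and b = "\<lambda>x. 2 * B * P * norm (G x)"])
    show "(\<lambda>x. C n x - F' (U x) * (G x $ i) * \<psi> x) \<in> borel_measurable lebesgue" for n
      unfolding C_def by measurable
    show "integrable lebesgue (\<lambda>x. B * P * norm (H n x - G x))" for n using G H by auto
    show "integrable lebesgue (\<lambda>x. 2 * B * P * norm (G x))" using G by auto
    have "(\<lambda>n. B * P * (LINT x|lebesgue. norm (H n x - G x))) \<longlonglongrightarrow> B * P * 0"
      by (intro tendsto_mult_left H_lim)
    then show "(\<lambda>n. LINT x|lebesgue. \<bar>B * P * norm (H n x - G x)\<bar>) \<longlonglongrightarrow> 0"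
      using B P0 by (simp add: abs_mult)
    show "AE x in lebesgue. (\<lambda>n. C n x - F' (U x) * (G x $ i) * \<psi> x) \<longlonglongrightarrow> 0"
      using V_ae H_ae
    proof eventually_elim
      case (elim x)
      have "(\<lambda>n. C n x) \<longlonglongrightarrow> F' (U x) * (G x $ i) * \<psi> x"
        unfolding C_def by (intro tendsto_intros continuous_on_tendsto_compose[OF F'(1) elim(1)] elim(2)) auto
      then show ?case by (rule LIM_zero)
    qed
    show "AE x in lebesgue. norm (C n x - F' (U x) * (G x $ i) * \<psi> x) \<le>
        \<bar>B * P * norm (H n x - G x)\<bar> + 2 * B * P * norm (G x)" for n
    proof (rule AE_I2)
      fix x
      have "norm (C n x) \<le> B * norm (H n x) * P"
        unfolding C_def norm_mult using F'(2) P B by (intro mult_mono) (auto simp: component_le_norm_cart)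
      also have "\<dots> = B * P * norm (H n x)" by simp
      also have "\<dots> \<le> B * P * (norm (H n x - G x) + norm (G x))"
        using B P0 norm_triangle_sub[of "H n x" "G x"] by (intro mult_left_mono) auto
      finally have 1: "norm (C n x) \<le> B * P * norm (H n x - G x) + B * P * norm (G x)" by (simp add: algebra_simps)
      have "norm (F' (U x) * (G x $ i) * \<psi> x) \<le> B * norm (G x) * P"
        unfolding norm_mult using F'(2) P B by (intro mult_mono) (auto simp: component_le_norm_cart)
      then have 2: "norm (F' (U x) * (G x $ i) * \<psi> x) \<le> B * P * norm (G x)" by (simp add: mult_ac)
      have "B * P * norm (H n x - G x) \<le> \<bar>B * P * norm (H n x - G x)\<bar>" by simp
      then show "norm (C n x - F' (U x) * (G x $ i) * \<psi> x) \<le>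
          \<bar>B * P * norm (H n x - G x)\<bar> + 2 * B * P * norm (G x)"
        using 1 2 norm_triangle_ineq4[of "C n x" "F' (U x) * (G x $ i) * \<psi> x"] by linarith
    qed
  qed
  have int_A': "integrable lebesgue (\<lambda>x. F (U x) * partial_deriv i \<psi> x)"
  proof -
    have "integrable lebesgue (\<lambda>x. partial_deriv i \<psi> x *\<^sub>R (indicator \<Omega> x *\<^sub>R F (u x)))"
    proof (rule integrable_mult_bounded[where B = Q])
      show "integrable lebesgue (\<lambda>x. indicator \<Omega> x *\<^sub>R F (u x))"
        using integrable_lipschitz_compose[OF fin lip u] by (simp only: integrable_lebesgue_on_iff[OF \<Omega>l])
    qed (use Q in auto)
    moreover have "partial_deriv i \<psi> x *\<^sub>R (indicator \<Omega> x *\<^sub>R F (u x)) = F (U x) * partial_deriv i \<psi> x" for x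
      using K(2) K(4)[of x i] by (auto simp: U_def indicator_def)
    ultimately show ?thesis by (simp only:)
  qed
  have int_C': "integrable lebesgue (\<lambda>x. F' (U x) * (G x $ i) * \<psi> x)"
  proof -
    have "integrable lebesgue (\<lambda>x. G x $ i)" using G by (rule integrable_bounded_linear[OF bounded_linear_vec_nth])
    then have "integrable lebesgue (\<lambda>x. \<psi> x *\<^sub>R (G x $ i))"
      by (rule integrable_mult_bounded[where B = P]) (use P in auto)
    then have "integrable lebesgue (\<lambda>x. F' (U x) *\<^sub>R (\<psi> x *\<^sub>R (G x $ i)))"
      by (rule integrable_mult_bounded[where B = B]) (use F'(2) in auto)
    then show ?thesis by (simp add: mult_ac)
  qed
  have "(\<lambda>n. LINT x|lebesgue. A n x) \<longlonglongrightarrow> (LINT x|lebesgue. F (U x) * partial_deriv i \<psi> x)"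
  proof (rule Lim_null[THEN iffD2], rule tendsto_0_le[OF A_lim, of _ 1], rule always_eventually, rule allI)
    fix n
    show "norm ((LINT x|lebesgue. A n x) - (LINT x|lebesgue. F (U x) * partial_deriv i \<psi> x))
      \<le> norm (LINT x|lebesgue. norm (A n x - F (U x) * partial_deriv i \<psi> x)) * 1"
      using integral_norm_bound[of lebesgue "\<lambda>x. A n x - F (U x) * partial_deriv i \<psi> x"] int_A[of n] int_A'
      by simp
  qed
  moreover have "(\<lambda>n. LINT x|lebesgue. C n x) \<longlonglongrightarrow> (LINT x|lebesgue. F' (U x) * (G x $ i) * \<psi> x)"
  proof (rule Lim_null[THEN iffD2], rule tendsto_0_le[OF C_lim, of _ 1], rule always_eventually, rule allI)
    fix n
    show "norm ((LINT x|lebesgue. C n x) - (LINT x|lebesgue. F' (U x) * (G x $ i) * \<psi> x))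
      \<le> norm (LINT x|lebesgue. norm (C n x - F' (U x) * (G x $ i) * \<psi> x)) * 1"
      using integral_norm_bound[of lebesgue "\<lambda>x. C n x - F' (U x) * (G x $ i) * \<psi> x"] int_C[of n] int_C'
      by simp
  qed
  then have "(\<lambda>n. - (LINT x|lebesgue. C n x)) \<longlonglongrightarrow> - (LINT x|lebesgue. F' (U x) * (G x $ i) * \<psi> x)"
    by (rule tendsto_minus)
  then have "(\<lambda>n. LINT x|lebesgue. A n x) \<longlonglongrightarrow> - (LINT x|lebesgue. F' (U x) * (G x $ i) * \<psi> x)"
    by (rule Lim_transform_eventually) (use ibp in \<open>force simp: eventually_sequentially\<close>)
  ultimately have "(LINT x|lebesgue. F (U x) * partial_deriv i \<psi> x) = - (LINT x|lebesgue. F' (U x) * (G x $ i) * \<psi> x)"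
    by (rule LIMSEQ_unique)
  moreover have "(LINT x|lebesgue_on \<Omega>. F (u x) * partial_deriv i \<psi> x) = (LINT x|lebesgue. F (U x) * partial_deriv i \<psi> x)"
    by (rule integral_lebesgue_on_eq[OF \<Omega>l]) (use K(2) K(4) in \<open>auto simp: U_def indicator_def\<close>)
  moreover have "(LINT x|lebesgue_on \<Omega>. (F' (u x) *\<^sub>R g x) $ i * \<psi> x) = (LINT x|lebesgue. F' (U x) * (G x $ i) * \<psi> x)"
    by (rule integral_lebesgue_on_eq[OF \<Omega>l]) (use K(2) K(3) in \<open>auto simp: U_def G_def indicator_def\<close>)
  ultimately show "(LINT x|lebesgue_on \<Omega>. F (u x) * partial_deriv i \<psi> x)
      = - (LINT x|lebesgue_on \<Omega>. (F' (u x) *\<^sub>R g x) $ i * \<psi> x)" by simp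
qed

subsection \<open>The chain rule for Lipschitz functions\<close>

lemma borel_measurable_vec_nth [measurable (raw)]:
  fixes f :: "'a \<Rightarrow> real ^ 'n"
  shows "f \<in> borel_measurable M \<Longrightarrow> (\<lambda>x. f x $ i) \<in> borel_measurable M"
  by (rule measurable_compose[where g = "\<lambda>x. x $ i"]) (auto intro!: borel_measurable_continuous_onI continuous_intros)

lemma has_weak_gradient_limit:
  fixes v :: "nat \<Rightarrow> real ^ 'n \<Rightarrow> real" and k :: "nat \<Rightarrow> real ^ 'n \<Rightarrow> real ^ 'n"
  assumes \<Omega>: "open \<Omega>" and w: "\<And>n. has_weak_gradient \<Omega> (v n) (k n)"
    and meas: "\<And>n. v n \<in> borel_measurable (lebesgue_on \<Omega>)" "\<And>n. k n \<in> borel_measurable (lebesgue_on \<Omega>)"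
    and lim: "\<And>x. (\<lambda>n. v n x) \<longlonglongrightarrow> v' x" "\<And>x. (\<lambda>n. k n x) \<longlonglongrightarrow> k' x"
    and a: "integrable (lebesgue_on \<Omega>) a" "\<And>n x. \<bar>v n x\<bar> \<le> a x"
    and b: "integrable (lebesgue_on \<Omega>) b" "\<And>n x. norm (k n x) \<le> b x"
  shows "has_weak_gradient \<Omega> v' k'"
proof -
  have v': "v' \<in> borel_measurable (lebesgue_on \<Omega>)" and k': "k' \<in> borel_measurable (lebesgue_on \<Omega>)"
    by (rule borel_measurable_LIMSEQ_metric[OF meas(1)], rule lim(1),
        rule borel_measurable_LIMSEQ_metric[OF meas(2)], rule lim(2))
  have v'_int: "integrable (lebesgue_on \<Omega>) v'"
    by (rule integrable_dominated_convergence[where s = v and w = a, OF v' meas(1) a(1)]) (use lim a in auto)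
  have k'_int: "integrable (lebesgue_on \<Omega>) k'"
    by (rule integrable_dominated_convergence[where s = k and w = b, OF k' meas(2) b(1)]) (use lim b in auto)
  show ?thesis
  proof (rule has_weak_gradientI[OF \<Omega> v'_int k'_int])
    fix \<psi> :: "real ^ 'n \<Rightarrow> real" and i assume \<psi>: "\<psi> \<in> test_functions \<Omega>"
    obtain K where K: "compact K" "K \<subseteq> \<Omega>" "\<And>x. x \<notin> K \<Longrightarrow> \<psi> x = 0" "\<And>x i. x \<notin> K \<Longrightarrow> partial_deriv i \<psi> x = 0"
      "continuous_on UNIV \<psi>" "\<And>i. continuous_on UNIV (partial_deriv i \<psi>)"
      using test_functionsE[OF \<psi>] by metis
    obtain P where P: "\<And>x. norm (\<psi> x) \<le> P" using bounded_of_compact_support[OF K(5,1,3)] by blast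
    obtain Q where Q: "\<And>x. norm (partial_deriv i \<psi> x) \<le> Q" using bounded_of_compact_support[OF K(6,1,4)] by blast
    have P0: "P \<ge> 0" "Q \<ge> 0" using P[of 0] Q[of 0] norm_ge_zero order_trans by blast+
    have cm: "f \<in> borel_measurable (lebesgue_on \<Omega>)" if "continuous_on UNIV f" for f :: "real ^ 'n \<Rightarrow> real"
      using measurable_restrict_space1[OF borel_measurable_lebesgue_continuous[OF that]] .
    note [measurable] = cm[OF K(5)] cm[OF K(6)] v' k' meas
    have "(\<lambda>n. LINT x|lebesgue_on \<Omega>. v n x * partial_deriv i \<psi> x) \<longlonglongrightarrow> (LINT x|lebesgue_on \<Omega>. v' x * partial_deriv i \<psi> x)"
    proof (rule integral_dominated_convergence[where w = "\<lambda>x. a x * Q"])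
      show "AE x in lebesgue_on \<Omega>. norm (v n x * partial_deriv i \<psi> x) \<le> a x * Q" for n
        using a(2) Q by (auto simp: abs_mult intro!: AE_I2 mult_mono intro: order_trans[OF abs_ge_zero])
    qed (use a lim in \<open>auto intro!: tendsto_intros\<close>)
    moreover have "(\<lambda>n. - (LINT x|lebesgue_on \<Omega>. k n x $ i * \<psi> x)) \<longlonglongrightarrow> - (LINT x|lebesgue_on \<Omega>. k' x $ i * \<psi> x)"
    proof (intro tendsto_minus integral_dominated_convergence[where w = "\<lambda>x. b x * P"])
      show "AE x in lebesgue_on \<Omega>. norm (k n x $ i * \<psi> x) \<le> b x * P" for n
        using b(2) P
        by (auto simp: abs_mult intro!: AE_I2 mult_mono intro: order_trans[OF component_le_norm_cart]
            order_trans[OF norm_ge_zero])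
      show "AE x in lebesgue_on \<Omega>. (\<lambda>n. k n x $ i * \<psi> x) \<longlonglongrightarrow> k' x $ i * \<psi> x"
        using lim by (auto intro!: tendsto_intros)
    qed (use b in auto)
    ultimately show "(LINT x|lebesgue_on \<Omega>. v' x * partial_deriv i \<psi> x) = - (LINT x|lebesgue_on \<Omega>. k' x $ i * \<psi> x)"
      using has_weak_gradientD[OF w \<psi>] LIMSEQ_unique by fastforce
  qed
qed

text \<open>\<open>F\<close> is replaced by its averages over \<open>[t, t + \<delta>]\<close>, whose derivatives are forward difference quotients.\<close>

theorem chain_rule_right:
  fixes u :: "real ^ 'n \<Rightarrow> real"
  assumes \<Omega>: "open \<Omega>" "bounded \<Omega>" and w: "has_weak_gradient \<Omega> u g"
    and u: "integrable (lebesgue_on \<Omega>) u" and g: "integrable (lebesgue_on \<Omega>) g"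
    and lip: "\<And>s t. \<bar>F s - F t\<bar> \<le> B * \<bar>s - t\<bar>"
    and F: "\<And>t. (F has_real_derivative D t) (at_right t)"
  shows "has_weak_gradient \<Omega> (\<lambda>x. F (u x)) (\<lambda>x. D (u x) *\<^sub>R g x)"
    and "(\<lambda>x. D (u x)) \<in> borel_measurable (lebesgue_on \<Omega>)" and "\<And>t. \<bar>D t\<bar> \<le> B"
proof -
  note fin = finite_measure_lebesgue_on_bounded_open[OF \<Omega>]
  interpret finite_measure "lebesgue_on \<Omega>" by (rule fin)
  have F_cont: "continuous_on UNIV F" by (rule lipschitz_imp_continuous[OF lip])
  have B: "B \<ge> 0" using lip[of 1 0] by simp
  obtain G where G: "\<And>t. (G has_real_derivative F t) (at t)"
    using einterval_antiderivative[of "-\<infinity>" "\<infinity>" F] F_cont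
    by (auto simp: continuous_on_eq_continuous_at has_real_derivative_iff_has_vector_derivative)
  define \<delta> where "\<delta> n = 1 / real (Suc n)" for n
  have \<delta>: "\<delta> n > 0" "\<delta> n \<le> 1" for n by (auto simp: \<delta>_def)
  have \<delta>0: "\<delta> \<longlonglongrightarrow> 0" unfolding \<delta>_def using LIMSEQ_inverse_real_of_nat by (simp add: divide_inverse)
  define A where "A n t = (G (t + \<delta> n) - G t) / \<delta> n" for n t
  define A' where "A' n t = (F (t + \<delta> n) - F t) / \<delta> n" for n t
  have A_der: "(A n has_real_derivative A' n t) (at t)" for n t
  proof -
    have "((\<lambda>t. G (t + \<delta> n)) has_real_derivative F (t + \<delta> n)) (at t)"
      using G[of "t + \<delta> n"] by (simp add: DERIV_shift)
    from DERIV_cdivide[OF DERIV_diff[OF this G]] show ?thesis unfolding A_def A'_def .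
  qed
  have A'_cont: "continuous_on UNIV (A' n)" for n
    unfolding A'_def using \<delta>(1)[of n]
    by (intro continuous_intros continuous_on_compose2[OF F_cont] F_cont) auto
  have A'_bound: "\<bar>A' n t\<bar> \<le> B" for n t
    using lip[of "t + \<delta> n" t] \<delta>(1)[of n] by (simp add: A'_def field_simps)
  have A_near: "\<bar>A n t - F t\<bar> \<le> B * \<delta> n" for n t
  proof -
    obtain z where z: "t < z" "z < t + \<delta> n" "G (t + \<delta> n) - G t = (t + \<delta> n - t) * F z"
      using MVT2[of t "t + \<delta> n" G F] G \<delta>(1)[of n] by auto
    then have "A n t = F z" using \<delta>(1)[of n] by (simp add: A_def)
    moreover have "B * \<bar>z - t\<bar> \<le> B * \<delta> n" using z B by (intro mult_left_mono) auto
    ultimately show ?thesis using lip[of z t] by simp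
  qed
  have A_lim: "(\<lambda>n. A n t) \<longlonglongrightarrow> F t" for t
  proof (rule LIM_zero_cancel, rule Lim_null_comparison)
    show "\<forall>\<^sub>F n in sequentially. norm (A n t - F t) \<le> B * \<delta> n" using A_near by simp
    show "(\<lambda>n. B * \<delta> n) \<longlonglongrightarrow> 0" using tendsto_mult_left[OF \<delta>0, of B] by simp
  qed
  have A'_lim: "(\<lambda>n. A' n t) \<longlonglongrightarrow> D t" for t
  proof -
    have "((\<lambda>y. (F y - F t) / (y - t)) \<longlongrightarrow> D t) (at_right t)"
      using F[of t] by (simp add: has_field_derivative_iff)
    \<comment> \<open>The points \<open>t + \<delta> n\<close> approach \<open>t\<close> strictly
      from above, so the quotients see the right derivative alone.\<close>
    moreover have "filterlim (\<lambda>n. t + \<delta> n) (at_right t) sequentially"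
      unfolding filterlim_at using \<delta>(1) tendsto_add[OF tendsto_const[of t] \<delta>0]
      by (simp add: less_imp_neq[symmetric])
    ultimately have "(\<lambda>n. (F (t + \<delta> n) - F t) / (t + \<delta> n - t)) \<longlonglongrightarrow> D t"
      by (rule filterlim_compose)
    then show ?thesis by (simp add: A'_def)
  qed
  have A_cont: "continuous_on UNIV (A n)" for n
    using A_der by (meson DERIV_continuous continuous_at_imp_continuous_on)
  have um[measurable]: "u \<in> borel_measurable (lebesgue_on \<Omega>)" using u by auto
  have gm[measurable]: "g \<in> borel_measurable (lebesgue_on \<Omega>)" using g by auto
  note [measurable] = borel_measurable_continuous_onI[OF A_cont] borel_measurable_continuous_onI[OF A'_cont]
  show D_meas: "(\<lambda>x. D (u x)) \<in> borel_measurable (lebesgue_on \<Omega>)"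
    by (rule borel_measurable_LIMSEQ_metric[of "\<lambda>n x. A' n (u x)"]) (use A'_lim in auto)
  show D_bound: "\<bar>D t\<bar> \<le> B" for t
    by (rule LIMSEQ_le_const2[OF tendsto_rabs[OF A'_lim]]) (use A'_bound in auto)
  show "has_weak_gradient \<Omega> (\<lambda>x. F (u x)) (\<lambda>x. D (u x) *\<^sub>R g x)"
  proof (rule has_weak_gradient_limit[OF \<Omega>(1), where v = "\<lambda>n x. A n (u x)" and k = "\<lambda>n x. A' n (u x) *\<^sub>R g x"
        and a = "\<lambda>x. \<bar>F (u x)\<bar> + B" and b = "\<lambda>x. B * norm (g x)"])
    show "has_weak_gradient \<Omega> (\<lambda>x. A n (u x)) (\<lambda>x. A' n (u x) *\<^sub>R g x)" for n
      by (rule chain_rule_C1[OF \<Omega> w u g A_der A'_cont A'_bound])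
    show "(\<lambda>x. A n (u x)) \<in> borel_measurable (lebesgue_on \<Omega>)"
      "(\<lambda>x. A' n (u x) *\<^sub>R g x) \<in> borel_measurable (lebesgue_on \<Omega>)" for n by measurable
    show "(\<lambda>n. A n (u x)) \<longlonglongrightarrow> F (u x)" for x by (rule A_lim)
    show "(\<lambda>n. A' n (u x) *\<^sub>R g x) \<longlonglongrightarrow> D (u x) *\<^sub>R g x" for x by (intro tendsto_intros A'_lim)
    show "integrable (lebesgue_on \<Omega>) (\<lambda>x. \<bar>F (u x)\<bar> + B)"
      using integrable_lipschitz_compose[OF fin lip u] by auto
    show "integrable (lebesgue_on \<Omega>) (\<lambda>x. B * norm (g x))" using g by auto
    show "\<bar>A n (u x)\<bar> \<le> \<bar>F (u x)\<bar> + B" for n x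
      using A_near[of n "u x"] mult_left_mono[OF \<delta>(2)[of n] B] by simp
    show "norm (A' n (u x) *\<^sub>R g x) \<le> B * norm (g x)" for n x
      using A'_bound by (auto intro!: mult_right_mono)
  qed
qed

lemma has_weak_gradient_uminus:
  assumes "open \<Omega>" "bounded \<Omega>" "has_weak_gradient \<Omega> u g"
    "integrable (lebesgue_on \<Omega>) u" "integrable (lebesgue_on \<Omega>) g"
  shows "has_weak_gradient \<Omega> (\<lambda>x. - u x) (\<lambda>x. - g x)"
  using chain_rule_C1[OF assms DERIV_minus[OF DERIV_ident], of 1] by simp

lemma has_real_derivative_reflect:
  fixes F :: "real \<Rightarrow> real"
  assumes "(F has_real_derivative D) (at_left (- t))"
  shows "((\<lambda>s. F (- s)) has_real_derivative - D) (at_right t)"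
proof -
  have "((\<lambda>y. (F y - F (- t)) / (y - - t)) \<longlongrightarrow> D) (at_left (- t))"
    using assms by (simp add: has_field_derivative_iff)
  then have "((\<lambda>y. - ((F (- y) - F (- t)) / (- y - - t))) \<longlongrightarrow> - D) (at_right t)"
    unfolding filterlim_at_left_to_right by (intro tendsto_minus) simp
  moreover have "- ((F (- y) - F (- t)) / (- y - - t)) = (F (- y) - F (- t)) / (y - t)" for y
    by (simp add: minus_divide_right)
  ultimately show ?thesis by (simp add: has_field_derivative_iff)
qed

text \<open>The right-hand version for \<open>- u\<close> and the reflected function: reflection
  exchanges the two sides, and the signs from the slope and from the gradient cancel.\<close>

theorem chain_rule_left:
  fixes u :: "real ^ 'n \<Rightarrow> real"
  assumes \<Omega>: "open \<Omega>" "bounded \<Omega>" and w: "has_weak_gradient \<Omega> u g"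
    and u: "integrable (lebesgue_on \<Omega>) u" and g: "integrable (lebesgue_on \<Omega>) g"
    and lip: "\<And>s t. \<bar>F s - F t\<bar> \<le> B * \<bar>s - t\<bar>"
    and F: "\<And>t. (F has_real_derivative D t) (at_left t)"
  shows "has_weak_gradient \<Omega> (\<lambda>x. F (u x)) (\<lambda>x. D (u x) *\<^sub>R g x)"
proof -
  have "has_weak_gradient \<Omega> (\<lambda>x. F (- (- u x))) (\<lambda>x. (- D (- (- u x))) *\<^sub>R (- g x))"
  proof (rule chain_rule_right(1)[OF \<Omega> has_weak_gradient_uminus[OF \<Omega> w u g], where F = "\<lambda>s. F (- s)"
        and D = "\<lambda>s. - D (- s)" and B = B])
    show "\<bar>F (- s) - F (- t)\<bar> \<le> B * \<bar>s - t\<bar>" for s t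
      using lip[of "- s" "- t"] by (simp add: abs_minus_commute)
    show "((\<lambda>s. F (- s)) has_real_derivative - D (- t)) (at_right t)" for t
      by (rule has_real_derivative_reflect[OF F])
  qed (use u g in auto)
  then show ?thesis by simp
qed

text \<open>Uniqueness forces the two candidate gradients, which are \<open>g x\<close> multiplied
  by \<open>DR (u x)\<close> and by \<open>DL (u x)\<close>, to agree almost everywhere; where the
  factors differ, \<open>g x\<close> must be 0.\<close>

corollary gradient_eq_0_at_corners:
  fixes u :: "real ^ 'n \<Rightarrow> real"
  assumes "open \<Omega>" "bounded \<Omega>" "has_weak_gradient \<Omega> u g"
    "integrable (lebesgue_on \<Omega>) u" "integrable (lebesgue_on \<Omega>) g"
    and lip: "\<And>s t. \<bar>F s - F t\<bar> \<le> B * \<bar>s - t\<bar>"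
    and right: "\<And>t. (F has_real_derivative DR t) (at_right t)"
    and left: "\<And>t. (F has_real_derivative DL t) (at_left t)"
  shows "AE x in lebesgue_on \<Omega>. DR (u x) \<noteq> DL (u x) \<longrightarrow> g x = 0"
  using weak_gradient_unique[OF assms(1) chain_rule_right(1)[OF assms(1-5) lip right]
      chain_rule_left[OF assms(1-5) lip left]]
  by eventually_elim auto

section \<open>Sobolev spaces on a bounded open set\<close>

locale bounded_domain =
  fixes \<Omega> :: "(real ^ 'n) set" and p :: real
  assumes \<Omega>: "open \<Omega>" "bounded \<Omega>" and p: "1 \<le> p"
begin

lemma \<Omega>_sets: "\<Omega> \<in> sets lebesgue"
  using \<Omega>(1) by (rule open_in_sets_lebesgue)

sublocale finite_measure "lebesgue_on \<Omega>"
  by (rule finite_measure_lebesgue_on_bounded_open[OF \<Omega>])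

lemma Lp_integrable:
  fixes f :: "real ^ 'n \<Rightarrow> 'b::euclidean_space"
  assumes "f \<in> Lp \<Omega> p"
  shows "integrable (lebesgue_on \<Omega>) f"
proof (rule Bochner_Integration.integrable_bound)
  show "integrable (lebesgue_on \<Omega>) (\<lambda>x. 1 + norm (f x) powr p)"
    using assms by (auto simp: Lp_def)
  show "AE x in lebesgue_on \<Omega>. norm (f x) \<le> norm (1 + norm (f x) powr p)"
  proof (rule AE_I2)
    fix x
    show "norm (f x) \<le> norm (1 + norm (f x) powr p)"
    proof (cases "norm (f x) \<le> 1")
      case True
      moreover have "0 \<le> norm (f x) powr p" by simp
      ultimately show ?thesis by (simp del: powr_ge_zero)
    next
      case False
      then have "norm (f x) powr 1 \<le> norm (f x) powr p" using p by (intro powr_mono) auto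
      then show ?thesis using False by simp
    qed
  qed
qed (use assms in \<open>auto simp: Lp_def\<close>)

lemma Lp_bound:
  fixes f :: "real ^ 'n \<Rightarrow> 'b::euclidean_space" and g :: "real ^ 'n \<Rightarrow> 'c::euclidean_space"
  assumes "f \<in> borel_measurable (lebesgue_on \<Omega>)" "g \<in> Lp \<Omega> p" "c \<ge> 0"
    and "AE x in lebesgue_on \<Omega>. norm (f x) \<le> c * norm (g x)"
  shows "f \<in> Lp \<Omega> p"
proof -
  have "integrable (lebesgue_on \<Omega>) (\<lambda>x. norm (f x) powr p)"
  proof (rule Bochner_Integration.integrable_bound)
    show "integrable (lebesgue_on \<Omega>) (\<lambda>x. c powr p * norm (g x) powr p)"
      using assms by (auto simp: Lp_def)
    show "AE x in lebesgue_on \<Omega>. norm (norm (f x) powr p) \<le> norm (c powr p * norm (g x) powr p)"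
      using assms(4)
    proof eventually_elim
      case (elim x)
      then have "norm (f x) powr p \<le> (c * norm (g x)) powr p" using p by (intro powr_mono2) auto
      then show ?case using assms(3) by (simp add: powr_mult abs_mult)
    qed
  qed (use assms in measurable)
  then show ?thesis using assms(1) by (simp add: Lp_def)
qed

lemma Lp_add:
  fixes f g :: "real ^ 'n \<Rightarrow> 'b::euclidean_space"
  assumes "f \<in> Lp \<Omega> p" "g \<in> Lp \<Omega> p"
  shows "(\<lambda>x. f x + g x) \<in> Lp \<Omega> p"
proof -
  have [measurable]: "f \<in> borel_measurable (lebesgue_on \<Omega>)" "g \<in> borel_measurable (lebesgue_on \<Omega>)"
    using assms by (auto simp: Lp_def)
  have "integrable (lebesgue_on \<Omega>) (\<lambda>x. norm (f x + g x) powr p)"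
  proof (rule Bochner_Integration.integrable_bound)
    show "integrable (lebesgue_on \<Omega>) (\<lambda>x. 2 powr p * (norm (f x) powr p + norm (g x) powr p))"
      using assms by (auto simp: Lp_def)
    show "AE x in lebesgue_on \<Omega>. norm (norm (f x + g x) powr p) \<le> norm (2 powr p * (norm (f x) powr p + norm (g x) powr p))"
      using p by (intro AE_I2) (simp add: norm_add_powr_le)
  qed measurable
  then show ?thesis by (simp add: Lp_def)
qed

lemma Lp_uminus:
  fixes f :: "real ^ 'n \<Rightarrow> 'b::euclidean_space"
  assumes "f \<in> Lp \<Omega> p"
  shows "(\<lambda>x. - f x) \<in> Lp \<Omega> p"
  using assms by (auto simp: Lp_def)

lemma Lp_diff:
  fixes f g :: "real ^ 'n \<Rightarrow> 'b::euclidean_space"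
  assumes "f \<in> Lp \<Omega> p" "g \<in> Lp \<Omega> p"
  shows "(\<lambda>x. f x - g x) \<in> Lp \<Omega> p"
  using Lp_add[OF assms(1) Lp_uminus[OF assms(2)]] by simp

lemma Lp_const: "(\<lambda>x. c :: 'b::euclidean_space) \<in> Lp \<Omega> p"
  by (simp add: Lp_def)

lemma Lp_cong_AE:
  fixes f g :: "real ^ 'n \<Rightarrow> 'b::euclidean_space"
  assumes "f \<in> Lp \<Omega> p" and ae: "AE x in lebesgue_on \<Omega>. f x = g x"
  shows "g \<in> Lp \<Omega> p"
proof (rule Lp_bound[of _ f 1])
  show "g \<in> borel_measurable (lebesgue_on \<Omega>)"
    using assms by (intro borel_measurable_lebesgue_on_AE[OF \<Omega>_sets _ ae]) (simp add: Lp_def)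
  show "AE x in lebesgue_on \<Omega>. norm (g x) \<le> 1 * norm (f x)" using ae by eventually_elim simp
qed (use assms in auto)

text \<open>\<open>weak_gradient\<close> is an arbitrary choice among representatives. Carrying the
  gradient as a second argument lets it be written explicitly, for instance as a slope times
  \<open>g\<close>, and leaves a single comparison with \<open>weak_gradient\<close> at the
  end.\<close>

definition sobolev :: "(real ^ 'n \<Rightarrow> real) \<Rightarrow> (real ^ 'n \<Rightarrow> real ^ 'n) \<Rightarrow> bool"
  where "sobolev u g \<longleftrightarrow> u \<in> Lp \<Omega> p \<and> g \<in> Lp \<Omega> p \<and> has_weak_gradient \<Omega> u g"

lemma sobolevD:
  assumes "sobolev u g"
  shows "u \<in> Lp \<Omega> p" "g \<in> Lp \<Omega> p" "has_weak_gradient \<Omega> u g"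
    "integrable (lebesgue_on \<Omega>) u" "integrable (lebesgue_on \<Omega>) g"
    "u \<in> borel_measurable (lebesgue_on \<Omega>)" "g \<in> borel_measurable (lebesgue_on \<Omega>)"
  using assms by (auto simp: sobolev_def intro: Lp_integrable) (auto simp: Lp_def)

lemma sobolev_unique:
  "sobolev u g \<Longrightarrow> sobolev u h \<Longrightarrow> AE x in lebesgue_on \<Omega>. g x = h x"
  using weak_gradient_unique[OF \<Omega>(1)] sobolevD(3) by blast

lemma sobolev_imp_W1p: "sobolev u g \<Longrightarrow> u \<in> W1p \<Omega> p"
  by (auto simp: sobolev_def W1p_def)

lemma W1p_imp_sobolev:
  assumes "u \<in> W1p \<Omega> p"
  shows "sobolev u (weak_gradient \<Omega> u)"
proof -
  obtain g where g: "u \<in> Lp \<Omega> p" "g \<in> Lp \<Omega> p" "has_weak_gradient \<Omega> u g"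
    using assms by (auto simp: W1p_def)
  have w: "has_weak_gradient \<Omega> u (weak_gradient \<Omega> u)"
    unfolding weak_gradient_def by (rule someI[where P = "has_weak_gradient \<Omega> u", OF g(3)])
  then have "weak_gradient \<Omega> u \<in> Lp \<Omega> p"
    using Lp_cong_AE[OF g(2) weak_gradient_unique[OF \<Omega>(1) g(3) w]] by simp
  then show ?thesis using g w by (simp add: sobolev_def)
qed

lemma sobolev_weak_gradient:
  assumes "sobolev u g"
  shows "AE x in lebesgue_on \<Omega>. weak_gradient \<Omega> u x = g x"
  by (rule sobolev_unique[OF W1p_imp_sobolev[OF sobolev_imp_W1p[OF assms]] assms])

text \<open>The p-th power of the Sobolev norm, computed with an explicit gradient. It is
  subadditive up to the factor \<open>2 powr p\<close>, which suffices for limits, and each summand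
  can be treated by convergence theorems for integrals.\<close>

definition energy :: "(real ^ 'n \<Rightarrow> real) \<Rightarrow> (real ^ 'n \<Rightarrow> real ^ 'n) \<Rightarrow> real"
  where "energy u g = (LINT x|lebesgue_on \<Omega>. norm (u x) powr p) + (LINT x|lebesgue_on \<Omega>. norm (g x) powr p)"

lemma energy_nonneg: "energy u g \<ge> 0"
  by (simp add: energy_def)

lemma W1p_norm_eq:
  assumes "sobolev u g"
  shows "W1p_norm \<Omega> p u = energy u g powr (1 / p)"
proof -
  note W = W1p_imp_sobolev[OF sobolev_imp_W1p[OF assms]]
  have "(LINT x|lebesgue_on \<Omega>. norm (weak_gradient \<Omega> u x) powr p) = (LINT x|lebesgue_on \<Omega>. norm (g x) powr p)"
    using sobolev_weak_gradient[OF assms] sobolevD(2)[OF assms] sobolevD(2)[OF W]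
    by (intro integral_cong_AE) (auto simp: Lp_def)
  then show ?thesis by (simp add: W1p_norm_def energy_def)
qed

lemma sobolev_diff:
  assumes "sobolev u g" "sobolev v h"
  shows "sobolev (\<lambda>x. u x - v x) (\<lambda>x. g x - h x)"
  unfolding sobolev_def
proof (intro conjI Lp_diff has_weak_gradientI[OF \<Omega>(1)])
  note u = sobolevD[OF assms(1)] and v = sobolevD[OF assms(2)]
  show "integrable (lebesgue_on \<Omega>) (\<lambda>x. u x - v x)" "integrable (lebesgue_on \<Omega>) (\<lambda>x. g x - h x)"
    using u v by auto
  fix \<psi> :: "real ^ 'n \<Rightarrow> real" and i assume \<psi>: "\<psi> \<in> test_functions \<Omega>"
  obtain K where K: "compact K" "K \<subseteq> \<Omega>" "\<And>x. x \<notin> K \<Longrightarrow> \<psi> x = 0" "\<And>x i. x \<notin> K \<Longrightarrow> partial_deriv i \<psi> x = 0"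
    "continuous_on UNIV \<psi>" "\<And>i. continuous_on UNIV (partial_deriv i \<psi>)"
    using test_functionsE[OF \<psi>] by metis
  have loc: "locally_integrable \<Omega> u" "locally_integrable \<Omega> v" "locally_integrable \<Omega> (\<lambda>x. g x $ i)"
    "locally_integrable \<Omega> (\<lambda>x. h x $ i)"
    using u v by (auto intro!: locally_integrableI[OF _ \<Omega>(1)] locally_integrable_component)
  note I = integrable_locally_mult_compact(1)[OF _ K(1,2,5,3) \<Omega>(1)]
    integrable_locally_mult_compact(1)[OF _ K(1,2,6,4) \<Omega>(1)]
  show "(LINT x|lebesgue_on \<Omega>. (u x - v x) * partial_deriv i \<psi> x) = - (LINT x|lebesgue_on \<Omega>. (g x - h x) $ i * \<psi> x)"
    using has_weak_gradientD[OF u(3) \<psi>, of i] has_weak_gradientD[OF v(3) \<psi>, of i]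
    by (simp add: left_diff_distrib Bochner_Integration.integral_diff[OF I(2)[OF loc(1)] I(2)[OF loc(2)]]
        Bochner_Integration.integral_diff[OF I(1)[OF loc(3)] I(1)[OF loc(4)]])
qed (use assms sobolevD in auto)

lemma sobolev_uminus:
  assumes "sobolev u g"
  shows "sobolev (\<lambda>x. - u x) (\<lambda>x. - g x)"
  using assms has_weak_gradient_uminus[OF \<Omega>] sobolevD[OF assms] by (auto simp: sobolev_def intro: Lp_uminus)

lemma sobolev_add:
  assumes "sobolev u g" "sobolev v h"
  shows "sobolev (\<lambda>x. u x + v x) (\<lambda>x. g x + h x)"
  using sobolev_diff[OF assms(1) sobolev_uminus[OF assms(2)]] by simp

lemma sobolev_cong_AE:
  assumes "sobolev u g" and u: "AE x in lebesgue_on \<Omega>. u x = v x" and g: "AE x in lebesgue_on \<Omega>. g x = h x"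
  shows "sobolev v h"
proof -
  note D = sobolevD[OF assms(1)]
  have L: "v \<in> Lp \<Omega> p" "h \<in> Lp \<Omega> p" using Lp_cong_AE[OF D(1) u] Lp_cong_AE[OF D(2) g] .
  note [measurable] = D(6,7)
  have [measurable]: "v \<in> borel_measurable (lebesgue_on \<Omega>)" "h \<in> borel_measurable (lebesgue_on \<Omega>)"
    using L by (auto simp: Lp_def)
  have "has_weak_gradient \<Omega> v h"
  proof (rule has_weak_gradientI[OF \<Omega>(1) Lp_integrable[OF L(1)] Lp_integrable[OF L(2)]])
    fix \<psi> :: "real ^ 'n \<Rightarrow> real" and i assume \<psi>: "\<psi> \<in> test_functions \<Omega>"
    obtain K where K: "continuous_on UNIV \<psi>" "\<And>i. continuous_on UNIV (partial_deriv i \<psi>)"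
      using test_functionsE[OF \<psi>] by metis
    have cm: "f \<in> borel_measurable (lebesgue_on \<Omega>)" if "continuous_on UNIV f" for f :: "real ^ 'n \<Rightarrow> real"
      using measurable_restrict_space1[OF borel_measurable_lebesgue_continuous[OF that]] .
    note [measurable] = cm[OF K(1)] cm[OF K(2)]
    have "(LINT x|lebesgue_on \<Omega>. v x * partial_deriv i \<psi> x) = (LINT x|lebesgue_on \<Omega>. u x * partial_deriv i \<psi> x)"
      using u by (intro integral_cong_AE) auto
    moreover have "(LINT x|lebesgue_on \<Omega>. h x $ i * \<psi> x) = (LINT x|lebesgue_on \<Omega>. g x $ i * \<psi> x)"
      using g by (intro integral_cong_AE) auto
    ultimately show "(LINT x|lebesgue_on \<Omega>. v x * partial_deriv i \<psi> x) = - (LINT x|lebesgue_on \<Omega>. h x $ i * \<psi> x)"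
      using has_weak_gradientD[OF D(3) \<psi>] by simp
  qed
  then show ?thesis using L by (simp add: sobolev_def)
qed

lemma sobolev_chain:
  assumes "sobolev u g" and lip: "\<And>s t. \<bar>F s - F t\<bar> \<le> B * \<bar>s - t\<bar>"
    and F: "\<And>t. (F has_real_derivative D t) (at_right t)"
  shows "sobolev (\<lambda>x. F (u x)) (\<lambda>x. D (u x) *\<^sub>R g x)"
proof -
  note d = sobolevD[OF assms(1)]
  note c = chain_rule_right[OF \<Omega> d(3,4,5) lip F]
  have B: "B \<ge> 0" using lip[of 1 0] by simp
  have "(\<lambda>x. F (u x)) \<in> Lp \<Omega> p"
  proof -
    \<comment> \<open>The Lipschitz bound controls only the difference to \<open>F 0\<close>; the
      constant is in \<open>Lp\<close> because \<open>\<Omega>\<close> has finite measure.\<close>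
    have "(\<lambda>x. F (u x) - F 0) \<in> Lp \<Omega> p"
    proof (rule Lp_bound[OF _ d(1) B])
      show "(\<lambda>x. F (u x) - F 0) \<in> borel_measurable (lebesgue_on \<Omega>)"
        using integrable_lipschitz_compose[OF finite_measure_axioms lip d(4)] by auto
      show "AE x in lebesgue_on \<Omega>. norm (F (u x) - F 0) \<le> B * norm (u x)"
        using lip[of _ 0] by simp
    qed
    from Lp_add[OF this Lp_const[of "F 0"]] show ?thesis by simp
  qed
  moreover have "(\<lambda>x. D (u x) *\<^sub>R g x) \<in> Lp \<Omega> p"
    by (rule Lp_bound[OF _ d(2) B]) (use c(2,3) d(7) in \<open>auto intro!: mult_right_mono\<close>)
  ultimately show ?thesis using c(1) by (simp add: sobolev_def)
qed

end

subsection \<open>Sobolev functions vanishing on the boundary\<close>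

definition gradient :: "(real ^ 'n \<Rightarrow> real) \<Rightarrow> real ^ 'n \<Rightarrow> real ^ 'n"
  where "gradient f x = (\<chi> i. partial_deriv i f x)"

lemma continuous_gradient:
  assumes "C_class 1 f"
  shows "continuous_on UNIV (gradient f)"
proof -
  have "continuous_on UNIV (\<lambda>x. gradient f x $ i)" for i
    using C_class_partial_deriv_continuous[of 0 f i] assms by (simp add: gradient_def)
  then show ?thesis by (subst continuous_on_componentwise) (auto simp: Basis_vec_def inner_axis)
qed

text \<open>\<open>DR\<close> is a right-continuous step function and \<open>DL t\<close> its left
  limit at \<open>t\<close>. Prescribing \<open>DR\<close> near \<open>t\<close>, beyond the
  one-sided derivatives of \<open>F\<close> at \<open>t\<close>, makes slopes eventually constant
  along sequences that converge to a point with \<open>DR t = DL t\<close>.\<close>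

definition piecewise_affine :: "(real \<Rightarrow> real) \<Rightarrow> (real \<Rightarrow> real) \<Rightarrow> (real \<Rightarrow> real) \<Rightarrow> bool"
  where "piecewise_affine F DR DL \<longleftrightarrow> (\<forall>t. \<exists>\<delta>>0.
    (\<forall>s\<in>{t..<t + \<delta>}. F s = F t + DR t * (s - t) \<and> DR s = DR t) \<and>
    (\<forall>s\<in>{t - \<delta><..<t}. F s = F t + DL t * (s - t) \<and> DR s = DL t))"

lemma piecewise_affine_right:
  assumes "piecewise_affine F DR DL"
  shows "(F has_real_derivative DR t) (at_right t)"
proof -
  obtain \<delta> where \<delta>: "\<delta> > 0" "\<And>s. s \<in> {t..<t + \<delta>} \<Longrightarrow> F s = F t + DR t * (s - t)"
    using assms unfolding piecewise_affine_def by blast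
  have "DR t = (F s - F t) / (s - t)" if "t < s" "s < t + \<delta>" for s
    using \<delta>(2)[of s] that by simp
  then have "eventually (\<lambda>s. DR t = (F s - F t) / (s - t)) (at_right t)"
    unfolding eventually_at_right_field using \<delta>(1) by (intro exI[of _ "t + \<delta>"] conjI allI impI) simp_all
  then show ?thesis
    unfolding has_field_derivative_iff by (rule Lim_transform_eventually[OF tendsto_const])
qed

lemma piecewise_affine_left:
  assumes "piecewise_affine F DR DL"
  shows "(F has_real_derivative DL t) (at_left t)"
proof -
  obtain \<delta> where \<delta>: "\<delta> > 0" "\<And>s. s \<in> {t - \<delta><..<t} \<Longrightarrow> F s = F t + DL t * (s - t)"
    using assms unfolding piecewise_affine_def by blast
  have "DL t = (F s - F t) / (s - t)" if "t - \<delta> < s" "s < t" for s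
    using \<delta>(2)[of s] that by simp
  then have "eventually (\<lambda>s. DL t = (F s - F t) / (s - t)) (at_left t)"
    unfolding eventually_at_left_field using \<delta>(1) by (intro exI[of _ "t - \<delta>"] conjI allI impI) simp_all
  then show ?thesis
    unfolding has_field_derivative_iff by (rule Lim_transform_eventually[OF tendsto_const])
qed

lemma piecewise_affine_slope_eventually_const:
  assumes "piecewise_affine F DR DL" "DR t = DL t" "s \<longlonglongrightarrow> t"
  shows "eventually (\<lambda>n. DR (s n) = DR t) sequentially"
proof -
  obtain \<delta> where \<delta>: "\<delta> > 0" "\<And>s. s \<in> {t..<t + \<delta>} \<Longrightarrow> DR s = DR t" "\<And>s. s \<in> {t - \<delta><..<t} \<Longrightarrow> DR s = DL t"
    using assms(1) unfolding piecewise_affine_def by blast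
  have "eventually (\<lambda>n. dist (s n) t < \<delta>) sequentially" using assms(3) \<delta>(1) by (rule tendstoD)
  then show ?thesis
  proof eventually_elim
    case (elim n)
    then have "s n \<in> {t..<t + \<delta>} \<or> s n \<in> {t - \<delta><..<t}" by (auto simp: dist_real_def)
    then show ?case using \<delta>(2,3) assms(2) by auto
  qed
qed

lemma piecewise_affine_abs:
  "piecewise_affine abs (\<lambda>t. if t \<ge> 0 then 1 else - 1) (\<lambda>t. if t > 0 then 1 else - 1)"
  unfolding piecewise_affine_def
proof
  fix t :: real
  show "\<exists>\<delta>>0. (\<forall>s\<in>{t..<t + \<delta>}. \<bar>s\<bar> = \<bar>t\<bar> + (if t \<ge> 0 then 1 else - 1) * (s - t) \<and>
        (if s \<ge> 0 then 1 else - 1) = (if t \<ge> 0 then 1 else - 1 :: real)) \<and>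
      (\<forall>s\<in>{t - \<delta><..<t}. \<bar>s\<bar> = \<bar>t\<bar> + (if t > 0 then 1 else - 1) * (s - t) \<and>
        (if s \<ge> 0 then 1 else - 1) = (if t > 0 then 1 else - 1 :: real))"
    by (rule exI[of _ "if t = 0 then 1 else \<bar>t\<bar>"]) auto
qed

lemma tendsto_0_of_powr:
  fixes f :: "nat \<Rightarrow> 'b::real_normed_vector"
  assumes "p \<ge> 1" "(\<lambda>n. norm (f n) powr p) \<longlonglongrightarrow> 0"
  shows "f \<longlonglongrightarrow> 0"
proof -
  have "(\<lambda>n. (norm (f n) powr p) powr (1 / p)) \<longlonglongrightarrow> 0 powr (1 / p)"
    using assms by (intro tendsto_powr') auto
  then have "(\<lambda>n. norm (f n)) \<longlonglongrightarrow> 0" using assms(1) by (simp add: powr_powr)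
  then show ?thesis by (rule tendsto_norm_zero_cancel)
qed

lemma integrable_convol_powr:
  fixes f :: "real ^ 'n \<Rightarrow> 'b::euclidean_space"
  assumes m: "mollifier r \<rho>" and p: "p \<ge> 1"
    and f: "integrable lebesgue f" "integrable lebesgue (\<lambda>x. norm (f x) powr p)"
  shows "integrable lebesgue (\<lambda>x. norm (convol \<rho> f x - f x) powr p)"
proof (rule Bochner_Integration.integrable_bound)
  show "integrable lebesgue (\<lambda>x. 2 powr p * (convol \<rho> (\<lambda>x. norm (f x) powr p) x + norm (f x) powr p))"
    using integrable_convol_L1(1)[OF m f(2)] f(2) by auto
  show "(\<lambda>x. norm (convol \<rho> f x - f x) powr p) \<in> borel_measurable lebesgue"
    using integrable_convol_L1(1)[OF m f(1)] f by measurable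
  show "AE x in lebesgue. norm (norm (convol \<rho> f x - f x) powr p) \<le>
      norm (2 powr p * (convol \<rho> (\<lambda>x. norm (f x) powr p) x + norm (f x) powr p))"
    by (intro AE_I2) (use norm_convol_diff_powr_le[OF m p f] in \<open>force intro: order_trans[OF _ abs_ge_self]\<close>)
qed

context bounded_domain
begin

lemma continuous_imp_measurable:
  fixes f :: "real ^ 'n \<Rightarrow> 'b::euclidean_space"
  assumes "continuous_on UNIV f"
  shows "f \<in> borel_measurable (lebesgue_on \<Omega>)"
  using measurable_restrict_space1[OF borel_measurable_lebesgue_continuous[OF assms]] .

lemma sobolev_C1_compact:
  assumes w: "w \<in> C1_compact \<Omega>"
  shows "sobolev w (gradient w)"
proof -
  have C: "C_class 1 w" and s: "compactly_supported_in \<Omega> w" using w by (auto simp: C1_compact_def)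
  obtain K where K: "compact K" "K \<subseteq> \<Omega>" "\<And>x. x \<notin> K \<Longrightarrow> w x = 0"
    using compactly_supported_inE[OF s] by blast
  have K': "partial_deriv i w x = 0" if "x \<notin> K" for x i
    by (rule partial_deriv_eq_0_outside[OF compact_imp_closed[OF K(1)] K(3) that])
  have cont: "continuous_on UNIV w" "continuous_on UNIV (partial_deriv i w)" and diff: "w differentiable (at x)" for i x
    using C C_class_imp_continuous[OF C] by auto
  have gcont: "continuous_on UNIV (gradient w)" by (rule continuous_gradient[OF C])
  have gK: "gradient w x = 0" if "x \<notin> K" for x using K'[OF that] by (simp add: gradient_def vec_eq_iff)
  obtain B1 where B1: "B1 > 0" "\<And>x. norm (w x) \<le> B1" using bounded_of_compact_support[OF cont(1) K(1,3)] by blast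
  obtain B2 where B2: "B2 > 0" "\<And>x. norm (gradient w x) \<le> B2" using bounded_of_compact_support[OF gcont K(1) gK] by blast
  have L1: "w \<in> Lp \<Omega> p"
    by (rule Lp_bound[OF continuous_imp_measurable[OF cont(1)] Lp_const[of "1 :: real"], of B1]) (use B1 in auto)
  have L2: "gradient w \<in> Lp \<Omega> p"
    by (rule Lp_bound[OF continuous_imp_measurable[OF gcont] Lp_const[of "1 :: real"], of B2]) (use B2 in auto)
  have "has_weak_gradient \<Omega> w (gradient w)"
  proof (rule has_weak_gradientI[OF \<Omega>(1) Lp_integrable[OF L1] Lp_integrable[OF L2]])
    fix \<psi> :: "real ^ 'n \<Rightarrow> real" and i assume \<psi>: "\<psi> \<in> test_functions \<Omega>"
    obtain K2 where K2: "continuous_on UNIV \<psi>" "\<And>i. continuous_on UNIV (partial_deriv i \<psi>)" "\<And>x. \<psi> differentiable (at x)"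
      using test_functionsE[OF \<psi>] by metis
    have cA: "continuous_on UNIV (\<lambda>x. w x * partial_deriv i \<psi> x)"
      and cC: "continuous_on UNIV (\<lambda>x. partial_deriv i w x * \<psi> x)"
      by (intro continuous_intros cont K2)+
    have int: "integrable lebesgue (\<lambda>x. w x * partial_deriv i \<psi> x)" "integrable lebesgue (\<lambda>x. partial_deriv i w x * \<psi> x)"
      using integrable_continuous_compact_support[OF cA K(1)] integrable_continuous_compact_support[OF cC K(1)] K(3) K'
      by auto
    have "(LINT x|lebesgue. w x * partial_deriv i \<psi> x + partial_deriv i w x * \<psi> x) = 0"
    proof (rule integral_directional_derivative_eq_0[where h = "\<lambda>x. w x * \<psi> x" and e = "axis i 1", OF _ _ K(1)])
      show "((\<lambda>t. w (x + t *\<^sub>R axis i 1) * \<psi> (x + t *\<^sub>R axis i 1)) has_real_derivative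
          w x * partial_deriv i \<psi> x + partial_deriv i w x * \<psi> x) (at 0)" for x
        using DERIV_mult[OF has_real_derivative_partial_deriv[OF diff[of x], of i]
            has_real_derivative_partial_deriv[OF K2(3)[of x], of i]]
        by (simp add: add.commute mult.commute)
    qed (use K(3) K' in \<open>auto intro!: continuous_intros cont K2\<close>)
    then have "(LINT x|lebesgue. w x * partial_deriv i \<psi> x) = - (LINT x|lebesgue. partial_deriv i w x * \<psi> x)"
      using int by simp
    moreover have "(LINT x|lebesgue_on \<Omega>. w x * partial_deriv i \<psi> x) = (LINT x|lebesgue. w x * partial_deriv i \<psi> x)"
      by (rule integral_lebesgue_on_eq[OF \<Omega>_sets]) (use K in auto)
    moreover have "(LINT x|lebesgue_on \<Omega>. gradient w x $ i * \<psi> x) = (LINT x|lebesgue. partial_deriv i w x * \<psi> x)"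
      by (rule integral_lebesgue_on_eq[OF \<Omega>_sets]) (use K K' in \<open>auto simp: gradient_def\<close>)
    ultimately show "(LINT x|lebesgue_on \<Omega>. w x * partial_deriv i \<psi> x) = - (LINT x|lebesgue_on \<Omega>. gradient w x $ i * \<psi> x)"
      by simp
  qed
  then show ?thesis using L1 L2 by (simp add: sobolev_def)
qed

lemma Lp_restrict:
  fixes f :: "real ^ 'n \<Rightarrow> 'b::euclidean_space"
  assumes "f \<in> Lp UNIV p"
  shows "f \<in> Lp \<Omega> p"
proof -
  have "f \<in> borel_measurable lebesgue" "integrable (lebesgue_on UNIV) (\<lambda>x. norm (f x) powr p)"
    using assms by (auto simp: Lp_def lebesgue_on_UNIV_eq)
  then show ?thesis
    using integrable_lebesgue_on_subset[OF _ _ \<Omega>_sets, of UNIV] measurable_restrict_space1 by (auto simp: Lp_def)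
qed

lemma sobolev_restrict:
  assumes "u \<in> W1p UNIV p"
  obtains g where "sobolev u g"
proof -
  obtain g where u: "u \<in> Lp UNIV p" and g: "g \<in> Lp UNIV p" and w: "has_weak_gradient UNIV u g"
    using assms by (auto simp: W1p_def)
  have "has_weak_gradient \<Omega> u g"
    unfolding has_weak_gradient_def
  proof (intro conjI ballI allI)
    show "locally_integrable \<Omega> u" "locally_integrable \<Omega> g"
      using w by (auto simp: has_weak_gradient_def locally_integrable_def)
    fix \<psi> :: "real ^ 'n \<Rightarrow> real" and i assume \<psi>: "\<psi> \<in> test_functions \<Omega>"
    then have \<psi>': "\<psi> \<in> test_functions UNIV" by (auto simp: test_functions_def compactly_supported_in_def)
    obtain K where K: "K \<subseteq> \<Omega>" "\<And>x. x \<notin> K \<Longrightarrow> \<psi> x = 0" "\<And>x i. x \<notin> K \<Longrightarrow> partial_deriv i \<psi> x = 0"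
      using test_functionsE[OF \<psi>] by metis
    have "(LINT x|lebesgue_on \<Omega>. u x * partial_deriv i \<psi> x) = (LINT x|lebesgue. u x * partial_deriv i \<psi> x)"
      by (rule integral_lebesgue_on_eq[OF \<Omega>_sets]) (use K in auto)
    moreover have "(LINT x|lebesgue_on \<Omega>. g x $ i * \<psi> x) = (LINT x|lebesgue. g x $ i * \<psi> x)"
      by (rule integral_lebesgue_on_eq[OF \<Omega>_sets]) (use K in auto)
    ultimately show "(LINT x|lebesgue_on \<Omega>. u x * partial_deriv i \<psi> x) = - (LINT x|lebesgue_on \<Omega>. g x $ i * \<psi> x)"
      using has_weak_gradientD[OF w \<psi>', of i] by (simp add: lebesgue_on_UNIV_eq)
  qed
  then have "sobolev u g" using Lp_restrict[OF u] Lp_restrict[OF g] by (simp add: sobolev_def)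
  then show ?thesis by (rule that)
qed

lemma energy_cong_AE:
  assumes "u \<in> Lp \<Omega> p" "g \<in> Lp \<Omega> p" "AE x in lebesgue_on \<Omega>. u x = v x" "AE x in lebesgue_on \<Omega>. g x = h x"
  shows "energy u g = energy v h"
proof -
  have [measurable]: "u \<in> borel_measurable (lebesgue_on \<Omega>)" "g \<in> borel_measurable (lebesgue_on \<Omega>)"
    "v \<in> borel_measurable (lebesgue_on \<Omega>)" "h \<in> borel_measurable (lebesgue_on \<Omega>)"
    using assms(1,2) Lp_cong_AE[OF assms(1,3)] Lp_cong_AE[OF assms(2,4)] by (auto simp: Lp_def)
  have "(LINT x|lebesgue_on \<Omega>. norm (u x) powr p) = (LINT x|lebesgue_on \<Omega>. norm (v x) powr p)"
    using assms(3) by (intro integral_cong_AE) auto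
  moreover have "(LINT x|lebesgue_on \<Omega>. norm (g x) powr p) = (LINT x|lebesgue_on \<Omega>. norm (h x) powr p)"
    using assms(4) by (intro integral_cong_AE) auto
  ultimately show ?thesis by (simp add: energy_def)
qed

lemma integral_powr_add_le:
  fixes f g :: "real ^ 'n \<Rightarrow> 'b::euclidean_space"
  assumes "f \<in> Lp \<Omega> p" "g \<in> Lp \<Omega> p"
  shows "(LINT x|lebesgue_on \<Omega>. norm (f x + g x) powr p) \<le>
    2 powr p * ((LINT x|lebesgue_on \<Omega>. norm (f x) powr p) + (LINT x|lebesgue_on \<Omega>. norm (g x) powr p))"
proof -
  have "(LINT x|lebesgue_on \<Omega>. norm (f x + g x) powr p) \<le>
      (LINT x|lebesgue_on \<Omega>. 2 powr p * (norm (f x) powr p + norm (g x) powr p))"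
  proof (rule integral_mono)
    show "norm (f x + g x) powr p \<le> 2 powr p * (norm (f x) powr p + norm (g x) powr p)" for x
      using p by (intro norm_add_powr_le) simp
  qed (use assms Lp_add[OF assms] in \<open>auto simp: Lp_def\<close>)
  also have "\<dots> = 2 powr p * ((LINT x|lebesgue_on \<Omega>. norm (f x) powr p) + (LINT x|lebesgue_on \<Omega>. norm (g x) powr p))"
    using assms by (simp add: Lp_def)
  finally show ?thesis .
qed

lemma energy_add_le:
  assumes "u \<in> Lp \<Omega> p" "g \<in> Lp \<Omega> p" "v \<in> Lp \<Omega> p" "h \<in> Lp \<Omega> p"
  shows "energy (\<lambda>x. u x + v x) (\<lambda>x. g x + h x) \<le> 2 powr p * (energy u g + energy v h)"
  using integral_powr_add_le[OF assms(1,3)] integral_powr_add_le[OF assms(2,4)]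
  unfolding energy_def by (simp add: algebra_simps)

lemma W1p_norm_less_iff:
  assumes "sobolev u g" "e > 0"
  shows "W1p_norm \<Omega> p u < e \<longleftrightarrow> energy u g < e powr p"
proof -
  have "W1p_norm \<Omega> p u < e \<longleftrightarrow> (energy u g powr (1 / p)) powr p < e powr p"
    unfolding W1p_norm_eq[OF assms(1)]
    using p assms(2) powr_less_mono2[of p "energy u g powr (1 / p)" e] powr_mono2[of p e "energy u g powr (1 / p)"]
    by fastforce
  also have "(energy u g powr (1 / p)) powr p = energy u g"
    using p energy_nonneg[of u g] by (simp add: powr_powr)
  finally show ?thesis .
qed

lemma W1p_zero_iff:
  assumes "sobolev z g"
  shows "z \<in> W1p_zero \<Omega> p \<longleftrightarrow>
    (\<forall>e>0. \<exists>w\<in>C1_compact \<Omega>. energy (\<lambda>x. w x - z x) (\<lambda>x. gradient w x - g x) < e)"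
    (is "_ \<longleftrightarrow> ?R")
proof
  have s: "sobolev (\<lambda>x. w x - z x) (\<lambda>x. gradient w x - g x)" if "w \<in> C1_compact \<Omega>" for w
    by (rule sobolev_diff[OF sobolev_C1_compact[OF that] assms])
  {
    assume z: "z \<in> W1p_zero \<Omega> p"
    show ?R
    proof (intro allI impI)
      fix e :: real assume e: "e > 0"
      then have "e powr (1 / p) > 0" by simp
      then obtain w where w: "w \<in> C1_compact \<Omega>" "W1p_norm \<Omega> p (\<lambda>x. w x - z x) < e powr (1 / p)"
        using z unfolding W1p_zero_def by blast
      have "(e powr (1 / p)) powr p = e" using p e by (simp add: powr_powr)
      then show "\<exists>w\<in>C1_compact \<Omega>. energy (\<lambda>x. w x - z x) (\<lambda>x. gradient w x - g x) < e"
        using w W1p_norm_less_iff[OF s[OF w(1)], of "e powr (1 / p)"] e by auto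
    qed
  next
    assume R: ?R
    have "\<exists>w\<in>C1_compact \<Omega>. W1p_norm \<Omega> p (\<lambda>x. w x - z x) < e" if e: "e > 0" for e
    proof -
      have "e powr p > 0" using e by simp
      then obtain w where "w \<in> C1_compact \<Omega>" "energy (\<lambda>x. w x - z x) (\<lambda>x. gradient w x - g x) < e powr p"
        using R by blast
      then show ?thesis using W1p_norm_less_iff[OF s e] by blast
    qed
    then show "z \<in> W1p_zero \<Omega> p" using sobolev_imp_W1p[OF assms] by (simp add: W1p_zero_def)
  }
qed

lemma W1p_zero_closed:
  assumes z: "sobolev z g"
    and approx: "\<And>e. e > 0 \<Longrightarrow> \<exists>v h. v \<in> W1p_zero \<Omega> p \<and> sobolev v h \<and>
      energy (\<lambda>x. v x - z x) (\<lambda>x. h x - g x) < e"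
  shows "z \<in> W1p_zero \<Omega> p"
  unfolding W1p_zero_iff[OF z]
proof (intro allI impI)
  fix e :: real assume e: "e > 0"
  \<comment> \<open>Two errors below \<open>e'\<close> are added, and \<open>energy_add_le\<close>
    multiplies the sum by \<open>2 powr p\<close>.\<close>
  define e' where "e' = e / (2 * 2 powr p)"
  have e': "e' > 0" "2 powr p * (e' + e') = e" using e by (auto simp: e'_def)
  obtain v h where v: "v \<in> W1p_zero \<Omega> p" "sobolev v h" "energy (\<lambda>x. v x - z x) (\<lambda>x. h x - g x) < e'"
    using approx[OF e'(1)] by blast
  obtain w where w: "w \<in> C1_compact \<Omega>" "energy (\<lambda>x. w x - v x) (\<lambda>x. gradient w x - h x) < e'"
    using v(1) W1p_zero_iff[OF v(2)] e'(1) by blast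
  note s1 = sobolev_diff[OF sobolev_C1_compact[OF w(1)] v(2)] and s2 = sobolev_diff[OF v(2) z]
  have "energy (\<lambda>x. w x - z x) (\<lambda>x. gradient w x - g x) =
      energy (\<lambda>x. (w x - v x) + (v x - z x)) (\<lambda>x. (gradient w x - h x) + (h x - g x))" by simp
  also have "\<dots> \<le> 2 powr p * (energy (\<lambda>x. w x - v x) (\<lambda>x. gradient w x - h x) + energy (\<lambda>x. v x - z x) (\<lambda>x. h x - g x))"
    using sobolevD[OF s1] sobolevD[OF s2] by (intro energy_add_le) auto
  also have "\<dots> < 2 powr p * (e' + e')" using v(3) w(2) by (intro mult_strict_left_mono) auto
  finally show "\<exists>w\<in>C1_compact \<Omega>. energy (\<lambda>x. w x - z x) (\<lambda>x. gradient w x - g x) < e"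
    using w(1) e'(2) by auto
qed

text \<open>Membership is a property of functions, not of classes, and a fold fixes the boundary
  datum only almost everywhere. The two representatives have distance 0, so closedness of
  \<open>W1p_zero\<close> gives the claim.\<close>

lemma W1p_zero_cong_AE:
  assumes z: "z \<in> W1p_zero \<Omega> p" and ae: "AE x in lebesgue_on \<Omega>. z x = v x"
  shows "v \<in> W1p_zero \<Omega> p"
proof -
  have s: "sobolev z (weak_gradient \<Omega> z)" using z W1p_imp_sobolev by (simp add: W1p_zero_def)
  have sv: "sobolev v (weak_gradient \<Omega> z)" by (rule sobolev_cong_AE[OF s ae]) simp
  show ?thesis
  proof (rule W1p_zero_closed[OF sv])
    fix e :: real assume e: "e > 0"
    note d = sobolevD[OF sobolev_diff[OF s sv]]
    have "energy (\<lambda>x. z x - v x) (\<lambda>x. weak_gradient \<Omega> z x - weak_gradient \<Omega> z x) = energy (\<lambda>x. 0) (\<lambda>x. 0)"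
      using ae by (intro energy_cong_AE d) auto
    also have "\<dots> = 0" by (simp add: energy_def)
    finally show "\<exists>v' h. v' \<in> W1p_zero \<Omega> p \<and> sobolev v' h \<and>
        energy (\<lambda>x. v' x - v x) (\<lambda>x. h x - weak_gradient \<Omega> z x) < e"
      using z s e by (intro exI[of _ z] exI[of _ "weak_gradient \<Omega> z"]) simp
  qed
qed

lemma integrable_extend:
  fixes f :: "real ^ 'n \<Rightarrow> 'b::euclidean_space"
  assumes "f \<in> Lp \<Omega> p"
  shows "integrable lebesgue (\<lambda>x. indicator \<Omega> x *\<^sub>R f x)"
    "integrable lebesgue (\<lambda>x. norm (indicator \<Omega> x *\<^sub>R f x) powr p)"
proof -
  show "integrable lebesgue (\<lambda>x. indicator \<Omega> x *\<^sub>R f x)"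
    using Lp_integrable[OF assms] by (simp only: integrable_lebesgue_on_iff[OF \<Omega>_sets])
  have "integrable lebesgue (\<lambda>x. indicator \<Omega> x *\<^sub>R (norm (f x) powr p))"
    using assms unfolding Lp_def integrable_lebesgue_on_iff[OF \<Omega>_sets] by blast
  moreover have "indicator \<Omega> x *\<^sub>R (norm (f x) powr p) = norm (indicator \<Omega> x *\<^sub>R f x) powr p" for x
    by (auto simp: indicator_def)
  ultimately show "integrable lebesgue (\<lambda>x. norm (indicator \<Omega> x *\<^sub>R f x) powr p)" by (simp only:)
qed

lemma integral_powr_restrict_le:
  fixes f h :: "real ^ 'n \<Rightarrow> 'b::euclidean_space"
  assumes "integrable lebesgue (\<lambda>x. norm (f x) powr p)" "\<And>x. x \<in> \<Omega> \<Longrightarrow> h x = f x"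
  shows "(LINT x|lebesgue_on \<Omega>. norm (h x) powr p) \<le> (LINT x|lebesgue. norm (f x) powr p)"
  unfolding integral_lebesgue_on[OF \<Omega>_sets]
proof (rule integral_mono')
  show "indicator \<Omega> x *\<^sub>R (norm (h x) powr p) \<le> norm (f x) powr p" for x
    using assms(2)[of x] by (auto simp: indicator_def)
qed (use assms in auto)

text \<open>The extension by zero is mollified with radii below the distance from \<open>K\<close>
  to the complement of \<open>\<Omega>\<close>. For this the gradient too has to vanish off
  \<open>K\<close>.\<close>

theorem W1p_zero_compact_support:
  assumes z: "sobolev z g" and K: "compact K" "K \<subseteq> \<Omega>" "\<And>x. x \<in> \<Omega> - K \<Longrightarrow> z x = 0"
  shows "z \<in> W1p_zero \<Omega> p"
proof -
  note zd = sobolevD[OF z]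
  define g0 where "g0 x = indicator K x *\<^sub>R g x" for x
  \<comment> \<open>The absolute value has its only corner at 0, so \<open>g\<close> vanishes almost
    everywhere on the zero set of \<open>z\<close>, in particular off \<open>K\<close>, and may be
    replaced by its cut-off \<open>g0\<close>.\<close>
  have "AE x in lebesgue_on \<Omega>. (if z x \<ge> 0 then 1 else - 1 :: real) \<noteq> (if z x > 0 then 1 else - 1) \<longrightarrow> g x = 0"
    by (rule gradient_eq_0_at_corners[OF \<Omega> zd(3,4,5) _ piecewise_affine_right[OF piecewise_affine_abs]
          piecewise_affine_left[OF piecewise_affine_abs], of 1]) auto
  then have ae: "AE x in lebesgue_on \<Omega>. g x = g0 x"
    using AE_space
  proof eventually_elim
    case (elim x)
    then show ?case using K(3)[of x] by (cases "x \<in> K") (auto simp: g0_def)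
  qed
  have z0: "sobolev z g0" by (rule sobolev_cong_AE[OF z _ ae]) simp
  note z0d = sobolevD[OF z0]
  define Z where "Z x = indicator \<Omega> x *\<^sub>R z x" for x
  define G where "G x = indicator \<Omega> x *\<^sub>R g0 x" for x
  note Zi = integrable_extend[OF z0d(1), folded Z_def] and Gi = integrable_extend[OF z0d(2), folded G_def]
  have Z_K: "Z x = 0" and G_K: "G x = 0" if "x \<notin> K" for x
    using that K(3)[of x] by (auto simp: Z_def G_def g0_def indicator_def)
  obtain \<rho> :: "nat \<Rightarrow> real ^ 'n \<Rightarrow> real" where \<rho>: "mollifier_sequence \<rho>"
    using exists_mollifier_sequence by blast
  have m: "mollifier (1 / real (Suc n)) (\<rho> n)" for n using \<rho> by (simp add: mollifier_sequence_def)
  obtain r where r: "r > 0" "(\<Union>x\<in>K. cball x r) \<subseteq> \<Omega>"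
    using compact_subset_open_imp_cball_epsilon_subset[OF K(1) \<Omega>(1) K(2)] by blast
  \<comment> \<open>Radii up to \<open>r / 2\<close> keep the supports of the mollifications in a
    compact neighbourhood of \<open>K\<close>, and leave another \<open>r / 2\<close> for the
    kernels centred near \<open>K\<close>.\<close>
  obtain N where N: "\<And>n. n \<ge> N \<Longrightarrow> 1 / real (Suc n) \<le> r / 2" using mollifier_sequence_small[of "r / 2"] r(1) by auto
  define w where "w n = convol (\<rho> n) Z" for n
  have w_C1: "w n \<in> C1_compact \<Omega>" if n: "n \<ge> N" for n
  proof -
    define S where "S = {x + y | x y. x \<in> K \<and> y \<in> cball 0 (r / 2)}"
    have "compactly_supported_in \<Omega> (w n)"
    proof (rule compactly_supported_inI)
      show "compact S" unfolding S_def by (intro compact_sums K compact_cball)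
      show "S \<subseteq> \<Omega>"
      proof
        fix a assume "a \<in> S"
        then obtain x y where xy: "a = x + y" "x \<in> K" "norm y \<le> r / 2" unfolding S_def by auto
        then have "a \<in> cball x r" using r(1) by (simp add: dist_norm)
        then show "a \<in> \<Omega>" using r(2) xy(2) by blast
      qed
      show "w n x = 0" if "x \<notin> S" for x
        unfolding w_def
      proof (rule convol_eq_0[OF m])
        fix y assume y: "dist x y < 1 / real (Suc n)"
        show "Z y = 0"
        proof (rule Z_K, rule notI)
          assume "y \<in> K"
          moreover have "x - y \<in> cball 0 (r / 2)" using y N[OF n] by (simp add: dist_norm norm_minus_commute)
          moreover have "x = y + (x - y)" by simp
          ultimately have "x \<in> S" unfolding S_def by blast
          then show False using that by simp
        qed
      qed
    qed
    then show ?thesis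
      using C_class_convol[OF mollifier_compact_support(1,2,3)[OF m] Zi(1)] by (simp add: C1_compact_def w_def)
  qed
  have w_grad: "gradient (w n) x = convol (\<rho> n) G x" if n: "n \<ge> N" for n x
  \<comment> \<open>Near \<open>K\<close> the ball of the kernel fits into \<open>\<Omega>\<close>,
    and mollification commutes with the weak gradient; at the remaining points both sides
    vanish.\<close>
  proof (cases "\<exists>y\<in>K. dist x y \<le> 1 / real (Suc n)")
    case True
    then obtain y where y: "y \<in> K" "dist x y \<le> 1 / real (Suc n)" by blast
    have "cball x (1 / real (Suc n)) \<subseteq> cball y r"
    proof
      fix a assume "a \<in> cball x (1 / real (Suc n))"
      then show "a \<in> cball y r"
        using y(2) N[OF n] dist_triangle[of y a x] by (simp add: dist_commute)
    qed
    then have "cball x (1 / real (Suc n)) \<subseteq> \<Omega>" using r(2) y(1) by blast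
    then show ?thesis
      unfolding gradient_def w_def Z_def G_def
      using partial_deriv_convol_weak[OF \<Omega>(1) z0d(3,4,5) m] by (simp add: vec_eq_iff)
  next
    case False
    have "partial_deriv i (w n) x = 0" for i
    proof -
      have zero: "partial_deriv i (\<rho> n) (x - y) *\<^sub>R Z y = 0" for y
      proof (cases "y \<in> K")
        case True
        then have "\<not> dist x y \<le> 1 / real (Suc n)" using False by blast
        then have "x - y \<notin> cball 0 (1 / real (Suc n))" unfolding mem_cball_0 dist_norm .
        then have "partial_deriv i (\<rho> n) (x - y) = 0"
          using mollifier_compact_support(3)[OF m[of n]]
          by (intro partial_deriv_eq_0_outside[of "cball 0 (1 / real (Suc n))"] closed_cball)
        then show ?thesis by simp
      qed (simp add: Z_K)
      have "partial_deriv i (w n) = convol (partial_deriv i (\<rho> n)) Z"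
        unfolding w_def by (rule partial_deriv_convol[OF mollifier_compact_support(1,2,3)[OF m] Zi(1)])
      then show ?thesis by (simp only: convol_def zero) simp
    qed
    moreover have "convol (\<rho> n) G x = 0"
      by (rule convol_eq_0[OF m], rule G_K) (use False less_imp_le in blast)
    ultimately show ?thesis by (simp add: gradient_def vec_eq_iff)
  qed
  show ?thesis
    unfolding W1p_zero_iff[OF z0]
  proof (intro allI impI)
    fix e :: real assume e: "e > 0"
    have "(\<lambda>n. (LINT x|lebesgue. norm (convol (\<rho> n) Z x - Z x) powr p) +
        (LINT x|lebesgue. norm (convol (\<rho> n) G x - G x) powr p)) \<longlonglongrightarrow> 0 + 0"
      by (intro tendsto_add convol_Lp[OF \<rho> p Zi] convol_Lp[OF \<rho> p Gi])
    then have "eventually (\<lambda>n. (LINT x|lebesgue. norm (convol (\<rho> n) Z x - Z x) powr p) +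
        (LINT x|lebesgue. norm (convol (\<rho> n) G x - G x) powr p) < e) sequentially"
      using e by (intro order_tendstoD) auto
    moreover have "eventually (\<lambda>n. n \<ge> N) sequentially" by (rule eventually_ge_at_top)
    ultimately obtain n where n: "n \<ge> N" "(LINT x|lebesgue. norm (convol (\<rho> n) Z x - Z x) powr p) +
        (LINT x|lebesgue. norm (convol (\<rho> n) G x - G x) powr p) < e"
      using eventually_happens'[OF sequentially_bot eventually_conj] by blast
    have "energy (\<lambda>x. w n x - z x) (\<lambda>x. gradient (w n) x - g0 x) \<le>
        (LINT x|lebesgue. norm (convol (\<rho> n) Z x - Z x) powr p) +
        (LINT x|lebesgue. norm (convol (\<rho> n) G x - G x) powr p)"
      unfolding energy_def w_grad[OF n(1)]
      by (intro add_mono integral_powr_restrict_le integrable_convol_powr[OF m p] Zi Gi) (auto simp: w_def Z_def G_def)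
    then show "\<exists>w\<in>C1_compact \<Omega>. energy (\<lambda>x. w x - z x) (\<lambda>x. gradient w x - g0 x) < e"
      using w_C1[OF n(1)] n(2) by force
  qed
qed

text \<open>If \<open>w\<close> is replaced by an approximant \<open>y n\<close> of compact support,
  the difference vanishes off a compact set and \<open>W1p_zero_compact_support\<close> applies. The
  fixed term \<open>F (\<phi> x)\<close> cancels from the convergence estimates, which compare
  \<open>F (yu n x)\<close> with \<open>F (u x)\<close>.\<close>

theorem W1p_zero_compose:
  assumes \<phi>: "sobolev \<phi> g\<phi>" and w: "w \<in> W1p_zero \<Omega> p"
    and lip: "\<And>s t. \<bar>F s - F t\<bar> \<le> B * \<bar>s - t\<bar>" and aff: "piecewise_affine F DR DL"
  shows "(\<lambda>x. F (\<phi> x + w x) - F (\<phi> x)) \<in> W1p_zero \<Omega> p"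
proof -
  define gw where "gw = weak_gradient \<Omega> w"
  have sw: "sobolev w gw" using w W1p_imp_sobolev by (simp add: W1p_zero_def gw_def)
  have B: "B \<ge> 0" using lip[of 1 0] by simp
  have "\<exists>v\<in>C1_compact \<Omega>. energy (\<lambda>x. v x - w x) (\<lambda>x. gradient v x - gw x) < 1 / real (Suc n)" for n
    using w W1p_zero_iff[OF sw] by (meson of_nat_0_less_iff zero_less_Suc zero_less_divide_1_iff)
  then obtain v where v: "\<And>n. v n \<in> C1_compact \<Omega>"
    "\<And>n. energy (\<lambda>x. v n x - w x) (\<lambda>x. gradient (v n) x - gw x) < 1 / real (Suc n)" by metis
  note sv = sobolev_C1_compact[OF v(1)]
  have E: "(\<lambda>n. energy (\<lambda>x. v n x - w x) (\<lambda>x. gradient (v n) x - gw x)) \<longlonglongrightarrow> 0"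
    by (rule tendsto_sandwich[OF _ _ tendsto_const[of 0] LIMSEQ_inverse_real_of_nat])
      (use v(2) energy_nonneg in \<open>auto simp: divide_inverse less_imp_le intro!: always_eventually\<close>)
  note dl = sobolevD[OF sobolev_diff[OF sv sw]]
  have E1: "(\<lambda>n. LINT x|lebesgue_on \<Omega>. norm (v n x - w x) powr p) \<longlonglongrightarrow> 0"
    by (rule tendsto_sandwich[OF _ _ tendsto_const[of 0] E]) (auto simp: energy_def intro!: always_eventually)
  have E2: "(\<lambda>n. LINT x|lebesgue_on \<Omega>. norm (gradient (v n) x - gw x) powr p) \<longlonglongrightarrow> 0"
    by (rule tendsto_sandwich[OF _ _ tendsto_const[of 0] E]) (auto simp: energy_def intro!: always_eventually)
  have I1: "integrable (lebesgue_on \<Omega>) (\<lambda>x. norm (v n x - w x) powr p)"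
    and I2: "integrable (lebesgue_on \<Omega>) (\<lambda>x. norm (gradient (v n) x - gw x) powr p)" for n
    using dl(1,2)[of n] by (auto simp: Lp_def)
  \<comment> \<open>Slopes are compared point by point, so almost everywhere convergence is
    extracted from the p-th powers, first for the functions and then for their gradients.\<close>
  have "\<exists>s. strict_mono s \<and> (AE x in lebesgue_on \<Omega>. (\<lambda>n. norm (v (s n) x - w x) powr p) \<longlonglongrightarrow> 0)"
    by (rule tendsto_L1_AE_subseq[OF I1]) (use E1 in simp)
  then obtain s where s: "strict_mono s" "AE x in lebesgue_on \<Omega>. (\<lambda>n. norm (v (s n) x - w x) powr p) \<longlonglongrightarrow> 0"
    by blast
  have "\<exists>t. strict_mono t \<and> (AE x in lebesgue_on \<Omega>. (\<lambda>n. norm (gradient (v (s (t n))) x - gw x) powr p) \<longlonglongrightarrow> 0)"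
    by (rule tendsto_L1_AE_subseq[OF I2]) (use LIMSEQ_subseq_LIMSEQ[OF E2 s(1)] in \<open>simp add: o_def\<close>)
  then obtain t where t: "strict_mono t"
    "AE x in lebesgue_on \<Omega>. (\<lambda>n. norm (gradient (v (s (t n))) x - gw x) powr p) \<longlonglongrightarrow> 0" by blast
  define y where "y n = v (s (t n))" for n
  have st: "strict_mono (s \<circ> t)" using s(1) t(1) by (rule strict_mono_o)
  have y: "y n \<in> C1_compact \<Omega>" and sy: "sobolev (y n) (gradient (y n))" for n using v(1) sv by (auto simp: y_def)
  have yE1: "(\<lambda>n. LINT x|lebesgue_on \<Omega>. norm (y n x - w x) powr p) \<longlonglongrightarrow> 0"
    and yE2: "(\<lambda>n. LINT x|lebesgue_on \<Omega>. norm (gradient (y n) x - gw x) powr p) \<longlonglongrightarrow> 0"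
    using LIMSEQ_subseq_LIMSEQ[OF E1 st] LIMSEQ_subseq_LIMSEQ[OF E2 st] by (auto simp: y_def o_def)
  have y_ae: "AE x in lebesgue_on \<Omega>. (\<lambda>n. y n x) \<longlonglongrightarrow> w x"
    using s(2)
  proof eventually_elim
    case (elim x)
    from LIMSEQ_subseq_LIMSEQ[OF elim t(1)] have "(\<lambda>n. norm (y n x - w x) powr p) \<longlonglongrightarrow> 0"
      by (simp add: y_def o_def)
    from tendsto_0_of_powr[OF p this] show ?case by (rule LIM_zero_cancel)
  qed
  have gy_ae: "AE x in lebesgue_on \<Omega>. (\<lambda>n. gradient (y n) x) \<longlonglongrightarrow> gw x"
    using t(2)
  proof eventually_elim
    case (elim x)
    from tendsto_0_of_powr[OF p elim] show ?case unfolding y_def by (rule LIM_zero_cancel)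
  qed
  define u where "u x = \<phi> x + w x" for x
  define gu where "gu x = g\<phi> x + gw x" for x
  define yu where "yu n x = \<phi> x + y n x" for n x
  define gyu where "gyu n x = g\<phi> x + gradient (y n) x" for n x
  have su: "sobolev u gu" unfolding u_def gu_def by (rule sobolev_add[OF \<phi> sw])
  have syu: "sobolev (yu n) (gyu n)" for n unfolding yu_def gyu_def by (rule sobolev_add[OF \<phi> sy])
  note chain = sobolev_chain[OF _ lip piecewise_affine_right[OF aff]]
  note cm = chain_rule_right(2,3)[OF \<Omega> _ _ _ lip piecewise_affine_right[OF aff]]
  note sud = sobolevD[OF su]
  have corner: "AE x in lebesgue_on \<Omega>. DR (u x) \<noteq> DL (u x) \<longrightarrow> gu x = 0"
    by (rule gradient_eq_0_at_corners[OF \<Omega> sud(3,4,5) lip piecewise_affine_right[OF aff] piecewise_affine_left[OF aff]])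
  define z where "z x = F (u x) - F (\<phi> x)" for x
  define gz where "gz x = DR (u x) *\<^sub>R gu x - DR (\<phi> x) *\<^sub>R g\<phi> x" for x
  define zn where "zn n x = F (yu n x) - F (\<phi> x)" for n x
  define gzn where "gzn n x = DR (yu n x) *\<^sub>R gyu n x - DR (\<phi> x) *\<^sub>R g\<phi> x" for n x
  have sz: "sobolev z gz" unfolding z_def gz_def by (rule sobolev_diff[OF chain[OF su] chain[OF \<phi>]])
  have szn: "sobolev (zn n) (gzn n)" for n unfolding zn_def gzn_def by (rule sobolev_diff[OF chain[OF syu] chain[OF \<phi>]])
  have DRB: "\<bar>DR t\<bar> \<le> B" for t using cm(2)[OF sud(3,4,5)] .
  have zn0: "zn n \<in> W1p_zero \<Omega> p" for n
  proof -
    obtain K where K: "compact K" "K \<subseteq> \<Omega>" "\<And>x. x \<notin> K \<Longrightarrow> y n x = 0"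
      using compactly_supported_inE y[of n] unfolding C1_compact_def by blast
    show ?thesis by (rule W1p_zero_compact_support[OF szn K(1,2)]) (use K(3) in \<open>auto simp: zn_def yu_def\<close>)
  qed
  have Z1: "(\<lambda>n. LINT x|lebesgue_on \<Omega>. norm (zn n x - z x) powr p) \<longlonglongrightarrow> 0"
  proof (rule tendsto_sandwich[OF _ _ tendsto_const[of 0]])
    show "(\<lambda>n. B powr p * (LINT x|lebesgue_on \<Omega>. norm (y n x - w x) powr p)) \<longlonglongrightarrow> 0"
      using tendsto_mult_left[OF yE1, of "B powr p"] by simp
    show "\<forall>\<^sub>F n in sequentially. (LINT x|lebesgue_on \<Omega>. norm (zn n x - z x) powr p) \<le>
        B powr p * (LINT x|lebesgue_on \<Omega>. norm (y n x - w x) powr p)"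
    proof (rule always_eventually, rule allI)
      fix n
      have "(LINT x|lebesgue_on \<Omega>. norm (zn n x - z x) powr p) \<le> (LINT x|lebesgue_on \<Omega>. B powr p * norm (y n x - w x) powr p)"
      proof (rule integral_mono)
        show "norm (zn n x - z x) powr p \<le> B powr p * norm (y n x - w x) powr p" for x
        proof -
          have "norm (zn n x - z x) \<le> B * norm (y n x - w x)"
            using lip[of "yu n x" "u x"] by (simp add: zn_def z_def yu_def u_def)
          then have "norm (zn n x - z x) powr p \<le> (B * norm (y n x - w x)) powr p"
            using p by (intro powr_mono2) auto
          then show ?thesis using B by (simp add: powr_mult)
        qed
      qed (use sobolevD(1)[OF sobolev_diff[OF szn sz]] sobolevD(1)[OF sobolev_diff[OF sy sw]] in \<open>auto simp: Lp_def\<close>)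
      then show "(LINT x|lebesgue_on \<Omega>. norm (zn n x - z x) powr p) \<le>
          B powr p * (LINT x|lebesgue_on \<Omega>. norm (y n x - w x) powr p)" by simp
    qed
  qed auto
  have gz_diff: "gzn n x - gz x = DR (yu n x) *\<^sub>R gyu n x - DR (u x) *\<^sub>R gu x" for n x
    by (simp add: gzn_def gz_def)
  have gyu_diff: "gyu n x - gu x = gradient (y n) x - gw x" for n x by (simp add: gyu_def gu_def)
  have Z2: "(\<lambda>n. LINT x|lebesgue_on \<Omega>. norm (norm (gzn n x - gz x) powr p)) \<longlonglongrightarrow> 0"
  \<comment> \<open>Slopes are at most \<open>B\<close> in absolute value. The p-th power is thus
    controlled by the gradient error, which vanishes in L1, and a fixed multiple of
    \<open>norm (gu x) powr p\<close>.\<close>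
  proof (rule tendsto_integral_norm_0_dominated[where a = "\<lambda>n x. 2 powr p * (B powr p * norm (gradient (y n) x - gw x) powr p)"
        and b = "\<lambda>x. 2 powr p * ((2 * B) powr p * norm (gu x) powr p)"])
    show "(\<lambda>x. norm (gzn n x - gz x) powr p) \<in> borel_measurable (lebesgue_on \<Omega>)" for n
      using sobolevD(2)[OF sobolev_diff[OF szn sz]] by (auto simp: Lp_def)
    show "integrable (lebesgue_on \<Omega>) (\<lambda>x. 2 powr p * (B powr p * norm (gradient (y n) x - gw x) powr p))" for n
      using sobolevD(2)[OF sobolev_diff[OF sy sw]] by (auto simp: Lp_def)
    show "integrable (lebesgue_on \<Omega>) (\<lambda>x. 2 powr p * ((2 * B) powr p * norm (gu x) powr p))"
      using sud(2) by (auto simp: Lp_def)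
    show "(\<lambda>n. LINT x|lebesgue_on \<Omega>. \<bar>2 powr p * (B powr p * norm (gradient (y n) x - gw x) powr p)\<bar>) \<longlonglongrightarrow> 0"
      using tendsto_mult_left[OF yE2, of "2 powr p * B powr p"] by (simp add: abs_mult mult.assoc)
    show "AE x in lebesgue_on \<Omega>. (\<lambda>n. norm (gzn n x - gz x) powr p) \<longlonglongrightarrow> 0"
      using y_ae gy_ae corner
    proof eventually_elim
      case (elim x)
      have yu_lim: "(\<lambda>n. yu n x) \<longlonglongrightarrow> u x" unfolding yu_def u_def by (intro tendsto_intros elim(1))
      have gyu_lim: "(\<lambda>n. gyu n x) \<longlonglongrightarrow> gu x" unfolding gyu_def gu_def by (intro tendsto_intros elim(2))
      have "(\<lambda>n. DR (yu n x) *\<^sub>R gyu n x - DR (u x) *\<^sub>R gu x) \<longlonglongrightarrow> 0"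
      \<comment> \<open>Off the corners the slope at \<open>yu n x\<close> is eventually the slope
        at \<open>u x\<close>. At a corner the slopes may oscillate, but \<open>gyu n x\<close>
        tends to \<open>gu x = 0\<close> and the slopes stay bounded.\<close>
      proof (cases "DR (u x) = DL (u x)")
        case True
        have "(\<lambda>n. DR (u x) *\<^sub>R gyu n x - DR (u x) *\<^sub>R gu x) \<longlonglongrightarrow> DR (u x) *\<^sub>R gu x - DR (u x) *\<^sub>R gu x"
          by (intro tendsto_intros gyu_lim)
        then have "(\<lambda>n. DR (u x) *\<^sub>R gyu n x - DR (u x) *\<^sub>R gu x) \<longlonglongrightarrow> 0" by simp
        then show ?thesis
          by (rule Lim_transform_eventually)
            (use piecewise_affine_slope_eventually_const[OF aff True yu_lim] in eventually_elim, simp)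
      next
        case False
        then have gu0: "gu x = 0" using elim(3) by simp
        show ?thesis
        proof (rule Lim_null_comparison)
          show "\<forall>\<^sub>F n in sequentially. norm (DR (yu n x) *\<^sub>R gyu n x - DR (u x) *\<^sub>R gu x) \<le> B * norm (gyu n x)"
            using DRB by (auto simp: gu0 intro!: always_eventually mult_right_mono)
          show "(\<lambda>n. B * norm (gyu n x)) \<longlonglongrightarrow> 0"
            using tendsto_mult_left[OF tendsto_norm[OF gyu_lim], of B] by (simp add: gu0)
        qed
      qed
      then have "(\<lambda>n. norm (gzn n x - gz x) powr p) \<longlonglongrightarrow> 0 powr p"
        unfolding gz_diff using p by (intro tendsto_powr') (auto intro: tendsto_norm_zero)
      then show ?case by simp
    qed
    show "AE x in lebesgue_on \<Omega>. norm (norm (gzn n x - gz x) powr p) \<le>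
        \<bar>2 powr p * (B powr p * norm (gradient (y n) x - gw x) powr p)\<bar> + 2 powr p * ((2 * B) powr p * norm (gu x) powr p)" for n
    proof (rule AE_I2)
      fix x
      have "norm (gzn n x - gz x) \<le> norm (DR (yu n x) *\<^sub>R gyu n x) + norm (DR (u x) *\<^sub>R gu x)"
        unfolding gz_diff by (rule norm_triangle_ineq4)
      also have "\<dots> \<le> B * norm (gyu n x) + B * norm (gu x)"
        using DRB by (auto intro!: add_mono mult_right_mono)
      also have "\<dots> \<le> B * (norm (gyu n x - gu x) + norm (gu x)) + B * norm (gu x)"
        using B norm_triangle_sub[of "gyu n x" "gu x"] by (intro add_right_mono mult_left_mono) auto
      also have "\<dots> = B * norm (gradient (y n) x - gw x) + 2 * B * norm (gu x)"
        by (simp add: gyu_diff algebra_simps)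
      finally have "norm (gzn n x - gz x) powr p \<le> (B * norm (gradient (y n) x - gw x) + 2 * B * norm (gu x)) powr p"
        using p by (intro powr_mono2) auto
      also have "\<dots> \<le> 2 powr p * ((B * norm (gradient (y n) x - gw x)) powr p + (2 * B * norm (gu x)) powr p)"
        using p B by (intro powr_add_le) auto
      also have "\<dots> = 2 powr p * (B powr p * norm (gradient (y n) x - gw x) powr p) + 2 powr p * ((2 * B) powr p * norm (gu x) powr p)"
        using B by (simp add: powr_mult distrib_left)
      finally show "norm (norm (gzn n x - gz x) powr p) \<le>
          \<bar>2 powr p * (B powr p * norm (gradient (y n) x - gw x) powr p)\<bar> + 2 powr p * ((2 * B) powr p * norm (gu x) powr p)"
        by simp
    qed
  qed
  have "z \<in> W1p_zero \<Omega> p"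
  proof (rule W1p_zero_closed[OF sz])
    fix e :: real assume e: "e > 0"
    have "(\<lambda>n. energy (\<lambda>x. zn n x - z x) (\<lambda>x. gzn n x - gz x)) \<longlonglongrightarrow> 0"
      unfolding energy_def using tendsto_add[OF Z1 Z2] by simp
    then have "eventually (\<lambda>n. energy (\<lambda>x. zn n x - z x) (\<lambda>x. gzn n x - gz x) < e) sequentially"
      using e by (intro order_tendstoD) auto
    then obtain n where "energy (\<lambda>x. zn n x - z x) (\<lambda>x. gzn n x - gz x) < e"
      by (auto simp: eventually_sequentially)
    then show "\<exists>v h. v \<in> W1p_zero \<Omega> p \<and> sobolev v h \<and> energy (\<lambda>x. v x - z x) (\<lambda>x. h x - gz x) < e"
      using zn0 szn by blast
  qed
  moreover have "z = (\<lambda>x. F (\<phi> x + w x) - F (\<phi> x))" by (simp add: fun_eq_iff z_def u_def)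
  ultimately show ?thesis by simp
qed

end

subsection \<open>The sawtooth\<close>

text \<open>The distance to the nearest integer.\<close>

definition tooth :: "real \<Rightarrow> real"
  where "tooth z = \<bar>z - of_int (round z)\<bar>"

text \<open>The right-continuous choice of slope: 1 at integers, - 1 midway between them.\<close>

definition tooth_slope :: "real \<Rightarrow> real"
  where "tooth_slope z = (if frac z < 1 / 2 then 1 else - 1)"

lemma tooth_nonneg: "0 \<le> tooth z"
  by (simp add: tooth_def)

lemma tooth_le: "tooth z \<le> 1 / 2"
  using of_int_round_abs_le[of z] by (simp add: tooth_def abs_minus_commute)

text \<open>The interval is closed at both ends, so that one formula serves to the right and to the
  left of an integer. It holds because \<open>round\<close> picks a nearest integer, and none is
  nearer than \<open>k\<close> or \<open>k + 1\<close>.\<close>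

lemma tooth_eq:
  assumes "of_int k \<le> z" "z \<le> of_int k + 1"
  shows "tooth z = min (z - of_int k) (of_int k + 1 - z)"
proof (rule antisym)
  have "tooth z \<le> \<bar>z - of_int k\<bar>" "tooth z \<le> \<bar>z - of_int (k + 1)\<bar>"
    unfolding tooth_def by (rule round_diff_minimal)+
  then show "tooth z \<le> min (z - of_int k) (of_int k + 1 - z)" using assms by simp
  have "round z \<le> k \<or> round z \<ge> k + 1" by linarith
  then have "of_int (round z) \<le> (of_int k :: real) \<or> of_int (round z) \<ge> (of_int k + 1 :: real)"
    by (metis of_int_1 of_int_add of_int_le_iff)
  then show "min (z - of_int k) (of_int k + 1 - z) \<le> tooth z"
    unfolding tooth_def using assms by linarith
qed

lemma tooth_lipschitz: "\<bar>tooth s - tooth t\<bar> \<le> \<bar>s - t\<bar>"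
proof -
  have "tooth s \<le> \<bar>s - t\<bar> + tooth t" for s t
  proof -
    have "tooth s \<le> \<bar>s - of_int (round t)\<bar>" unfolding tooth_def by (rule round_diff_minimal)
    also have "\<dots> \<le> \<bar>s - t\<bar> + tooth t" unfolding tooth_def by linarith
    finally show ?thesis .
  qed
  from this[of s t] this[of t s] show ?thesis by (simp add: abs_le_iff abs_minus_commute)
qed

lemma tooth_right:
  obtains \<delta> where "\<delta> > 0" "\<And>s. s \<in> {z..<z + \<delta>} \<Longrightarrow> tooth s = tooth z + tooth_slope z * (s - z) \<and> tooth_slope s = tooth_slope z"
proof -
  define k where "k = \<lfloor>z\<rfloor>"
  have k: "of_int k \<le> z" "z < of_int k + 1" unfolding k_def by linarith+
  have fr: "frac s = s - of_int k" if "of_int k \<le> s" "s < of_int k + 1" for s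
    using that by (simp add: frac_def) (metis floor_unique of_int_eq_iff)
  show ?thesis
  proof (cases "z < of_int k + 1 / 2")
    case True
    show ?thesis
      by (rule that[of "of_int k + 1 / 2 - z"])
        (use True k in \<open>auto simp: tooth_eq[of k] tooth_slope_def fr\<close>)
  next
    case False
    show ?thesis
      by (rule that[of "of_int k + 1 - z"])
        (use False k in \<open>auto simp: tooth_eq[of k] tooth_slope_def fr\<close>)
  qed
qed

lemma tooth_left:
  obtains \<delta> a where "\<delta> > 0" "\<And>s. s \<in> {z - \<delta><..<z} \<Longrightarrow> tooth s = tooth z + a * (s - z) \<and> tooth_slope s = a"
proof -
  \<comment> \<open>Ceiling minus 1 rather than floor: an integer \<open>z\<close> has to be the
    right end of its unit interval when it is approached from below.\<close>
  define k where "k = \<lceil>z\<rceil> - 1"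
  have k: "of_int k < z" "z \<le> of_int k + 1" unfolding k_def by linarith+
  have fr: "frac s = s - of_int k" if "of_int k \<le> s" "s < of_int k + 1" for s
    using that by (simp add: frac_def) (metis floor_unique of_int_eq_iff)
  show ?thesis
  proof (cases "z \<le> of_int k + 1 / 2")
    case True
    show ?thesis
      by (rule that[of "z - of_int k" 1])
        (use True k in \<open>auto simp: tooth_eq[of k] tooth_slope_def fr\<close>)
  next
    case False
    show ?thesis
      by (rule that[of "z - (of_int k + 1 / 2)" "- 1"])
        (use False k in \<open>auto simp: tooth_eq[of k] tooth_slope_def fr\<close>)
  qed
qed

lemma tooth_slope_cases: "tooth_slope z = 1 \<or> tooth_slope z = - 1"
  by (simp add: tooth_slope_def)

text \<open>Scaled to have height \<open>2 * e * (1 / 2) = e\<close> and slopes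
  \<open>\<theta>\<close> and \<open>- \<theta>\<close>; for \<open>\<theta> = 0\<close> it is
  identically 0.\<close>

definition saw :: "real \<Rightarrow> real \<Rightarrow> real \<Rightarrow> real"
  where "saw \<theta> e s = 2 * e * tooth (\<theta> * s / (2 * e))"

definition saw_slope :: "real \<Rightarrow> real \<Rightarrow> real \<Rightarrow> real"
  where "saw_slope \<theta> e s = \<theta> * tooth_slope (\<theta> * s / (2 * e))"

lemma saw_bounds:
  assumes "e > 0"
  shows "0 \<le> saw \<theta> e s" "saw \<theta> e s \<le> e"
  using assms tooth_nonneg[of "\<theta> * s / (2 * e)"] tooth_le[of "\<theta> * s / (2 * e)"]
  by (auto simp: saw_def mult_left_le)

lemma saw_0 [simp]: "saw \<theta> e 0 = 0"
  by (simp add: saw_def tooth_def)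

lemma saw_lipschitz:
  assumes "e > 0" "0 \<le> \<theta>" "\<theta> \<le> 1"
  shows "\<bar>saw \<theta> e s - saw \<theta> e t\<bar> \<le> \<bar>s - t\<bar>"
proof -
  have "\<bar>saw \<theta> e s - saw \<theta> e t\<bar> = 2 * e * \<bar>tooth (\<theta> * s / (2 * e)) - tooth (\<theta> * t / (2 * e))\<bar>"
    using assms(1) by (simp add: saw_def abs_mult flip: right_diff_distrib)
  also have "\<dots> \<le> 2 * e * \<bar>\<theta> * s / (2 * e) - \<theta> * t / (2 * e)\<bar>"
    using assms(1) by (intro mult_left_mono tooth_lipschitz) auto
  also have "\<dots> = \<theta> * \<bar>s - t\<bar>"
    using assms by (simp add: abs_mult flip: diff_divide_distrib right_diff_distrib)
  also have "\<dots> \<le> 1 * \<bar>s - t\<bar>" using assms by (intro mult_right_mono) auto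
  finally show ?thesis by simp
qed

lemma saw_slope_cases: "saw_slope \<theta> e s = \<theta> \<or> saw_slope \<theta> e s = - \<theta>"
  using tooth_slope_cases[of "\<theta> * s / (2 * e)"] by (auto simp: saw_slope_def)

lemma saw_right:
  assumes "e > 0" "0 \<le> \<theta>"
  obtains \<delta> where "\<delta> > 0" "\<And>s. s \<in> {t..<t + \<delta>} \<Longrightarrow>
    saw \<theta> e s = saw \<theta> e t + saw_slope \<theta> e t * (s - t) \<and> saw_slope \<theta> e s = saw_slope \<theta> e t"
\<comment> \<open>For \<open>\<theta> = 0\<close> the neighbourhood \<open>\<delta> / c\<close>
  below would degenerate, but the function is then constant.\<close>
proof (cases "\<theta> = 0")
  case True
  then show ?thesis using that[of 1] by (simp add: saw_def saw_slope_def)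
next
  case False
  then have \<theta>: "\<theta> > 0" using assms by simp
  define c where "c = \<theta> / (2 * e)"
  have c: "c > 0" "2 * e * c = \<theta>" using assms \<theta> by (auto simp: c_def)
  have cs: "\<theta> * s / (2 * e) = c * s" for s by (simp add: c_def)
  obtain \<delta> where \<delta>: "\<delta> > 0" "\<And>s. s \<in> {c * t..<c * t + \<delta>} \<Longrightarrow>
      tooth s = tooth (c * t) + tooth_slope (c * t) * (s - c * t) \<and> tooth_slope s = tooth_slope (c * t)"
    by (rule tooth_right[of "c * t"]) blast
  show ?thesis
  proof (rule that[of "\<delta> / c"])
    fix s assume s: "s \<in> {t..<t + \<delta> / c}"
    then have "c * s \<in> {c * t..<c * t + \<delta>}" using c(1) by (auto simp: field_simps)
    note h = conjunct1[OF \<delta>(2)[OF this]] conjunct2[OF \<delta>(2)[OF this]]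
    show "saw \<theta> e s = saw \<theta> e t + saw_slope \<theta> e t * (s - t) \<and> saw_slope \<theta> e s = saw_slope \<theta> e t"
      unfolding saw_def saw_slope_def cs h by (simp add: c(2)[symmetric] algebra_simps)
  qed (use \<delta>(1) c(1) in auto)
qed

lemma saw_left:
  assumes "e > 0" "0 \<le> \<theta>"
  obtains \<delta> a where "\<delta> > 0" "\<And>s. s \<in> {t - \<delta><..<t} \<Longrightarrow>
    saw \<theta> e s = saw \<theta> e t + a * (s - t) \<and> saw_slope \<theta> e s = a"
proof (cases "\<theta> = 0")
  case True
  then show ?thesis using that[of 1 0] by (simp add: saw_def saw_slope_def)
next
  case False
  then have \<theta>: "\<theta> > 0" using assms by simp
  define c where "c = \<theta> / (2 * e)"
  have c: "c > 0" "2 * e * c = \<theta>" using assms \<theta> by (auto simp: c_def)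
  have cs: "\<theta> * s / (2 * e) = c * s" for s by (simp add: c_def)
  obtain \<delta> a where \<delta>: "\<delta> > 0" "\<And>s. s \<in> {c * t - \<delta><..<c * t} \<Longrightarrow>
      tooth s = tooth (c * t) + a * (s - c * t) \<and> tooth_slope s = a"
    by (rule tooth_left[of "c * t"]) blast
  show ?thesis
  proof (rule that[of "\<delta> / c" "\<theta> * a"])
    fix s assume s: "s \<in> {t - \<delta> / c<..<t}"
    then have "c * s \<in> {c * t - \<delta><..<c * t}" using c(1) by (auto simp: field_simps)
    note h = conjunct1[OF \<delta>(2)[OF this]] conjunct2[OF \<delta>(2)[OF this]]
    show "saw \<theta> e s = saw \<theta> e t + \<theta> * a * (s - t) \<and> saw_slope \<theta> e s = \<theta> * a"
      unfolding saw_def saw_slope_def cs h by (simp add: c(2)[symmetric] algebra_simps)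
  qed (use \<delta>(1) c(1) in auto)
qed

subsection \<open>Truncation by folding\<close>

text \<open>
  The identity on \<open>[lo, hi]\<close>; the rays beyond \<open>hi\<close> and \<open>lo\<close> are folded back into
  \<open>[hi - e, hi]\<close> and \<open>[lo, lo + e']\<close> with slopes \<open>\<plusminus>\<theta>\<close> and \<open>\<plusminus>\<theta>'\<close>.
\<close>

definition fold_back :: "real \<Rightarrow> real \<Rightarrow> real \<Rightarrow> real \<Rightarrow> real \<Rightarrow> real \<Rightarrow> real \<Rightarrow> real"
  where "fold_back hi \<theta> e lo \<theta>' e' t =
    max lo (min hi t) - saw \<theta> e (max 0 (t - hi)) + saw \<theta>' e' (min 0 (t - lo))"

text \<open>Right slopes: \<open>hi\<close> already belongs to the folded ray, while
  \<open>lo\<close> still belongs to the identity, hence the strict inequality there.\<close>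

definition fold_slope :: "real \<Rightarrow> real \<Rightarrow> real \<Rightarrow> real \<Rightarrow> real \<Rightarrow> real \<Rightarrow> real \<Rightarrow> real"
  where "fold_slope hi \<theta> e lo \<theta>' e' t =
    (if t \<ge> hi then - saw_slope \<theta> e (t - hi) else if t < lo then saw_slope \<theta>' e' (t - lo) else 1)"

lemma fold_back_cases:
  assumes "lo < hi"
  shows "lo \<le> t \<Longrightarrow> t \<le> hi \<Longrightarrow> fold_back hi \<theta> e lo \<theta>' e' t = t"
    and "t \<ge> hi \<Longrightarrow> fold_back hi \<theta> e lo \<theta>' e' t = hi - saw \<theta> e (t - hi)"
    and "t \<le> lo \<Longrightarrow> fold_back hi \<theta> e lo \<theta>' e' t = lo + saw \<theta>' e' (t - lo)"
  using assms by (auto simp: fold_back_def max_def min_def)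

text \<open>A number is the sum of its clamped value and its excesses above \<open>hi\<close> and
  below \<open>lo\<close>. All three are nondecreasing, so their increments add up to exactly
  \<open>\<bar>s - t\<bar>\<close>, and each sawtooth is 1-Lipschitz in its excess. The factor
  \<open>1\<close> matches the shape of the Lipschitz hypothesis in the chain rules.\<close>

lemma fold_back_lipschitz:
  assumes "e > 0" "e' > 0" "\<theta> \<in> {0..1}" "\<theta>' \<in> {0..1}" "lo < hi"
  shows "\<bar>fold_back hi \<theta> e lo \<theta>' e' s - fold_back hi \<theta> e lo \<theta>' e' t\<bar> \<le> 1 * \<bar>s - t\<bar>"
proof -
  let ?c = "\<lambda>t. max lo (min hi t)" and ?r = "\<lambda>t. max 0 (t - hi)" and ?l = "\<lambda>t. min 0 (t - lo)"
  have saws: "\<bar>saw \<theta> e (?r s) - saw \<theta> e (?r t)\<bar> \<le> \<bar>?r s - ?r t\<bar>"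
    "\<bar>saw \<theta>' e' (?l s) - saw \<theta>' e' (?l t)\<bar> \<le> \<bar>?l s - ?l t\<bar>"
    using assms by (auto intro: saw_lipschitz)
  have tri: "\<bar>a - b + c - (a' - b' + c')\<bar> \<le> \<bar>a - a'\<bar> + \<bar>b - b'\<bar> + \<bar>c - c'\<bar>" for a a' b b' c c' :: real
    by linarith
  have "\<bar>fold_back hi \<theta> e lo \<theta>' e' s - fold_back hi \<theta> e lo \<theta>' e' t\<bar> \<le>
      \<bar>?c s - ?c t\<bar> + \<bar>saw \<theta> e (?r s) - saw \<theta> e (?r t)\<bar> + \<bar>saw \<theta>' e' (?l s) - saw \<theta>' e' (?l t)\<bar>"
    unfolding fold_back_def by (rule tri)
  also have "\<dots> \<le> \<bar>?c s - ?c t\<bar> + \<bar>?r s - ?r t\<bar> + \<bar>?l s - ?l t\<bar>"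
    by (intro add_mono order_refl saws)
  also have "\<bar>?c s - ?c t\<bar> + \<bar>?r s - ?r t\<bar> + \<bar>?l s - ?l t\<bar> = \<bar>s - t\<bar>"
  proof -
    have sum: "?c x + ?r x + ?l x = x" for x using assms(5) by (simp add: max_def min_def)
    have mono: "?c x \<le> ?c y \<and> ?r x \<le> ?r y \<and> ?l x \<le> ?l y" if "x \<le> y" for x y
      using that by (intro conjI max.mono min.mono) auto
    have abs_sum: "\<bar>a - a'\<bar> + \<bar>b - b'\<bar> + \<bar>c - c'\<bar> = \<bar>x - y\<bar>"
      if "a + b + c = x" "a' + b' + c' = y" "x \<le> y \<Longrightarrow> a \<le> a' \<and> b \<le> b' \<and> c \<le> c'"
        "y \<le> x \<Longrightarrow> a' \<le> a \<and> b' \<le> b \<and> c' \<le> c" for a a' b b' c c' x y :: real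
      using that by (cases "x \<le> y") auto
    show ?thesis using abs_sum[of "?c s" "?r s" "?l s" s "?c t" "?r t" "?l t" t] sum[of s] sum[of t] mono[of s t] mono[of t s]
      by blast
  qed
  finally show ?thesis by simp
qed

text \<open>The left slopes are obtained by choice from local statements, and the smaller of the two
  radii serves both sides.\<close>

lemma piecewise_affineI:
  assumes right: "\<And>t. \<exists>\<delta>>0. \<forall>s\<in>{t..<t + \<delta>}. F s = F t + DR t * (s - t) \<and> DR s = DR t"
    and left: "\<And>t. \<exists>\<delta>>0. \<exists>a. \<forall>s\<in>{t - \<delta><..<t}. F s = F t + a * (s - t) \<and> DR s = a"
  obtains DL where "piecewise_affine F DR DL"
proof -
  obtain \<delta>1 where \<delta>1: "\<And>t. \<delta>1 t > 0" "\<And>t s. s \<in> {t..<t + \<delta>1 t} \<Longrightarrow> F s = F t + DR t * (s - t) \<and> DR s = DR t"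
    using right by metis
  obtain \<delta>2 DL where \<delta>2: "\<And>t. \<delta>2 t > 0" "\<And>t s. s \<in> {t - \<delta>2 t<..<t} \<Longrightarrow> F s = F t + DL t * (s - t) \<and> DR s = DL t"
    using left by metis
  have "piecewise_affine F DR DL"
    unfolding piecewise_affine_def
  proof
    fix t
    show "\<exists>\<delta>>0. (\<forall>s\<in>{t..<t + \<delta>}. F s = F t + DR t * (s - t) \<and> DR s = DR t) \<and>
        (\<forall>s\<in>{t - \<delta><..<t}. F s = F t + DL t * (s - t) \<and> DR s = DL t)"
    proof (intro exI[of _ "min (\<delta>1 t) (\<delta>2 t)"] conjI ballI)
      fix s assume "s \<in> {t..<t + min (\<delta>1 t) (\<delta>2 t)}"
      then have "s \<in> {t..<t + \<delta>1 t}" by (auto simp: min_def split: if_splits)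
      from \<delta>1(2)[OF this] show "F s = F t + DR t * (s - t)" "DR s = DR t" by blast+
    next
      fix s assume "s \<in> {t - min (\<delta>1 t) (\<delta>2 t)<..<t}"
      then have "s \<in> {t - \<delta>2 t<..<t}" by auto
      from \<delta>2(2)[OF this] show "F s = F t + DL t * (s - t)" "DR s = DL t" by blast+
    qed (use \<delta>1(1) \<delta>2(1) in auto)
  qed
  then show ?thesis by (rule that)
qed

lemma piecewise_affine_fold_back:
  assumes "e > 0" "e' > 0" "\<theta> \<in> {0..1}" "\<theta>' \<in> {0..1}" "lo < hi"
  obtains DL where "piecewise_affine (fold_back hi \<theta> e lo \<theta>' e') (fold_slope hi \<theta> e lo \<theta>' e') DL"
proof (rule piecewise_affineI[of "fold_back hi \<theta> e lo \<theta>' e'" "fold_slope hi \<theta> e lo \<theta>' e'"])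
  have pos: "0 < e" "0 \<le> \<theta>" "0 < e'" "0 \<le> \<theta>'" using assms by auto
  let ?F = "fold_back hi \<theta> e lo \<theta>' e'" and ?D = "fold_slope hi \<theta> e lo \<theta>' e'"
  note F = fold_back_cases[OF assms(5), of _ \<theta> e \<theta>' e']
  fix t
  show "\<exists>\<delta>>0. \<forall>s\<in>{t..<t + \<delta>}. ?F s = ?F t + ?D t * (s - t) \<and> ?D s = ?D t"
  proof -
    consider "t \<ge> hi" | "t < lo" | "lo \<le> t" "t < hi" by linarith
    then show ?thesis
    proof cases
      case 1
      obtain \<delta> where \<delta>: "\<delta> > 0" "\<And>s. s \<in> {t - hi..<t - hi + \<delta>} \<Longrightarrow>
          saw \<theta> e s = saw \<theta> e (t - hi) + saw_slope \<theta> e (t - hi) * (s - (t - hi)) \<and> saw_slope \<theta> e s = saw_slope \<theta> e (t - hi)"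
        by (rule saw_right[OF pos(1,2), of "t - hi"]) blast
      show ?thesis
      proof (intro exI[of _ \<delta>] conjI ballI \<delta>(1))
        fix s assume s: "s \<in> {t..<t + \<delta>}"
        then show "?F s = ?F t + ?D t * (s - t)" "?D s = ?D t"
          using \<delta>(2)[of "s - hi"] 1 by (auto simp: F(2) fold_slope_def)
      qed
    next
      case 2
      obtain \<delta> where \<delta>: "\<delta> > 0" "\<And>s. s \<in> {t - lo..<t - lo + \<delta>} \<Longrightarrow>
          saw \<theta>' e' s = saw \<theta>' e' (t - lo) + saw_slope \<theta>' e' (t - lo) * (s - (t - lo)) \<and> saw_slope \<theta>' e' s = saw_slope \<theta>' e' (t - lo)"
        by (rule saw_right[OF pos(3,4), of "t - lo"]) blast
      \<comment> \<open>The radius is also limited by \<open>lo - t\<close>, so that all nearby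
        points remain on the lower ray.\<close>
      show ?thesis
      proof (intro exI[of _ "min \<delta> (lo - t)"] conjI ballI)
        fix s assume s: "s \<in> {t..<t + min \<delta> (lo - t)}"
        then show "?F s = ?F t + ?D t * (s - t)" "?D s = ?D t"
          using \<delta>(2)[of "s - lo"] 2 assms(5) by (auto simp: F(3) fold_slope_def)
      qed (use \<delta>(1) 2 in auto)
    next
      case 3
      show ?thesis
        by (rule exI[of _ "hi - t"]) (use 3 in \<open>auto simp: F(1) fold_slope_def\<close>)
    qed
  qed
  show "\<exists>\<delta>>0. \<exists>a. \<forall>s\<in>{t - \<delta><..<t}. ?F s = ?F t + a * (s - t) \<and> ?D s = a"
  proof -
    \<comment> \<open>Seen from the left, \<open>hi\<close> ends the identity and \<open>lo\<close>
      ends the lower ray, the reverse of the assignment for right slopes.\<close>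
    consider "t > hi" | "t \<le> lo" | "lo < t" "t \<le> hi" by linarith
    then show ?thesis
    proof cases
      case 1
      obtain \<delta> a where \<delta>: "\<delta> > 0" "\<And>s. s \<in> {t - hi - \<delta><..<t - hi} \<Longrightarrow>
          saw \<theta> e s = saw \<theta> e (t - hi) + a * (s - (t - hi)) \<and> saw_slope \<theta> e s = a"
        by (rule saw_left[OF pos(1,2), of "t - hi"]) blast
      show ?thesis
      proof (rule exI[of _ "min \<delta> (t - hi)"], intro exI[of _ "- a"] conjI ballI)
        fix s assume s: "s \<in> {t - min \<delta> (t - hi)<..<t}"
        then show "?F s = ?F t + - a * (s - t)" "?D s = - a"
          using \<delta>(2)[of "s - hi"] 1 by (auto simp: F(2) fold_slope_def)
      qed (use \<delta>(1) 1 in auto)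
    next
      case 2
      obtain \<delta> a where \<delta>: "\<delta> > 0" "\<And>s. s \<in> {t - lo - \<delta><..<t - lo} \<Longrightarrow>
          saw \<theta>' e' s = saw \<theta>' e' (t - lo) + a * (s - (t - lo)) \<and> saw_slope \<theta>' e' s = a"
        by (rule saw_left[OF pos(3,4), of "t - lo"]) blast
      show ?thesis
      proof (rule exI[of _ \<delta>], intro exI[of _ a] conjI ballI \<delta>(1))
        fix s assume s: "s \<in> {t - \<delta><..<t}"
        then show "?F s = ?F t + a * (s - t)" "?D s = a"
          using \<delta>(2)[of "s - lo"] 2 assms(5) by (auto simp: F(3) fold_slope_def)
      qed
    next
      case 3
      show ?thesis
        by (rule exI[of _ "t - lo"], intro conjI exI[of _ 1]) (use 3 in \<open>auto simp: F(1) fold_slope_def\<close>)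
    qed
  qed
qed (use that in blast)

section \<open>Measurability and growth bounds along a function, and the regularity result\<close>

lemma borel_measurable_caratheodory:
  fixes L :: "real ^ 'n \<Rightarrow> real \<Rightarrow> real ^ 'n \<Rightarrow> real"
  assumes \<Omega>: "\<Omega> \<in> sets lebesgue" and L: "caratheodory \<Omega> L"
    and u: "u \<in> borel_measurable (lebesgue_on \<Omega>)" and g: "g \<in> borel_measurable (lebesgue_on \<Omega>)"
  shows "(\<lambda>x. L x (u x) (g x)) \<in> borel_measurable (lebesgue_on \<Omega>)"
proof -
  let ?M = "lebesgue_on \<Omega>"
  \<comment> \<open>The pair is a pointwise limit of simple functions. Along a simple function only
    finitely many sections of \<open>L\<close> occur, each measurable in \<open>x\<close>;
    continuity in the other arguments gives the limit.\<close>
  have "(\<lambda>x. (u x, g x)) \<in> borel_measurable ?M" using u g by (rule borel_measurable_Pair)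
  from borel_measurable_implies_sequence_metric[OF this, of 0]
  obtain F :: "nat \<Rightarrow> real ^ 'n \<Rightarrow> real \<times> (real ^ 'n)" where F: "\<And>i. simple_function ?M (F i)"
    "\<And>x. x \<in> \<Omega> \<Longrightarrow> (\<lambda>i. F i x) \<longlonglongrightarrow> (u x, g x)"
    by auto
  have meas: "(\<lambda>x. L x (fst (F i x)) (snd (F i x))) \<in> borel_measurable ?M" for i
  proof (rule measurable_compose_countable'[where f = "\<lambda>y x. L x (fst y) (snd y)" and g = "F i" and I = "F i ` space ?M"])
    show "(\<lambda>x. L x (fst y) (snd y)) \<in> borel_measurable ?M" for y
      using L by (simp add: caratheodory_def)
    show "F i \<in> measurable ?M (count_space (F i ` space ?M))"
      using simple_functionD[OF F(1)[of i]] by (subst measurable_count_space_eq2) auto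
    show "countable (F i ` space ?M)"
      using simple_functionD(1)[OF F(1)[of i]] by (rule countable_finite)
  qed
  have "AE x in ?M. continuous_on UNIV (\<lambda>(t, \<xi>). L x t \<xi>)" using L by (simp add: caratheodory_def)
  then obtain N where N: "N \<in> null_sets ?M" "{x \<in> space ?M. \<not> continuous_on UNIV (\<lambda>(t, \<xi>). L x t \<xi>)} \<subseteq> N"
    by (auto simp: eventually_ae_filter)
  have [measurable]: "N \<in> sets ?M" using N(1) by auto
  \<comment> \<open>The indicator removes a null set containing the points where continuity fails;
    completeness of the measure removes it again at the end.\<close>
  have "(\<lambda>x. indicator (space ?M - N) x * L x (u x) (g x)) \<in> borel_measurable ?M"
  proof (rule borel_measurable_LIMSEQ_metric)
    show "(\<lambda>x. indicator (space ?M - N) x * L x (fst (F i x)) (snd (F i x))) \<in> borel_measurable ?M" for i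
      using meas by measurable
    show "(\<lambda>i. indicator (space ?M - N) x * L x (fst (F i x)) (snd (F i x))) \<longlonglongrightarrow>
        indicator (space ?M - N) x * L x (u x) (g x)" if x: "x \<in> space ?M" for x
    proof (cases "x \<in> N")
      case False
      then have "continuous_on UNIV (\<lambda>(t, \<xi>). L x t \<xi>)" using N(2) x by blast
      from continuous_on_tendsto_compose[OF this F(2)] x
      have "(\<lambda>i. L x (fst (F i x)) (snd (F i x))) \<longlonglongrightarrow> L x (u x) (g x)"
        by (simp add: case_prod_beta)
      then show ?thesis by (intro tendsto_intros)
    qed simp
  qed
  moreover have "AE x in ?M. indicator (space ?M - N) x * L x (u x) (g x) = L x (u x) (g x)"
    using AE_not_in[OF N(1)] AE_space by eventually_elim auto
  ultimately show ?thesis by (rule borel_measurable_lebesgue_on_AE[OF \<Omega>])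
qed

text \<open>A real supremum dominates its members only if the set is bounded above. Continuity on
  the compact interval provides this, and the infimum is bounded below by 0. Each summand is at most
  the sum, which covers both signs of \<open>c\<close>.\<close>

lemma SUP_INF_bound:
  fixes h :: "real \<Rightarrow> real ^ 'n \<Rightarrow> real"
  assumes cont: "continuous_on UNIV (\<lambda>(t, \<xi>). h t \<xi>)" and C: "C \<ge> 0"
    and le: "(SUP s\<in>{a..b}. \<bar>h s (\<theta> *\<^sub>R \<xi>)\<bar> + \<bar>h s (- \<theta> *\<^sub>R \<xi>)\<bar>) \<le> C * (INF s\<in>S. \<bar>h s \<xi>\<bar>) + q"
    and s: "s \<in> {a..b}" "t \<in> S" "c = \<theta> \<or> c = - \<theta>"
  shows "\<bar>h s (c *\<^sub>R \<xi>)\<bar> \<le> C * \<bar>h t \<xi>\<bar> + q"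
proof -
  have "continuous_on {a..b} (\<lambda>s. (\<lambda>(t, \<xi>). h t \<xi>) (s, y))" for y
    by (rule continuous_on_compose2[OF cont]) (auto intro!: continuous_intros)
  then have "continuous_on {a..b} (\<lambda>s. h s y)" for y by simp
  then have "continuous_on {a..b} (\<lambda>s. \<bar>h s (\<theta> *\<^sub>R \<xi>)\<bar> + \<bar>h s (- \<theta> *\<^sub>R \<xi>)\<bar>)"
    by (intro continuous_on_add continuous_on_rabs)
  then have "bdd_above ((\<lambda>s. \<bar>h s (\<theta> *\<^sub>R \<xi>)\<bar> + \<bar>h s (- \<theta> *\<^sub>R \<xi>)\<bar>) ` {a..b})"
    by (intro bounded_imp_bdd_above compact_imp_bounded compact_continuous_image compact_Icc)
  then have "\<bar>h s (\<theta> *\<^sub>R \<xi>)\<bar> + \<bar>h s (- \<theta> *\<^sub>R \<xi>)\<bar> \<le> (SUP s\<in>{a..b}. \<bar>h s (\<theta> *\<^sub>R \<xi>)\<bar> + \<bar>h s (- \<theta> *\<^sub>R \<xi>)\<bar>)"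
    by (rule cSUP_upper[OF s(1)])
  moreover have "(INF s\<in>S. \<bar>h s \<xi>\<bar>) \<le> \<bar>h t \<xi>\<bar>"
    by (rule cINF_lower[OF _ s(2)]) (auto intro: bdd_belowI[of _ 0])
  then have "C * (INF s\<in>S. \<bar>h s \<xi>\<bar>) \<le> C * \<bar>h t \<xi>\<bar>" using C by (rule mult_left_mono)
  ultimately show ?thesis using le s(3) by auto
qed

theorem theorem1p3:
  fixes \<Omega> :: "(real ^ 'n) set"
    and p :: real
    and \<phi> :: "real ^ 'n \<Rightarrow> real"
    and L :: "real ^ 'n \<Rightarrow> real \<Rightarrow> real ^ 'n \<Rightarrow> real"
    and \<theta>p \<theta>m C :: real
    and mp mm \<epsilon> :: "nat \<Rightarrow> real"
    and q :: "real ^ 'n \<Rightarrow> real"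
  assumes "open \<Omega>" and "bounded \<Omega>"
    and "1 \<le> p" and "p \<le> real CARD('n)"
    and "\<phi> \<in> W1p UNIV p \<inter> Linf UNIV"
    and "caratheodory \<Omega> L"
    and "\<theta>p \<in> {0..1}" and "\<theta>m \<in> {0..1}"
    and "filterlim mp at_top sequentially" and "filterlim mm at_top sequentially"
    and "\<forall>i\<ge>1. \<epsilon> i > 0"
    and "integrable (lebesgue_on \<Omega>) q"
    and "C \<ge> 0"
    and "\<forall>i\<ge>1. AE x in lebesgue_on \<Omega>. \<forall>\<xi>.
      (SUP s\<in>{mp i - \<epsilon> i..mp i}. \<bar>L x s (\<theta>p *\<^sub>R \<xi>)\<bar> + \<bar>L x s (- \<theta>p *\<^sub>R \<xi>)\<bar>)
        \<le> C * (INF s\<in>{mp i..}. \<bar>L x s \<xi>\<bar>) + q x"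
    and "\<forall>i\<ge>1. AE x in lebesgue_on \<Omega>. \<forall>\<xi>.
      (SUP s\<in>{- mm i..- mm i + \<epsilon> i}. \<bar>L x s (\<theta>m *\<^sub>R \<xi>)\<bar> + \<bar>L x s (- \<theta>m *\<^sub>R \<xi>)\<bar>)
        \<le> C * (INF s\<in>{..- mm i}. \<bar>L x s \<xi>\<bar>) + q x"
  shows "\<forall>u \<in> admissible \<Omega> p \<phi> L. Linf_regular_at \<Omega> p \<phi> L u"
proof
  fix u assume u: "u \<in> admissible \<Omega> p \<phi> L"
  interpret bounded_domain \<Omega> p by unfold_locales (use assms in auto)
  obtain w where w: "w \<in> W1p_zero \<Omega> p" "u = (\<lambda>x. \<phi> x + w x)" and Lu: "integrable (lebesgue_on \<Omega>) (lagrangian_along \<Omega> L u)"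
    using u by (auto simp: admissible_def W1p_boundary_def)
  obtain g\<phi> where \<phi>: "sobolev \<phi> g\<phi>" using sobolev_restrict assms(5) by blast
  have "sobolev w (weak_gradient \<Omega> w)" using w(1) W1p_imp_sobolev by (simp add: W1p_zero_def)
  from sobolev_add[OF \<phi> this] have "u \<in> W1p \<Omega> p" unfolding w(2) by (rule sobolev_imp_W1p)
  define g where "g = weak_gradient \<Omega> u"
  have su: "sobolev u g" unfolding g_def by (rule W1p_imp_sobolev[OF \<open>u \<in> W1p \<Omega> p\<close>])
  note sud = sobolevD[OF su]
  obtain M where "AE x in lebesgue_on UNIV. \<bar>\<phi> x\<bar> \<le> M" using assms(5) by (auto simp: Linf_def)
  then have "AE x in lebesgue. \<bar>\<phi> x\<bar> \<le> M" unfolding lebesgue_on_UNIV_eq .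
  then have M: "AE x in lebesgue_on \<Omega>. \<bar>\<phi> x\<bar> \<le> M"
    unfolding AE_lebesgue_on_iff[OF \<Omega>_sets] by eventually_elim simp
  have "eventually (\<lambda>i. mp i \<ge> \<bar>M\<bar> + 1) sequentially" "eventually (\<lambda>i. mm i \<ge> \<bar>M\<bar> + 1) sequentially"
    using assms(9,10) by (auto simp: filterlim_at_top)
  then have "eventually (\<lambda>i. mp i \<ge> \<bar>M\<bar> + 1 \<and> mm i \<ge> \<bar>M\<bar> + 1) sequentially" by eventually_elim simp
  then obtain N0 where N0: "\<And>i. i \<ge> N0 \<Longrightarrow> mp i \<ge> \<bar>M\<bar> + 1 \<and> mm i \<ge> \<bar>M\<bar> + 1"
    by (auto simp: eventually_sequentially)
  \<comment> \<open>The shift by \<open>N0\<close> puts the essential range of \<open>\<phi>\<close>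
    between the levels, and the final 1 makes the index admissible for hypotheses that start at 1.
    The levels exceed \<open>\<bar>M\<bar> + 1 > 0\<close>, so 0 lies between them too.\<close>
  define I where "I k = k + N0 + 1" for k
  have I: "I k \<ge> 1" "mp (I k) \<ge> \<bar>M\<bar> + 1" "mm (I k) \<ge> \<bar>M\<bar> + 1" for k using N0[of "I k"] by (auto simp: I_def)
  have I_lim: "filterlim I at_top sequentially"
    unfolding I_def by (rule filterlim_at_top_mono[OF filterlim_ident]) auto
  define e where "e k = \<epsilon> (I k)" for k
  define hi where "hi k = mp (I k)" for k
  define lo where "lo k = - mm (I k)" for k
  have e: "e k > 0" for k using assms(11) I(1) by (simp add: e_def)
  have hl: "lo k < 0" "hi k > 0" "lo k < hi k" "M \<le> hi k" "lo k \<le> - M" for k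
    using I(2,3)[of k] by (auto simp: hi_def lo_def)
  \<comment> \<open>Strict at the top, since the right slope at \<open>hi k\<close> is already that
    of the folded ray.\<close>
  have inside: "eventually (\<lambda>k. lo k \<le> t \<and> t < hi k) sequentially" for t
  proof -
    have "filterlim hi at_top sequentially" "filterlim (\<lambda>k. mm (I k)) at_top sequentially"
      unfolding hi_def using filterlim_compose[OF assms(9) I_lim] filterlim_compose[OF assms(10) I_lim] by auto
    then have "eventually (\<lambda>k. hi k > t) sequentially" "eventually (\<lambda>k. mm (I k) > - t) sequentially"
      by (auto simp: filterlim_at_top_dense)
    then show ?thesis by eventually_elim (auto simp: lo_def)
  qed
  define F where "F k = fold_back (hi k) \<theta>p (e k) (lo k) \<theta>m (e k)" for k
  define D where "D k = fold_slope (hi k) \<theta>p (e k) (lo k) \<theta>m (e k)" for k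
  have lip: "\<bar>F k s - F k t\<bar> \<le> 1 * \<bar>s - t\<bar>" for k s t
    unfolding F_def by (rule fold_back_lipschitz[OF e e assms(7,8) hl(3)])
  have aff: "\<exists>DL. piecewise_affine (F k) (D k) DL" for k
    unfolding F_def D_def using piecewise_affine_fold_back[OF e e assms(7,8) hl(3)] by blast
  have der: "(F k has_real_derivative D k t) (at_right t)" for k t
    using aff[of k] piecewise_affine_right by blast
  have F_mid: "F k t = t" if "lo k \<le> t" "t \<le> hi k" for k t
    unfolding F_def by (rule fold_back_cases(1)[OF hl(3) that])
  have F_hi: "F k t \<in> {hi k - e k..hi k}" if "t \<ge> hi k" for k t
    unfolding F_def fold_back_cases(2)[OF hl(3) that] using saw_bounds[OF e] by auto
  have F_lo: "F k t \<in> {lo k..lo k + e k}" if "t \<le> lo k" for k t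
    unfolding F_def fold_back_cases(3)[OF hl(3) that] using saw_bounds[OF e] by auto
  have D_mid: "D k t = 1" if "lo k \<le> t" "t < hi k" for k t using that by (simp add: D_def fold_slope_def)
  have D_hi: "D k t = \<theta>p \<or> D k t = - \<theta>p" if "t \<ge> hi k" for k t
    using that saw_slope_cases[of \<theta>p "e k" "t - hi k"] by (auto simp: D_def fold_slope_def)
  have D_lo: "D k t = \<theta>m \<or> D k t = - \<theta>m" if "t < lo k" for k t
    using that hl(3)[of k] saw_slope_cases[of \<theta>m "e k" "t - lo k"] by (auto simp: D_def fold_slope_def)
  define v where "v k x = F k (u x)" for k x
  have sv: "sobolev (v k) (\<lambda>x. D k (u x) *\<^sub>R g x)" for k
    unfolding v_def by (rule sobolev_chain[OF su lip der])
  have Dm: "(\<lambda>x. D k (u x)) \<in> borel_measurable (lebesgue_on \<Omega>)" and D1: "\<bar>D k t\<bar> \<le> 1" for k t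
    using chain_rule_right(2,3)[OF \<Omega> sud(3,4,5) lip der] by blast+
  have v_boundary: "v k \<in> W1p_boundary \<Omega> p \<phi>" for k
  proof -
    obtain DL where "piecewise_affine (F k) (D k) DL" using aff by blast
    from W1p_zero_compose[OF \<phi> w(1) lip this]
    have "(\<lambda>x. F k (\<phi> x + w x) - F k (\<phi> x)) \<in> W1p_zero \<Omega> p" .
    \<comment> \<open>Here \<open>F k\<close> fixes \<open>\<phi> x\<close>, because
      \<open>\<bar>\<phi> x\<bar> \<le> M\<close> almost everywhere and \<open>M\<close> is below
      both levels.\<close>
    moreover have "AE x in lebesgue_on \<Omega>. F k (\<phi> x + w x) - F k (\<phi> x) = v k x - \<phi> x"
      using M by eventually_elim (use hl[of k] in \<open>simp add: v_def w(2) F_mid abs_le_iff\<close>)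
    ultimately have "(\<lambda>x. v k x - \<phi> x) \<in> W1p_zero \<Omega> p" by (rule W1p_zero_cong_AE)
    then show ?thesis unfolding W1p_boundary_def by force
  qed
  have v_Linf: "v k \<in> Linf \<Omega>" for k
  proof -
    have "\<bar>v k x\<bar> \<le> \<bar>hi k\<bar> + \<bar>lo k\<bar> + e k" for x
    proof -
      consider "u x \<ge> hi k" | "u x \<le> lo k" | "lo k \<le> u x" "u x \<le> hi k" by linarith
      then show ?thesis
        using F_hi[where k = k and t = "u x"] F_lo[where k = k and t = "u x"] F_mid[where k = k and t = "u x"] e[of k] hl[of k]
        unfolding v_def by cases auto
    qed
    then show ?thesis using sobolevD(6)[OF sv] unfolding Linf_def by blast
  qed
  \<comment> \<open>The Lagrangian along \<open>v k\<close> with the explicit gradient; it agrees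
    with \<open>lagrangian_along\<close> almost everywhere, as \<open>weak_gradient\<close> is
    another representative.\<close>
  define \<Lambda> where "\<Lambda> k x = L x (v k x) (D k (u x) *\<^sub>R g x)" for k x
  have \<Lambda>_ae: "AE x in lebesgue_on \<Omega>. lagrangian_along \<Omega> L (v k) x = \<Lambda> k x" for k
    using sobolev_weak_gradient[OF sv[of k]] by eventually_elim (simp add: lagrangian_along_def \<Lambda>_def)
  have \<Lambda>u: "lagrangian_along \<Omega> L u x = L x (u x) (g x)" for x by (simp add: lagrangian_along_def g_def)
  have \<Lambda>_meas: "\<Lambda> k \<in> borel_measurable (lebesgue_on \<Omega>)" for k
    unfolding \<Lambda>_def by (rule borel_measurable_caratheodory[OF \<Omega>_sets assms(6) sobolevD(6,7)[OF sv]])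
  have L_meas: "(\<lambda>x. lagrangian_along \<Omega> L (v k) x) \<in> borel_measurable (lebesgue_on \<Omega>)" for k
    unfolding lagrangian_along_def
    by (rule borel_measurable_caratheodory[OF \<Omega>_sets assms(6) sobolevD(6)[OF sv]
          sobolevD(7)[OF W1p_imp_sobolev[OF sobolev_imp_W1p[OF sv]]]])
  have \<Lambda>_mid: "\<Lambda> k x = L x (u x) (g x)" if "lo k \<le> u x" "u x < hi k" for k x
    using that by (simp add: \<Lambda>_def v_def F_mid D_mid)
  \<comment> \<open>On the folded parts the slope is one of the two signed multiples in the
    hypothesis and \<open>v k x\<close> lies in its window. The constant is \<open>C + 1\<close>
    because between the levels the integrand is the original one, and \<open>C\<close> may be less
    than 1.\<close>
  have \<Lambda>_bound: "AE x in lebesgue_on \<Omega>. \<bar>\<Lambda> k x\<bar> \<le> (C + 1) * \<bar>L x (u x) (g x)\<bar> + \<bar>q x\<bar>" for k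
  proof -
    have "AE x in lebesgue_on \<Omega>. continuous_on UNIV (\<lambda>(t, \<xi>). L x t \<xi>)"
      using assms(6) by (simp add: caratheodory_def)
    moreover note assms(14)[rule_format, OF I(1)[of k], folded hi_def e_def]
    moreover note assms(15)[rule_format, OF I(1)[of k], folded lo_def e_def]
    ultimately show ?thesis
    proof eventually_elim
      case (elim x)
      have *: "C * \<bar>L x (u x) (g x)\<bar> + q x \<le> (C + 1) * \<bar>L x (u x) (g x)\<bar> + \<bar>q x\<bar>"
        "\<bar>L x (u x) (g x)\<bar> \<le> (C + 1) * \<bar>L x (u x) (g x)\<bar> + \<bar>q x\<bar>"
        using assms(13) by (auto simp: algebra_simps)
      consider "u x \<ge> hi k" | "u x < lo k" | "lo k \<le> u x" "u x < hi k" by linarith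
      then show ?case
      proof cases
        case 1
        have "\<bar>L x (v k x) (D k (u x) *\<^sub>R g x)\<bar> \<le> C * \<bar>L x (u x) (g x)\<bar> + q x"
          by (rule SUP_INF_bound[OF elim(1) assms(13) elim(2)[rule_format, of "g x"]])
            (use 1 F_hi[where k = k and t = "u x"] D_hi[where k = k and t = "u x"] in \<open>auto simp: v_def\<close>)
        then show ?thesis using *(1) by (simp add: \<Lambda>_def)
      next
        case 2
        have "\<bar>L x (v k x) (D k (u x) *\<^sub>R g x)\<bar> \<le> C * \<bar>L x (u x) (g x)\<bar> + q x"
          by (rule SUP_INF_bound[OF elim(1) assms(13) elim(3)[rule_format, of "g x"]])
            (use 2 F_lo[where k = k and t = "u x"] D_lo[where k = k and t = "u x"] in \<open>auto simp: v_def\<close>)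
        then show ?thesis using *(1) by (simp add: \<Lambda>_def)
      next
        case 3
        then show ?thesis using *(2) by (simp add: \<Lambda>_mid)
      qed
    qed
  qed
  have Lu': "integrable (lebesgue_on \<Omega>) (\<lambda>x. L x (u x) (g x))"
    using Lu by (simp add: \<Lambda>u[abs_def])
  have dom: "integrable (lebesgue_on \<Omega>) (\<lambda>x. (C + 1) * \<bar>L x (u x) (g x)\<bar> + \<bar>q x\<bar>)"
    using Lu' assms(12) by auto
  have \<Lambda>_int: "integrable (lebesgue_on \<Omega>) (\<Lambda> k)" for k
    by (rule Bochner_Integration.integrable_bound[OF dom \<Lambda>_meas])
      (use \<Lambda>_bound[of k] in \<open>eventually_elim, simp\<close>)
  have Lv_int: "integrable (lebesgue_on \<Omega>) (lagrangian_along \<Omega> L (v k))" for k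
    by (rule integrable_lebesgue_on_cong_AE[OF \<Omega>_sets \<Lambda>_int]) (use \<Lambda>_ae[of k] in \<open>eventually_elim, simp\<close>)
  have adm: "v k \<in> admissible \<Omega> p \<phi> L" for k
    using v_boundary Lv_int by (simp add: admissible_def)
  \<comment> \<open>At each fixed value the fold is eventually the identity with slope 1, so the
    differences below are eventually 0 at every point.\<close>
  have mid_ev: "eventually (\<lambda>k. F k t = t \<and> D k t = 1) sequentially" for t
    using inside[of t] by eventually_elim (auto simp: F_mid D_mid)
  have lag_lim: "(\<lambda>k. LINT x|lebesgue_on \<Omega>. \<bar>lagrangian_along \<Omega> L (v k) x - lagrangian_along \<Omega> L u x\<bar>) \<longlonglongrightarrow> 0"
  proof -
    have "(\<lambda>k. LINT x|lebesgue_on \<Omega>. \<bar>\<Lambda> k x - L x (u x) (g x)\<bar>) \<longlonglongrightarrow> (LINT x|lebesgue_on \<Omega>. (0 :: real))"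
    proof (rule integral_dominated_convergence[where w = "\<lambda>x. ((C + 1) * \<bar>L x (u x) (g x)\<bar> + \<bar>q x\<bar>) + \<bar>L x (u x) (g x)\<bar>"])
      show "AE x in lebesgue_on \<Omega>. (\<lambda>k. \<bar>\<Lambda> k x - L x (u x) (g x)\<bar>) \<longlonglongrightarrow> 0"
      proof (rule AE_I2, rule tendsto_eventually)
        fix x
        show "\<forall>\<^sub>F k in sequentially. \<bar>\<Lambda> k x - L x (u x) (g x)\<bar> = 0"
          using inside[of "u x"] by eventually_elim (simp add: \<Lambda>_mid)
      qed
      show "AE x in lebesgue_on \<Omega>. norm \<bar>\<Lambda> k x - L x (u x) (g x)\<bar> \<le>
          ((C + 1) * \<bar>L x (u x) (g x)\<bar> + \<bar>q x\<bar>) + \<bar>L x (u x) (g x)\<bar>" for k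
        using \<Lambda>_bound[of k] by eventually_elim simp
    qed (use dom Lu' \<Lambda>_meas in auto)
    moreover have "(LINT x|lebesgue_on \<Omega>. \<bar>lagrangian_along \<Omega> L (v k) x - lagrangian_along \<Omega> L u x\<bar>)
        = (LINT x|lebesgue_on \<Omega>. \<bar>\<Lambda> k x - L x (u x) (g x)\<bar>)" for k
    proof (rule integral_cong_AE)
      show "AE x in lebesgue_on \<Omega>. \<bar>lagrangian_along \<Omega> L (v k) x - lagrangian_along \<Omega> L u x\<bar> = \<bar>\<Lambda> k x - L x (u x) (g x)\<bar>"
        using \<Lambda>_ae[of k] by eventually_elim (simp add: \<Lambda>u)
    qed (use L_meas[of k] \<Lambda>_meas[of k] Lu Lu' in auto)
    ultimately show ?thesis by simp
  qed
  have norm_lim: "(\<lambda>k. W1p_norm \<Omega> p (\<lambda>x. v k x - u x)) \<longlonglongrightarrow> 0"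
  proof -
    have sd: "sobolev (\<lambda>x. v k x - u x) (\<lambda>x. D k (u x) *\<^sub>R g x - g x)" for k
      by (rule sobolev_diff[OF sv su])
    have "(\<lambda>k. LINT x|lebesgue_on \<Omega>. norm (v k x - u x) powr p) \<longlonglongrightarrow> (LINT x|lebesgue_on \<Omega>. (0 :: real))"
    proof (rule integral_dominated_convergence[where w = "\<lambda>x. 2 powr p * norm (u x) powr p"])
      show "AE x in lebesgue_on \<Omega>. (\<lambda>k. norm (v k x - u x) powr p) \<longlonglongrightarrow> 0"
      proof (rule AE_I2, rule tendsto_eventually)
        fix x
        show "\<forall>\<^sub>F k in sequentially. norm (v k x - u x) powr p = 0"
          using mid_ev[of "u x"] by eventually_elim (simp add: v_def)
      qed
      show "AE x in lebesgue_on \<Omega>. norm (norm (v k x - u x) powr p) \<le> 2 powr p * norm (u x) powr p" for k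
      proof (rule AE_I2)
        fix x
        \<comment> \<open>A 1-Lipschitz map fixing 0 satisfies
          \<open>\<bar>F k (u x)\<bar> \<le> \<bar>u x\<bar>\<close>, whence the majorant
          independent of \<open>k\<close>.\<close>
        have "F k 0 = 0" using hl[of k] by (intro F_mid) auto
        then have "norm (v k x - u x) \<le> 2 * norm (u x)" using lip[of k "u x" 0] by (simp add: v_def)
        then have "norm (v k x - u x) powr p \<le> (2 * norm (u x)) powr p" using p by (intro powr_mono2) auto
        then show "norm (norm (v k x - u x) powr p) \<le> 2 powr p * norm (u x) powr p" by (simp add: powr_mult)
      qed
    qed (use sobolevD(1)[OF sd] sud(1) in \<open>auto simp: Lp_def\<close>)
    moreover have "(\<lambda>k. LINT x|lebesgue_on \<Omega>. norm (D k (u x) *\<^sub>R g x - g x) powr p) \<longlonglongrightarrow> (LINT x|lebesgue_on \<Omega>. (0 :: real))"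
    proof (rule integral_dominated_convergence[where w = "\<lambda>x. 2 powr p * norm (g x) powr p"])
      show "AE x in lebesgue_on \<Omega>. (\<lambda>k. norm (D k (u x) *\<^sub>R g x - g x) powr p) \<longlonglongrightarrow> 0"
      proof (rule AE_I2, rule tendsto_eventually)
        fix x
        show "\<forall>\<^sub>F k in sequentially. norm (D k (u x) *\<^sub>R g x - g x) powr p = 0"
          using mid_ev[of "u x"] by eventually_elim simp
      qed
      show "AE x in lebesgue_on \<Omega>. norm (norm (D k (u x) *\<^sub>R g x - g x) powr p) \<le> 2 powr p * norm (g x) powr p" for k
      proof (rule AE_I2)
        fix x
        have "norm (D k (u x) *\<^sub>R g x - g x) \<le> \<bar>D k (u x)\<bar> * norm (g x) + norm (g x)"
          using norm_triangle_ineq4[of "D k (u x) *\<^sub>R g x" "g x"] by simp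
        also have "\<dots> \<le> 1 * norm (g x) + norm (g x)" by (intro add_right_mono mult_right_mono D1) auto
        finally have "norm (D k (u x) *\<^sub>R g x - g x) powr p \<le> (2 * norm (g x)) powr p"
          using p by (intro powr_mono2) auto
        then show "norm (norm (D k (u x) *\<^sub>R g x - g x) powr p) \<le> 2 powr p * norm (g x) powr p" by (simp add: powr_mult)
      qed
    qed (use sobolevD(2)[OF sd] sud(2) in \<open>auto simp: Lp_def\<close>)
    ultimately have "(\<lambda>k. energy (\<lambda>x. v k x - u x) (\<lambda>x. D k (u x) *\<^sub>R g x - g x)) \<longlonglongrightarrow> 0"
      unfolding energy_def by (auto intro: tendsto_add_zero)
    then have "(\<lambda>k. energy (\<lambda>x. v k x - u x) (\<lambda>x. D k (u x) *\<^sub>R g x - g x) powr (1 / p)) \<longlonglongrightarrow> 0 powr (1 / p)"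
      using p energy_nonneg by (intro tendsto_powr') auto
    then show ?thesis by (simp add: W1p_norm_eq[OF sd])
  qed
  show "Linf_regular_at \<Omega> p \<phi> L u"
    unfolding Linf_regular_at_def using adm v_Linf norm_lim lag_lim by blast
qed

end
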